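(* Let $K$ be a complete discrete valuation field whose residue field $k_K$ has characteristic $p>0$ and satisfies $|k_K:k_K^p|<\infty$. Let $L/K$ be a finite Galois well ramified $p$-extension, and put $K_0=L\cap K_{\mathrm{ur}}$, where $K_{\mathrm{ur}}$ is the maximal unramified extension of $K$. Then there is a Galois subextension $T/K_0$ of $L/K_0$ such that $T/K_0$ is in case I and $L/T$ is in case II.
   Context: For a finite extension $L/K$ of complete discrete valuation fields, $\mathcal{O}_L$ is the valuation ring and $k_L$ the residue field of $L$. A finite Galois $p$-extension $L/K$ is well ramified if $\mathcal{O}_L=\mathcal{O}_K[\alpha]$ for some $\alpha\in L$. An extension $L/K$ is in case I if $k_L/k_K$ is separable; it is in case II if $|L:K|=|k_L:k_K|$ and $k_L=k_K(a)$ for some $a$, purely inseparable over $k_K$. *)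

theory Defs
  imports "HOL-Algebra.Algebra" "HOL-Library.Extended_Real"
begin

text \<open>All fields live inside an ambient field Omega (an algebraic closure of K),
  carrying a real-valued (rank one) valuation w with values in ereal, w x = \<infinity> iff x = 0.
  For a subfield E of Omega, the valuation ring, maximal ideal and residue field of E are
  taken with respect to the restriction of w to E.  Since K is complete, the
  valuation of K extends uniquely to every finite extension, so these are the
  valuation rings / residue fields of the paper.\<close>

definition valuation :: "('a, 'b) ring_scheme \<Rightarrow> ('a \<Rightarrow> ereal) \<Rightarrow> bool" where
  "valuation \<Omega> w \<longleftrightarrow>
     (\<forall>x\<in>carrier \<Omega>. w x = \<infinity> \<longleftrightarrow> x = \<zero>\<^bsub>\<Omega>\<^esub>) \<and>
     (\<forall>x\<in>carrier \<Omega>. w x \<noteq> -\<infinity>) \<and>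
     (\<forall>x\<in>carrier \<Omega>. \<forall>y\<in>carrier \<Omega>. w (x \<otimes>\<^bsub>\<Omega>\<^esub> y) = w x + w y) \<and>
     (\<forall>x\<in>carrier \<Omega>. \<forall>y\<in>carrier \<Omega>. min (w x) (w y) \<le> w (x \<oplus>\<^bsub>\<Omega>\<^esub> y))"

definition discrete_on :: "('a, 'b) ring_scheme \<Rightarrow> ('a \<Rightarrow> ereal) \<Rightarrow> 'a set \<Rightarrow> bool" where
  "discrete_on \<Omega> w K \<longleftrightarrow>
     (\<exists>c::real. c > 0 \<and> w ` (K - {\<zero>\<^bsub>\<Omega>\<^esub>}) = {ereal (c * real_of_int n) | n. True})"

definition complete_on :: "('a, 'b) ring_scheme \<Rightarrow> ('a \<Rightarrow> ereal) \<Rightarrow> 'a set \<Rightarrow> bool" where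
  "complete_on \<Omega> w K \<longleftrightarrow>
     (\<forall>s :: nat \<Rightarrow> 'a. (\<forall>n. s n \<in> K) \<longrightarrow>
        (\<forall>M::real. \<exists>N. \<forall>i j. N \<le> i \<longrightarrow> N \<le> j \<longrightarrow> ereal M \<le> w (s i \<ominus>\<^bsub>\<Omega>\<^esub> s j)) \<longrightarrow>
        (\<exists>x\<in>K. \<forall>M::real. \<exists>N. \<forall>i. N \<le> i \<longrightarrow> ereal M \<le> w (s i \<ominus>\<^bsub>\<Omega>\<^esub> x)))"

definition vring :: "('a \<Rightarrow> ereal) \<Rightarrow> 'a set \<Rightarrow> 'a set" where
  "vring w E = {x \<in> E. 0 \<le> w x}"

definition vmax :: "('a \<Rightarrow> ereal) \<Rightarrow> 'a set \<Rightarrow> 'a set" where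
  "vmax w E = {x \<in> E. 0 < w x}"

definition residue_field :: "('a, 'b) ring_scheme \<Rightarrow> ('a \<Rightarrow> ereal) \<Rightarrow> 'a set \<Rightarrow> 'a set ring" where
  "residue_field \<Omega> w E = (\<Omega>\<lparr>carrier := vring w E\<rparr>) Quot (vmax w E)"

text \<open>The image of k_F inside k_E (for F a subfield of E), via a + m_F maps to a + m_E.\<close>
definition res_img :: "('a, 'b) ring_scheme \<Rightarrow> ('a \<Rightarrow> ereal) \<Rightarrow> 'a set \<Rightarrow> 'a set \<Rightarrow> 'a set set" where
  "res_img \<Omega> w F E = {a_r_coset \<Omega> (vmax w E) a | a. a \<in> vring w F}"

definition res_deg :: "('a, 'b) ring_scheme \<Rightarrow> ('a \<Rightarrow> ereal) \<Rightarrow> 'a set \<Rightarrow> 'a set \<Rightarrow> nat" where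
  "res_deg \<Omega> w F E = ring.dim (residue_field \<Omega> w E) (res_img \<Omega> w F E) (carrier (residue_field \<Omega> w E))"

text \<open>Formal derivative of a polynomial (coefficient list, leading coefficient first).\<close>
definition poly_deriv :: "('a, 'b) ring_scheme \<Rightarrow> 'a list \<Rightarrow> 'a list" where
  "poly_deriv R p = ring.normalize R
     (map2 (\<lambda>c (i::nat). add_pow R i c) (butlast p) (rev [1..<length p]))"

definition separable_poly :: "('a, 'b) ring_scheme \<Rightarrow> 'a set \<Rightarrow> 'a list \<Rightarrow> bool" where
  "separable_poly R F f \<longleftrightarrow>
     (\<forall>d\<in>carrier (univ_poly R F).
        d divides\<^bsub>univ_poly R F\<^esub> f \<and> d divides\<^bsub>univ_poly R F\<^esub> poly_deriv R f \<longrightarrow> degree d = 0)"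

definition separable_ext :: "('a, 'b) ring_scheme \<Rightarrow> 'a set \<Rightarrow> bool" where
  "separable_ext R F \<longleftrightarrow>
     (\<forall>a\<in>carrier R. ring.algebraic R F a \<and> separable_poly R F (ring.Irr R F a))"

definition gal :: "('a, 'b) ring_scheme \<Rightarrow> 'a set \<Rightarrow> 'a set \<Rightarrow> ('a \<Rightarrow> 'a) set" where
  "gal \<Omega> F E = {\<sigma>. \<sigma> \<in> ring_iso (\<Omega>\<lparr>carrier := E\<rparr>) (\<Omega>\<lparr>carrier := E\<rparr>) \<and>
                    (\<forall>x\<in>F. \<sigma> x = x) \<and> \<sigma> \<in> extensional E}"

definition galois :: "('a, 'b) ring_scheme \<Rightarrow> 'a set \<Rightarrow> 'a set \<Rightarrow> bool" where
  "galois \<Omega> F E \<longleftrightarrow> subfield F \<Omega> \<and> subfield E \<Omega> \<and> F \<subseteq> E \<and>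
     ring.finite_dimension \<Omega> F E \<and> card (gal \<Omega> F E) = ring.dim \<Omega> F E"

definition unramified_fin :: "('a, 'b) ring_scheme \<Rightarrow> ('a \<Rightarrow> ereal) \<Rightarrow> 'a set \<Rightarrow> 'a set \<Rightarrow> bool" where
  "unramified_fin \<Omega> w F E \<longleftrightarrow> subfield E \<Omega> \<and> F \<subseteq> E \<and> ring.finite_dimension \<Omega> F E \<and>
     w ` (E - {\<zero>\<^bsub>\<Omega>\<^esub>}) = w ` (F - {\<zero>\<^bsub>\<Omega>\<^esub>}) \<and>
     separable_ext (residue_field \<Omega> w E) (res_img \<Omega> w F E)"

definition K_ur :: "('a, 'b) ring_scheme \<Rightarrow> ('a \<Rightarrow> ereal) \<Rightarrow> 'a set \<Rightarrow> 'a set" where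
  "K_ur \<Omega> w K = \<Union> {E. unramified_fin \<Omega> w K E}"

definition well_ramified :: "('a, 'b) ring_scheme \<Rightarrow> ('a \<Rightarrow> ereal) \<Rightarrow> 'a set \<Rightarrow> 'a set \<Rightarrow> bool" where
  "well_ramified \<Omega> w K L \<longleftrightarrow>
     (\<exists>\<alpha>\<in>L. vring w L = generate_ring \<Omega> (insert \<alpha> (vring w K)))"

definition case_I :: "('a, 'b) ring_scheme \<Rightarrow> ('a \<Rightarrow> ereal) \<Rightarrow> 'a set \<Rightarrow> 'a set \<Rightarrow> bool" where
  "case_I \<Omega> w F E \<longleftrightarrow> separable_ext (residue_field \<Omega> w E) (res_img \<Omega> w F E)"

text \<open>Case II (p = residue characteristic): |E:F| = |k_E:k_F| and k_E = k_F(a) with a purely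
  inseparable over k_F, i.e. a^(p^n) in k_F for some n.\<close>
definition case_II :: "('a, 'b) ring_scheme \<Rightarrow> ('a \<Rightarrow> ereal) \<Rightarrow> nat \<Rightarrow> 'a set \<Rightarrow> 'a set \<Rightarrow> bool" where
  "case_II \<Omega> w p F E \<longleftrightarrow>
     ring.finite_dimension \<Omega> F E \<and>
     ring.finite_dimension (residue_field \<Omega> w E) (res_img \<Omega> w F E) (carrier (residue_field \<Omega> w E)) \<and>
     ring.dim \<Omega> F E = res_deg \<Omega> w F E \<and>
     (\<exists>a\<in>carrier (residue_field \<Omega> w E).
        carrier (residue_field \<Omega> w E) = generate_field (residue_field \<Omega> w E) (insert a (res_img \<Omega> w F E)) \<and>
        (\<exists>n::nat. a [^]\<^bsub>residue_field \<Omega> w E\<^esub> (p ^ n) \<in> res_img \<Omega> w F E))"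

end

theory Submission
  imports Defs
begin

text \<open>
  Let \<open>E\<close> be the fixed field of the inertia group of \<open>L/K\<close>. By Newton approximation and a trace
  argument, \<open>k\<^sub>L/k\<^sub>E\<close> is purely inseparable and \<open>E = L \<inter> K\<^sub>u\<^sub>r\<close>. Write \<open>O\<^sub>L = O\<^sub>K[\<alpha>]\<close> and let \<open>q\<close> be least
  such that \<open>\<alpha>^(p^q)\<close> is congruent to an element of \<open>E\<close>; the residues of the powers of \<open>\<alpha>\<close> below
  \<open>p^q\<close> form a basis of \<open>k\<^sub>L/k\<^sub>E\<close>. Starting from \<open>M = L\<close> we descend \<open>q\<close> times. Among the elements of
  inertia acting nontrivially on \<open>M\<close>, the one that moves \<open>\<alpha>\<close> least acts on \<open>M\<close> centrally and with
  order \<open>p\<close>. It moves a lift \<open>y\<close> of the generator of \<open>k\<^sub>M/k\<^sub>E\<close> least possible and the maximal ideal by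
  more, so the expansion in \<open>y\<close> of an element it fixes has vanishing derivative in \<open>k\<^sub>M\<close>; the residue
  field of its fixed field is therefore generated by the residue of \<open>y^p\<close>. After \<open>q\<close> steps we reach a
  field \<open>T\<close> with \<open>k\<^sub>T = k\<^sub>E\<close> and \<open>|L:T| \<le> p^q = |k\<^sub>L:k\<^sub>T|\<close>, which forces equality.
\<close>

section \<open>Linear algebra and automorphisms of fields\<close>

text \<open>Inertia acts trivially on residue fields, so a subgroup of order p may cut down the
  value group instead of the residue field; the difficulty is to force every step to be of the
  second kind. The tool is a comparison of the valuations w (t z - z): for a polynomial f with
  integral coefficients fixed by t, w (t f(z) - f(z)) equals w (t z - z) if f'(z) is a unit and is
  larger if f'(z) lies in the maximal ideal and t z differs from z. Since O_L = O_K[\<alpha>], a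
  uniformizer of M can be taken in E or of the form y^n - a with a in E and p dividing n, and the
  derivative of X^n is divisible by p; hence these valuations are larger on the maximal ideal than
  at y. Centrality of t keeps the fixed field stable under inertia, which the next step and the
  Galois property of T/E both require. Only upper bounds for degrees are carried along. Residue
  classes are handled as inequalities 0 < w (x - y) between representatives; the quotient rings of
  the statement enter only where separability, case I and case II are read off or
  established.\<close>

lemma (in ring) finsum_in_subring:
  assumes "subring M R" "\<And>i. i \<in> A \<Longrightarrow> f i \<in> M"
  shows "finsum R f A \<in> M"
proof (cases "finite A")
  case True
  have MR: "M \<subseteq> carrier R" using subringE(1)[OF assms(1)] .
  show ?thesis using True assms(2)
  proof (induction A)
    case empty thus ?case using subringE(2)[OF assms(1)] by simp
  next
    case (insert a A)
    then have "f \<in> A \<rightarrow> carrier R" "f a \<in> carrier R" using MR by auto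
    then show ?case using insert subringE(7)[OF assms(1)] by (simp add: finsum_insert)
  qed
next
  case False
  thus ?thesis using subringE(2)[OF assms(1)] by (simp add: finsum_infinite)
qed

lemma (in field) subfield_inv:
  assumes "subfield M R" "x \<in> M" "x \<noteq> \<zero>"
  shows "inv x \<in> M"
  using subfield_m_inv(1)[OF assms(1)] assms(2,3) by auto

text \<open>Gaussian elimination, by induction on the equations. If equation i has a nonzero
  coefficient at b0, the unknown b0 is eliminated from the others (coefficients \<open>a'\<close>),
  the smaller system is solved, and b0 is recovered from equation i. In
  \<open>artin_independent_bound\<close> the equations are indexed by automorphisms, in
  \<open>dedekind_bound\<close> by basis vectors.\<close>

lemma (in field) homogeneous_system:
  assumes M: "subfield M R" and "finite A" "finite B" "card A < card B"
    and "\<And>i b. i \<in> A \<Longrightarrow> b \<in> B \<Longrightarrow> a i b \<in> M"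
  shows "\<exists>c. (\<forall>b\<in>B. c b \<in> M) \<and> (\<exists>b\<in>B. c b \<noteq> \<zero>) \<and> (\<forall>i\<in>A. (\<Oplus>b\<in>B. a i b \<otimes> c b) = \<zero>)"
  using assms(2-5)
proof (induction A arbitrary: B a rule: finite_induct)
  case empty
  then have "B \<noteq> {}" by auto
  then show ?case using subringE(3)[OF subfieldE(1)[OF M]] by (intro exI[of _ "\<lambda>_. \<one>"]) auto
next
  case (insert i A)
  note MR = subfieldE(3)[OF M] and Ms = subringE[OF subfieldE(1)[OF M]]
  show ?case
  proof (cases "\<forall>b\<in>B. a i b = \<zero>")
    case True
    have "card A < card B" using insert.prems(2) insert.hyps by simp
    then obtain c where c: "\<forall>b\<in>B. c b \<in> M" "\<exists>b\<in>B. c b \<noteq> \<zero>" "\<forall>j\<in>A. (\<Oplus>b\<in>B. a j b \<otimes> c b) = \<zero>"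
      using insert.IH[OF insert.prems(1), of a] insert.prems(3) by auto
    have "(\<Oplus>b\<in>B. a i b \<otimes> c b) = (\<Oplus>b\<in>B. \<zero>)"
      using True c MR by (intro finsum_cong') auto
    then show ?thesis using c by (intro exI[of _ c]) (auto simp: finsum_zero)
  next
    case False
    then obtain b0 where b0: "b0 \<in> B" "a i b0 \<noteq> \<zero>" by auto
    define q where "q = inv (a i b0)"
    have aM: "a j b \<in> M" "a j b \<in> carrier R" if "j \<in> insert i A" "b \<in> B" for j b
      using insert.prems(3)[OF that] MR by auto
    have qM: "q \<in> M" "q \<in> carrier R" and q: "a i b0 \<otimes> q = \<one>"
      unfolding q_def using subfield_inv[OF M] b0 aM MR field_Units by auto
    define B' where "B' = B - {b0}"
    have B': "finite B'" "B = insert b0 B'" "b0 \<notin> B'" using insert.prems(1) b0 B'_def by auto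
    define a' where "a' j b = a j b \<ominus> a j b0 \<otimes> q \<otimes> a i b" for j b
    have "card A < card B'" using insert.prems(2) insert.hyps B' by simp
    moreover have "a' j b \<in> M" if "j \<in> A" "b \<in> B'" for j b
      unfolding a'_def a_minus_def using that aM qM Ms b0 B' by auto
    ultimately obtain c where c: "\<forall>b\<in>B'. c b \<in> M" "\<exists>b\<in>B'. c b \<noteq> \<zero>"
        "\<forall>j\<in>A. (\<Oplus>b\<in>B'. a' j b \<otimes> c b) = \<zero>"
      using insert.IH[OF B'(1), of a'] by auto
    have cR: "\<And>b. b \<in> B' \<Longrightarrow> c b \<in> carrier R" using c(1) MR by auto
    define s where "s = (\<Oplus>b\<in>B'. a i b \<otimes> c b)"
    have sM: "s \<in> M" unfolding s_def using c(1) aM(1) B' by (intro finsum_in_subring[OF subfieldE(1)[OF M]] Ms(6)) auto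
    then have sR: "s \<in> carrier R" using MR by auto
    define d where "d b = (if b = b0 then \<ominus> (q \<otimes> s) else c b)" for b
    have dM: "\<forall>b\<in>B. d b \<in> M" using c(1) sM qM Ms B' unfolding d_def by auto
    have dR: "\<And>b. b \<in> B \<Longrightarrow> d b \<in> carrier R" using dM MR by auto
    have eq: "(\<Oplus>b\<in>B. a j b \<otimes> d b) = \<ominus> (a j b0 \<otimes> (q \<otimes> s)) \<oplus> (\<Oplus>b\<in>B'. a j b \<otimes> c b)"
      if j: "j \<in> insert i A" for j
    proof -
      have "(\<Oplus>b\<in>B. a j b \<otimes> d b) = a j b0 \<otimes> d b0 \<oplus> (\<Oplus>b\<in>B'. a j b \<otimes> d b)"
        unfolding B'(2) using B' aM[OF j] dR by (intro finsum_insert) auto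
      also have "(\<Oplus>b\<in>B'. a j b \<otimes> d b) = (\<Oplus>b\<in>B'. a j b \<otimes> c b)"
        using B' aM[OF j] dR cR by (intro finsum_cong') (auto simp: d_def)
      finally show ?thesis using aM[OF j b0(1)] qM sR by (simp add: d_def r_minus)
    qed
    have "(\<Oplus>b\<in>B. a i b \<otimes> d b) = \<ominus> (a i b0 \<otimes> q \<otimes> s) \<oplus> s"
      using eq[of i] aM[of i b0] b0 qM sR by (simp add: s_def m_assoc)
    then have i0: "(\<Oplus>b\<in>B. a i b \<otimes> d b) = \<zero>" using q sR by (simp add: l_neg)
    have "(\<Oplus>b\<in>B. a j b \<otimes> d b) = \<zero>" if j: "j \<in> A" for j
    proof -
      note aj = aM[of j]
      have mem: "a j b0 \<in> carrier R" using aj b0 j by auto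
      have "\<zero> = (\<Oplus>b\<in>B'. a' j b \<otimes> c b)" using c(3) j by auto
      also have "\<dots> = (\<Oplus>b\<in>B'. a j b \<otimes> c b \<oplus> (\<ominus> (a j b0 \<otimes> q)) \<otimes> (a i b \<otimes> c b))"
      proof (intro finsum_cong')
        fix b assume b: "b \<in> B'"
        then have "a j b \<in> carrier R" "a i b \<in> carrier R" "c b \<in> carrier R" using aM j B' cR by auto
        then show "a' j b \<otimes> c b = a j b \<otimes> c b \<oplus> (\<ominus> (a j b0 \<otimes> q)) \<otimes> (a i b \<otimes> c b)"
          unfolding a'_def using mem qM by algebra
      qed (use B' aM j cR mem qM in auto)
      also have "\<dots> = (\<Oplus>b\<in>B'. a j b \<otimes> c b) \<oplus> (\<Oplus>b\<in>B'. (\<ominus> (a j b0 \<otimes> q)) \<otimes> (a i b \<otimes> c b))"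
        using B' aM j cR mem qM by (intro finsum_addf) auto
      also have "(\<Oplus>b\<in>B'. (\<ominus> (a j b0 \<otimes> q)) \<otimes> (a i b \<otimes> c b)) = (\<ominus> (a j b0 \<otimes> q)) \<otimes> s"
        unfolding s_def using B' aM j cR mem qM by (intro finsum_rdistr[symmetric]) auto
      finally have "(\<Oplus>b\<in>B'. a j b \<otimes> c b) \<oplus> (\<ominus> (a j b0 \<otimes> q)) \<otimes> s = \<zero>" by simp
      moreover have "(\<Oplus>b\<in>B'. a j b \<otimes> c b) \<in> carrier R"
        using B' aM j cR by (intro finsum_closed) auto
      ultimately show ?thesis unfolding eq[OF insertI2[OF j]] using mem qM sR
        by (simp add: l_minus m_assoc a_comm)
    qed
    moreover have "\<exists>b\<in>B. d b \<noteq> \<zero>" using c(2) B' by (auto simp: d_def)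
    ultimately show ?thesis using dM i0 by (intro exI[of _ d]) auto
  qed
qed

text \<open>Artin's independence of characters: \<open>P = 0\<close> is the classical case, and the maximal ideal
  \<open>P\<close> of a valuation ring gives it for the characters induced on the residue field.\<close>

lemma (in cring) independence_mod_prime:
  assumes B: "subring B R" and PB: "P \<subseteq> B" and P0: "\<zero> \<in> P" "\<one> \<notin> P"
    and Pm: "\<And>a b. a \<in> P \<Longrightarrow> b \<in> P \<Longrightarrow> a \<ominus> b \<in> P"
    and Pa: "\<And>a b. a \<in> B \<Longrightarrow> b \<in> P \<Longrightarrow> a \<otimes> b \<in> P"
    and Pp: "\<And>a b. a \<in> B \<Longrightarrow> b \<in> B \<Longrightarrow> a \<otimes> b \<in> P \<Longrightarrow> a \<in> P \<or> b \<in> P"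
    and A: "\<one> \<in> A" "\<And>x y. x \<in> A \<Longrightarrow> y \<in> A \<Longrightarrow> x \<otimes> y \<in> A"
    and S: "finite S" "\<And>s x. s \<in> S \<Longrightarrow> x \<in> A \<Longrightarrow> s x \<in> B" "\<And>s. s \<in> S \<Longrightarrow> s \<one> = \<one>"
      "\<And>s x y. s \<in> S \<Longrightarrow> x \<in> A \<Longrightarrow> y \<in> A \<Longrightarrow> s (x \<otimes> y) = s x \<otimes> s y"
    and dist: "\<And>s t. s \<in> S \<Longrightarrow> t \<in> S \<Longrightarrow> s \<noteq> t \<Longrightarrow> \<exists>x\<in>A. s x \<ominus> t x \<notin> P"
    and c: "\<And>s. s \<in> S \<Longrightarrow> c s \<in> B"
    and rel: "\<And>z. z \<in> A \<Longrightarrow> (\<Oplus>s\<in>S. c s \<otimes> s z) \<in> P"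
  shows "\<forall>s\<in>S. c s \<in> P"
  using S dist c rel
proof (induction S arbitrary: c rule: finite_induct)
  case empty thus ?case by simp
next
  case (insert t S)
  note BR = subringE(1)[OF B] and Bs = subringE[OF B]
  have cR: "c s \<in> carrier R" if "s \<in> insert t S" for s using insert.prems(5)[OF that] BR by auto
  have sR: "s x \<in> carrier R" if "s \<in> insert t S" "x \<in> A" for s x using insert.prems(1)[OF that] BR by auto
  \<comment> \<open>The relation at x z minus t x times the relation at z: the term of t cancels,
    and each s in S acquires the factor s x - t x.\<close>
  define d where "d x s = c s \<otimes> (s x \<ominus> t x)" for x s
  have dB: "d x s \<in> B" if "s \<in> S" "x \<in> A" for x s
    unfolding d_def a_minus_def using insert.prems(1,5) that Bs by auto
  have relS: "(\<Oplus>s\<in>S. d x s \<otimes> s z) \<in> P" if x: "x \<in> A" and z: "z \<in> A" for x z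
  proof -
    have split: "(\<Oplus>s\<in>insert t S. c s \<otimes> s y) = c t \<otimes> t y \<oplus> (\<Oplus>s\<in>S. c s \<otimes> s y)" if "y \<in> A" for y
      using insert.hyps cR sR that by (intro finsum_insert) auto
    define u where "u = (\<Oplus>s\<in>S. c s \<otimes> s (x \<otimes> z))"
    define v where "v = (\<Oplus>s\<in>S. c s \<otimes> s z)"
    have uR: "u \<in> carrier R" unfolding u_def using cR sR A(2)[OF x z] by (intro finsum_closed) auto
    have vR: "v \<in> carrier R" unfolding v_def using cR sR z by (intro finsum_closed) auto
    have "c t \<otimes> t (x \<otimes> z) \<oplus> u \<in> P" using insert.prems(6)[OF A(2)[OF x z]] split[OF A(2)[OF x z]] u_def by simp
    then have 1: "c t \<otimes> (t x \<otimes> t z) \<oplus> u \<in> P" using insert.prems(3)[of t x z] x z by simp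
    have "c t \<otimes> t z \<oplus> v \<in> P" using insert.prems(6)[OF z] split[OF z] v_def by simp
    then have 2: "t x \<otimes> (c t \<otimes> t z \<oplus> v) \<in> P" using Pa insert.prems(1)[of t x] x by simp
    have "(c t \<otimes> (t x \<otimes> t z) \<oplus> u) \<ominus> (t x \<otimes> (c t \<otimes> t z \<oplus> v)) = u \<oplus> (\<ominus> t x) \<otimes> v"
      using cR[of t] sR[of t x] sR[of t z] x z uR vR by simp algebra
    also have "(\<ominus> t x) \<otimes> v = (\<Oplus>s\<in>S. (\<ominus> t x) \<otimes> (c s \<otimes> s z))"
      unfolding v_def using insert.hyps cR sR x z by (intro finsum_rdistr) auto
    also have "u \<oplus> \<dots> = (\<Oplus>s\<in>S. c s \<otimes> s (x \<otimes> z) \<oplus> (\<ominus> t x) \<otimes> (c s \<otimes> s z))"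
      unfolding u_def using cR sR x z A(2)[OF x z] by (intro finsum_addf[symmetric]) auto
    also have "\<dots> = (\<Oplus>s\<in>S. d x s \<otimes> s z)"
    proof (intro finsum_cong')
      fix s assume s: "s \<in> S"
      then have "s (x \<otimes> z) = s x \<otimes> s z" using insert.prems(3) x z by simp
      then show "c s \<otimes> s (x \<otimes> z) \<oplus> (\<ominus> t x) \<otimes> (c s \<otimes> s z) = d x s \<otimes> s z"
        unfolding d_def using cR[of s] sR[of s x] sR[of s z] sR[of t x] x z s by simp algebra
    next
      show "(\<lambda>s. d x s \<otimes> s z) \<in> S \<rightarrow> carrier R" using dB sR x z BR by blast
    qed simp
    finally show ?thesis using Pm[OF 1 2] by simp
  qed
  have dP: "d x s \<in> P" if "x \<in> A" "s \<in> S" for x s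
  proof -
    have "\<forall>s\<in>S. d x s \<in> P"
      by (rule insert.IH) (use insert.prems dB relS that in auto)
    then show ?thesis using that by simp
  qed
  have SP: "c s \<in> P" if s: "s \<in> S" for s
  proof -
    have "s \<noteq> t" using s insert.hyps by auto
    then obtain x where x: "x \<in> A" "s x \<ominus> t x \<notin> P" using insert.prems(4)[of s t] s by auto
    have "s x \<ominus> t x \<in> B" unfolding a_minus_def using insert.prems(1) s x Bs by auto
    then show ?thesis using dP[OF x(1) s] Pp[of "c s" "s x \<ominus> t x"] insert.prems(5) s x by (auto simp: d_def)
  qed
  \<comment> \<open>Evaluating the full relation at 1 isolates c t, since every other term already
    lies in P.\<close>
  have "(\<Oplus>s\<in>S. c s \<otimes> s \<one>) \<in> P"
  proof -
    have add: "a \<oplus> b \<in> P" if "a \<in> P" "b \<in> P" for a b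
    proof -
      have "a \<in> carrier R" "b \<in> carrier R" using that PB BR by auto
      moreover have "a \<ominus> (\<zero> \<ominus> b) \<in> P" using Pm that P0 by blast
      ultimately show ?thesis by (simp add: a_minus_def)
    qed
    have "finite S" by (rule insert.hyps)
    moreover have "c s \<otimes> s \<one> \<in> P" if "s \<in> S" for s
      using SP[OF that] insert.prems(2)[of s] that cR by simp
    ultimately show ?thesis
    proof (induction S rule: finite_induct)
      case (insert a F)
      then have "(\<lambda>s. c s \<otimes> s \<one>) \<in> F \<rightarrow> carrier R" "c a \<otimes> a \<one> \<in> carrier R" using PB BR by blast+
      then show ?case using insert add by (simp add: finsum_insert)
    qed (simp add: P0)
  qed
  moreover have "c t \<otimes> t \<one> \<oplus> (\<Oplus>s\<in>S. c s \<otimes> s \<one>) \<in> P"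
  proof -
    have "(\<Oplus>s\<in>insert t S. c s \<otimes> s \<one>) = c t \<otimes> t \<one> \<oplus> (\<Oplus>s\<in>S. c s \<otimes> s \<one>)"
      using insert.hyps cR sR A(1) by (intro finsum_insert) auto
    then show ?thesis using insert.prems(6)[OF A(1)] by simp
  qed
  ultimately have "(c t \<otimes> t \<one> \<oplus> (\<Oplus>s\<in>S. c s \<otimes> s \<one>)) \<ominus> (\<Oplus>s\<in>S. c s \<otimes> s \<one>) \<in> P"
    using Pm by blast
  moreover have "(\<Oplus>s\<in>S. c s \<otimes> s \<one>) \<in> carrier R" using \<open>(\<Oplus>s\<in>S. c s \<otimes> s \<one>) \<in> P\<close> PB BR by auto
  ultimately have "c t \<in> P" using insert.prems(2)[of t] cR[of t]
    by (simp add: a_minus_def a_assoc r_neg)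
  then show ?case using SP by auto
qed

section \<open>Endomorphisms of a subfield, finite groups of them and their fixed fields\<close>

abbreviation (in ring) endo :: "'a set \<Rightarrow> ('a \<Rightarrow> 'a) set" where
  "endo M \<equiv> ring_hom (R\<lparr>carrier := M\<rparr>) (R\<lparr>carrier := M\<rparr>)"

text \<open>A finite group of automorphisms of M. Inverses are not demanded: left translation by an
  injective map is a bijection of a finite set closed under composition
  (\<open>automorphisms_inverse\<close>). Members are extensional so that agreement on M is
  equality.\<close>

definition (in ring) automorphisms :: "'a set \<Rightarrow> ('a \<Rightarrow> 'a) set \<Rightarrow> bool" where
  "automorphisms M S \<longleftrightarrow> finite S \<and> S \<subseteq> endo M \<inter> extensional M \<and> (\<lambda>x\<in>M. x) \<in> S \<and>
     (\<forall>s\<in>S. \<forall>t\<in>S. compose M s t \<in> S)"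

definition (in ring) fixed :: "'a set \<Rightarrow> ('a \<Rightarrow> 'a) set \<Rightarrow> 'a set" where
  "fixed M S = {x \<in> M. \<forall>s\<in>S. s x = x}"

lemma (in ring) subring_pow:
  assumes "subring M R" "x \<in> M"
  shows "x [^] (n::nat) \<in> M"
  using subringE(3,6)[OF assms(1)] assms(2) by (induction n) auto

lemma (in ring) fixedD: "x \<in> fixed M S \<Longrightarrow> x \<in> M" "x \<in> fixed M S \<Longrightarrow> s \<in> S \<Longrightarrow> s x = x"
  unfolding fixed_def by blast+

context field
begin

lemma endoD:
  assumes "s \<in> endo M"
  shows "x \<in> M \<Longrightarrow> s x \<in> M" "x \<in> M \<Longrightarrow> y \<in> M \<Longrightarrow> s (x \<otimes> y) = s x \<otimes> s y"
    "x \<in> M \<Longrightarrow> y \<in> M \<Longrightarrow> s (x \<oplus> y) = s x \<oplus> s y" "s \<one> = \<one>"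
  using assms unfolding ring_hom_def by auto

lemma endoI:
  assumes "\<And>x. x \<in> M \<Longrightarrow> s x \<in> M" "\<And>x y. x \<in> M \<Longrightarrow> y \<in> M \<Longrightarrow> s (x \<otimes> y) = s x \<otimes> s y"
    "\<And>x y. x \<in> M \<Longrightarrow> y \<in> M \<Longrightarrow> s (x \<oplus> y) = s x \<oplus> s y" "s \<one> = \<one>"
  shows "s \<in> endo M"
  using assms unfolding ring_hom_def by auto

context
  fixes M s assumes M: "subfield M R" and s: "s \<in> endo M"
begin

lemma endo_zero: "s \<zero> = \<zero>"
proof -
  note Ms = subringE[OF subfieldE(1)[OF M]]
  have "s \<zero> \<in> carrier R" using endoD(1)[OF s Ms(2)] Ms(1) by auto
  moreover have "s \<zero> = s \<zero> \<oplus> s \<zero>" using endoD(3)[OF s Ms(2) Ms(2)] by simp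
  ultimately show ?thesis by (metis add.r_cancel_one')
qed

lemma endo_a_inv: assumes x: "x \<in> M" shows "s (\<ominus> x) = \<ominus> s x"
proof -
  note Ms = subringE[OF subfieldE(1)[OF M]]
  have "s x \<oplus> s (\<ominus> x) = \<zero>" using endoD(3)[OF s x Ms(5)[OF x]] x Ms(1) endo_zero
    by (simp add: r_neg subset_iff)
  moreover have "s x \<in> carrier R" "s (\<ominus> x) \<in> carrier R"
    using endoD(1)[OF s] x Ms(5)[OF x] Ms(1) by auto
  ultimately show ?thesis by (metis add.inv_equality a_comm)
qed

lemma endo_minus: "x \<in> M \<Longrightarrow> y \<in> M \<Longrightarrow> s (x \<ominus> y) = s x \<ominus> s y"
  unfolding a_minus_def using endoD(3)[OF s] endo_a_inv subringE(5)[OF subfieldE(1)[OF M]] by simp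

lemma endo_nonzero: assumes "x \<in> M" "x \<noteq> \<zero>" shows "s x \<noteq> \<zero>"
proof
  assume "s x = \<zero>"
  have i: "inv x \<in> M" "x \<otimes> inv x = \<one>" using subfield_m_inv[OF M] assms by auto
  then have "\<one> = s x \<otimes> s (inv x)" using endoD(2)[OF s assms(1) i(1)] endoD(4)[OF s] by simp
  then show False using \<open>s x = \<zero>\<close> endoD(1)[OF s i(1)] subfieldE(3)[OF M] by auto
qed

lemma endo_inv: assumes "x \<in> M" "x \<noteq> \<zero>" shows "s (inv x) = inv (s x)"
proof -
  have i: "inv x \<in> M" "x \<otimes> inv x = \<one>" using subfield_m_inv[OF M] assms by auto
  then have "\<one> = s x \<otimes> s (inv x)" using endoD(2)[OF s assms(1) i(1)] endoD(4)[OF s] by simp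
  moreover have "s x \<in> carrier R" "s (inv x) \<in> carrier R"
    using endoD(1)[OF s] i assms subfieldE(3)[OF M] by auto
  ultimately show ?thesis by (metis comm_inv_char)
qed

lemma endo_inj: "inj_on s M"
proof (rule inj_onI)
  fix x y assume xy: "x \<in> M" "y \<in> M" "s x = s y"
  note MR = subfieldE(3)[OF M]
  have "s (x \<ominus> y) = \<zero>" using xy endo_minus endoD(1)[OF s] MR by (simp add: r_right_minus_eq subset_iff)
  moreover have "x \<ominus> y \<in> M" unfolding a_minus_def using xy subringE(5,7)[OF subfieldE(1)[OF M]] by simp
  ultimately have "x \<ominus> y = \<zero>" using endo_nonzero by auto
  then show "x = y" using xy MR by (simp add: r_right_minus_eq subset_iff)
qed

lemma endo_finsum:
  assumes "\<And>i. i \<in> A \<Longrightarrow> f i \<in> M"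
  shows "s (\<Oplus>i\<in>A. f i) = (\<Oplus>i\<in>A. s (f i))"
proof (cases "finite A")
  case True
  note MR = subfieldE(3)[OF M]
  show ?thesis using True assms
  proof (induction A)
    case empty thus ?case using endo_zero by simp
  next
    case (insert a A)
    have f: "f \<in> A \<rightarrow> carrier R" "f a \<in> carrier R" using insert MR by auto
    have sf: "(\<lambda>i. s (f i)) \<in> A \<rightarrow> carrier R" "s (f a) \<in> carrier R"
      using insert.prems endoD(1)[OF s] MR by auto
    have "finsum R f A \<in> M" by (rule finsum_in_subring[OF subfieldE(1)[OF M]]) (use insert.prems in auto)
    then show ?case using insert f sf endoD(3)[OF s] by (simp add: finsum_insert)
  qed
qed (simp add: finsum_infinite endo_zero)

lemma endo_pow: "x \<in> M \<Longrightarrow> s (x [^] (n::nat)) = s x [^] n"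
proof (induction n)
  case (Suc n)
  have "x [^] n \<in> M" using subring_pow[OF subfieldE(1)[OF M] Suc.prems] .
  then show ?case using Suc endoD(2)[OF s] by simp
qed (simp add: endoD(4)[OF s])

end

lemma endo_compose:
  assumes "subfield M R" "s \<in> endo M" "t \<in> endo M"
  shows "compose M s t \<in> endo M"
  using endoD[OF assms(2)] endoD[OF assms(3)] subringE[OF subfieldE(1)[OF assms(1)]]
  by (intro endoI) (auto simp: compose_def)

lemma fixed_subfield:
  assumes M: "subfield M R" and S: "S \<subseteq> endo M"
  shows "subfield (fixed M S) R"
proof (rule subfieldI')
  note Ms = subringE[OF subfieldE(1)[OF M]]
  have e: "s \<in> endo M" if "s \<in> S" for s using S that by auto
  show "subring (fixed M S) R"
  proof (rule subringI)
    show "fixed M S \<subseteq> carrier R" using Ms(1) by (auto simp: fixed_def)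
    have F: "x \<in> fixed M S" if "x \<in> M" "\<And>s. s \<in> S \<Longrightarrow> s x = x" for x
      using that by (simp add: fixed_def)
    have F': "x \<in> M" "s \<in> S \<Longrightarrow> s x = x" if "x \<in> fixed M S" for x s
      using that by (auto simp: fixed_def)
    show "\<one> \<in> fixed M S" by (intro F Ms(3) endoD(4)[OF e])
    show "\<ominus> h \<in> fixed M S" if h: "h \<in> fixed M S" for h
    proof (intro F Ms(5) F'(1)[OF h])
      fix s assume s: "s \<in> S"
      show "s (\<ominus> h) = \<ominus> h" using endo_a_inv[OF M e[OF s] F'(1)[OF h]] F'(2)[OF h s] by simp
    qed
    fix h k assume h: "h \<in> fixed M S" and k: "k \<in> fixed M S"
    show "h \<otimes> k \<in> fixed M S"
    proof (intro F Ms(6) F'(1)[OF h] F'(1)[OF k])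
      fix s assume s: "s \<in> S"
      show "s (h \<otimes> k) = h \<otimes> k"
        using endoD(2)[OF e[OF s] F'(1)[OF h] F'(1)[OF k]] F'(2)[OF h s] F'(2)[OF k s] by simp
    qed
    show "h \<oplus> k \<in> fixed M S"
    proof (intro F Ms(7) F'(1)[OF h] F'(1)[OF k])
      fix s assume s: "s \<in> S"
      show "s (h \<oplus> k) = h \<oplus> k"
        using endoD(3)[OF e[OF s] F'(1)[OF h] F'(1)[OF k]] F'(2)[OF h s] F'(2)[OF k s] by simp
    qed
  qed
  fix k assume k: "k \<in> fixed M S - {\<zero>}"
  then have "inv k \<in> M" using subfield_inv[OF M] by (auto simp: fixed_def)
  moreover have "s (inv k) = inv k" if s: "s \<in> S" for s
    using k endo_inv[OF M e[OF s], of k] fixedD(2)[of k M S s, OF _ s] fixedD(1)[of k M S] by simp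
  ultimately show "inv k \<in> fixed M S" by (simp add: fixed_def)
qed

lemma automorphismsD:
  assumes "automorphisms M S"
  shows "finite S" "\<And>s. s \<in> S \<Longrightarrow> s \<in> endo M" "\<And>s. s \<in> S \<Longrightarrow> s \<in> extensional M" "(\<lambda>x\<in>M. x) \<in> S"
    "\<And>s t. s \<in> S \<Longrightarrow> t \<in> S \<Longrightarrow> compose M s t \<in> S" "S \<subseteq> endo M" "S \<noteq> {}"
  using assms unfolding automorphisms_def by auto

text \<open>Left translation by t is injective because t is, and an injective map of a finite set
  into itself is onto. This is what makes traces and norms invariant.\<close>

lemma automorphisms_compose_bij:
  assumes M: "subfield M R" and S: "automorphisms M S" and t: "t \<in> S"
  shows "(compose M t) ` S = S" "inj_on (compose M t) S"
proof -
  show inj: "inj_on (compose M t) S"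
  proof (rule inj_onI)
    fix a b assume ab: "a \<in> S" "b \<in> S" "compose M t a = compose M t b"
    show "a = b"
    proof (rule extensionalityI[OF automorphismsD(3)[OF S ab(1)] automorphismsD(3)[OF S ab(2)]])
      fix x assume x: "x \<in> M"
      then have "t (a x) = t (b x)" using fun_cong[OF ab(3), of x] by (simp add: compose_def)
      then show "a x = b x"
        using endo_inj[OF M automorphismsD(2)[OF S t]] endoD(1)[OF automorphismsD(2)[OF S]] ab x
        by (auto dest: inj_onD)
    qed
  qed
  have "(compose M t) ` S \<subseteq> S" using automorphismsD(5)[OF S t] by auto
  then show "(compose M t) ` S = S" using inj automorphismsD(1)[OF S]
    by (metis card_image card_subset_eq)
qed

lemma automorphisms_inverse:
  assumes M: "subfield M R" and S: "automorphisms M S" and t: "t \<in> S"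
  shows "\<exists>u\<in>S. \<forall>x\<in>M. t (u x) = x \<and> u (t x) = x"
proof -
  have "(\<lambda>x\<in>M. x) \<in> compose M t ` S"
    using automorphisms_compose_bij(1)[OF M S t] automorphismsD(4)[OF S] by simp
  then obtain u where u: "u \<in> S" "compose M t u = (\<lambda>x\<in>M. x)" by auto
  have tu: "t (u x) = x" if "x \<in> M" for x
    using fun_cong[OF u(2), of x] that by (simp add: compose_def)
  have "u (t x) = x" if x: "x \<in> M" for x
  proof -
    have "t x \<in> M" "u (t x) \<in> M" using endoD(1)[OF automorphismsD(2)[OF S]] t u x by auto
    moreover have "t (u (t x)) = t x" using tu calculation by simp
    ultimately show ?thesis
      using endo_inj[OF M automorphismsD(2)[OF S t]] x by (auto dest: inj_onD)
  qed
  then show ?thesis using u tu by auto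
qed

lemma finsum_automorphisms_reindex:
  assumes M: "subfield M R" and S: "automorphisms M S" and t: "t \<in> S" and f: "f \<in> S \<rightarrow> carrier R"
  shows "(\<Oplus>s\<in>S. f (compose M t s)) = (\<Oplus>s\<in>S. f s)"
  using finsum_reindex[of f "compose M t" S] automorphisms_compose_bij[OF M S t] f by simp

lemma trace_fixed:
  assumes M: "subfield M R" and S: "automorphisms M S" and x: "x \<in> M"
  shows "(\<Oplus>s\<in>S. s x) \<in> fixed M S"
proof -
  note MR = subfieldE(3)[OF M]
  have sx: "\<And>s. s \<in> S \<Longrightarrow> s x \<in> M" using endoD(1)[OF automorphismsD(2)[OF S]] x by auto
  have "t (\<Oplus>s\<in>S. s x) = (\<Oplus>s\<in>S. s x)" if t: "t \<in> S" for t
  proof -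
    have "t (\<Oplus>s\<in>S. s x) = (\<Oplus>s\<in>S. t (s x))"
      by (rule endo_finsum[OF M automorphismsD(2)[OF S t]]) (rule sx)
    also have "\<dots> = (\<Oplus>s\<in>S. compose M t s x)" using x by (simp add: compose_def)
    also have "\<dots> = (\<Oplus>s\<in>S. s x)"
      using finsum_automorphisms_reindex[OF M S t, of "\<lambda>s. s x"] sx MR by auto
    finally show ?thesis .
  qed
  moreover have "(\<Oplus>s\<in>S. s x) \<in> M" by (rule finsum_in_subring[OF subfieldE(1)[OF M]]) (rule sx)
  ultimately show ?thesis by (simp add: fixed_def)
qed

lemma independence_of_endomorphisms:
  assumes M: "subfield M R" and S: "finite S" "S \<subseteq> endo M \<inter> extensional M"
    and c: "\<And>s. s \<in> S \<Longrightarrow> c s \<in> carrier R"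
    and rel: "\<And>z. z \<in> M \<Longrightarrow> (\<Oplus>s\<in>S. c s \<otimes> s z) = \<zero>"
    and s: "s \<in> S"
  shows "c s = \<zero>"
proof -
  note MR = subfieldE(3)[OF M] and Ms = subringE[OF subfieldE(1)[OF M]]
  have sM: "s x \<in> carrier R" if "s \<in> S" "x \<in> M" for s x using endoD(1)[of s M x] S that MR by auto
  have "\<forall>s\<in>S. c s \<in> {\<zero>}"
  proof (rule independence_mod_prime[of "carrier R" _ M])
    fix s t assume st: "s \<in> S" "t \<in> S" "s \<noteq> t"
    then obtain x where "x \<in> M" "s x \<noteq> t x" using S(2) by (meson extensionalityI IntD2 subsetD)
    then show "\<exists>x\<in>M. s x \<ominus> t x \<notin> {\<zero>}" using st sM by (intro bexI[of _ x]) auto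
  qed (use S c rel sM Ms carrier_is_subring endoD integral in \<open>auto simp: subset_iff\<close>)
  then show ?thesis using s by simp
qed

text \<open>If the trace of z u vanished for every z, the elements s u would be the coefficients of
  a linear relation among the s, and independence would give u = 0.\<close>

lemma trace_nonzero:
  assumes M: "subfield M R" and S: "automorphisms M S" and u: "u \<in> M" "u \<noteq> \<zero>"
  shows "\<exists>z\<in>M. (\<Oplus>s\<in>S. s (z \<otimes> u)) \<noteq> \<zero>"
proof (rule ccontr)
  note MR = subfieldE(3)[OF M] and Ms = subringE[OF subfieldE(1)[OF M]]
  assume "\<not> ?thesis"
  then have *: "(\<Oplus>s\<in>S. s (z \<otimes> u)) = \<zero>" if "z \<in> M" for z using that by auto
  have sM: "s x \<in> M" "s x \<in> carrier R" if "s \<in> S" "x \<in> M" for s x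
    using endoD(1)[OF automorphismsD(2)[OF S]] that MR by auto
  have "(\<Oplus>s\<in>S. s u \<otimes> s z) = \<zero>" if z: "z \<in> M" for z
  proof -
    have "(\<Oplus>s\<in>S. s u \<otimes> s z) = (\<Oplus>s\<in>S. s (z \<otimes> u))"
      using endoD(2)[OF automorphismsD(2)[OF S] z u(1)] sM z u
      using subringE(6)[OF subfieldE(1)[OF M]] MR by (intro finsum_cong') (auto simp: m_comm)
    then show ?thesis using * z by simp
  qed
  then have "s u = \<zero>" if "s \<in> S" for s
    using independence_of_endomorphisms[OF M automorphismsD(1)[OF S], of "\<lambda>s. s u"] that
      automorphismsD(2,3)[OF S] sM u by auto
  then show False using automorphismsD(4)[OF S] u by auto
qed

section \<open>Artin's theorem, Dedekind's bound and the part of Galois theory that follows from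
  them\<close>

text \<open>An independent list of maximal length spans V, because a vector outside its span would
  prolong it. This turns a bound on independent lists into an actual dimension.\<close>

lemma dimension_of_bounded_independent:
  assumes K: "subfield K R" and V: "subalgebra K V R"
    and b: "\<And>Us. independent K Us \<Longrightarrow> set Us \<subseteq> V \<Longrightarrow> length Us \<le> n"
  shows "\<exists>m\<le>n. dimension m K V"
proof -
  define P where "P m \<longleftrightarrow> (\<exists>Us. independent K Us \<and> set Us \<subseteq> V \<and> length Us = m)" for m
  have P0: "P 0" unfolding P_def by auto
  have Pb: "m \<le> n" if "P m" for m using that b unfolding P_def by auto
  define m where "m = (GREATEST m. P m)"
  have m: "P m" "\<And>k. P k \<Longrightarrow> k \<le> m"
    unfolding m_def using GreatestI_nat[of P, OF P0 Pb] Greatest_le_nat[of P _ n] Pb by auto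
  then obtain Us where Us: "independent K Us" "set Us \<subseteq> V" "length Us = m" unfolding P_def by auto
  have VR: "V \<subseteq> carrier R" using subalgebra_in_carrier[OF V] .
  have "Span K Us = V"
  proof
    show "Span K Us \<subseteq> V" using subalgebra_Span_incl[OF K V Us(2)] .
    show "V \<subseteq> Span K Us"
    proof
      fix v assume v: "v \<in> V"
      show "v \<in> Span K Us"
      proof (rule ccontr)
        assume "v \<notin> Span K Us"
        then have "independent K (v # Us)" using Us v VR by (intro li_Cons) auto
        then have "P (Suc m)" unfolding P_def using Us v by (intro exI[of _ "v # Us"]) auto
        then show False using m(2) by fastforce
      qed
    qed
  qed
  then show ?thesis using dimension_independent[OF Us(1)] Us(3) Pb[OF m(1)] by auto
qed

lemma subfield_subalgebra:
  assumes "subfield F R" "subfield E R" "F \<subseteq> E"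
  shows "subalgebra F E R"
proof (intro subalgebra.intro subalgebra_axioms.intro)
  note Es = subringE[OF subfieldE(1)[OF assms(2)]]
  show "subgroup E (add_monoid R)" using Es by (intro add.subgroupI) auto
qed (use assms subringE(6)[OF subfieldE(1)[OF assms(2)]] in auto)

lemma dimension_pos:
  assumes "subfield F R" "subfield E R" "dimension n F E"
  shows "n > 0"
proof (rule ccontr)
  assume "\<not> n > 0"
  then have "E = {\<zero>}" using dimension_zero[OF assms(1)] assms(3) by simp
  then show False using subringE(3)[OF subfieldE(1)[OF assms(2)]] by auto
qed

lemma combine_nth:
  assumes "set Us \<subseteq> carrier R" "set Ks \<subseteq> carrier R" "length Ks = length Us"
  shows "combine Ks Us = (\<Oplus>i\<in>{..<length Us}. Ks ! i \<otimes> Us ! i)"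
  using assms(3,1,2)
proof (induction Ks Us rule: list_induct2)
  case (Cons k Ks u Us)
  have *: "{..<length (u # Us)} = insert 0 (Suc ` {..<length Us})"
    using lessThan_Suc_eq_insert_0 by simp
  have mem: "(k # Ks) ! i \<otimes> (u # Us) ! i \<in> carrier R" if "i < Suc (length Us)" for i
    using Cons.prems Cons.hyps that by (metis list.size(4) nth_mem subsetD m_closed add.commute plus_1_eq_Suc length_Cons)
  have "(\<Oplus>i\<in>{..<length (u # Us)}. (k # Ks) ! i \<otimes> (u # Us) ! i)
      = k \<otimes> u \<oplus> (\<Oplus>i\<in>Suc ` {..<length Us}. (k # Ks) ! i \<otimes> (u # Us) ! i)"
    unfolding * using mem Cons.prems by (subst finsum_insert) auto
  also have "(\<Oplus>i\<in>Suc ` {..<length Us}. (k # Ks) ! i \<otimes> (u # Us) ! i) = (\<Oplus>i\<in>{..<length Us}. Ks ! i \<otimes> Us ! i)"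
    using mem finsum_reindex[of "\<lambda>i. (k # Ks) ! i \<otimes> (u # Us) ! i" Suc "{..<length Us}"] by auto
  finally show ?case using Cons by simp
qed simp

text \<open>More vectors than automorphisms leave a nontrivial solution c of the equations with
  coefficients s (U_j). It lives only in M; multiplying by a suitable z and taking traces moves it
  into the fixed field without killing it.\<close>

lemma artin_independent_bound:
  assumes M: "subfield M R" and S: "automorphisms M S"
    and Us: "independent (fixed M S) Us" "set Us \<subseteq> M"
  shows "length Us \<le> card S"
proof (rule ccontr)
  assume neg: "\<not> ?thesis"
  note MR = subfieldE(3)[OF M] and Ms = subringE[OF subfieldE(1)[OF M]]
  define F where "F = fixed M S"
  have F: "subfield F R" unfolding F_def using fixed_subfield[OF M automorphismsD(6)[OF S]] .
  note FR = subfieldE(3)[OF F]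
  have sM: "s x \<in> M" if "s \<in> S" "x \<in> M" for s x
    using endoD(1)[OF automorphismsD(2)[OF S]] that by auto
  define J where "J = {..<length Us}"
  have UM: "Us ! j \<in> M" "Us ! j \<in> carrier R" if "j \<in> J" for j using Us(2) that MR unfolding J_def by (meson lessThan_iff nth_mem subsetD)+
  have "\<exists>c. (\<forall>j\<in>J. c j \<in> M) \<and> (\<exists>j\<in>J. c j \<noteq> \<zero>) \<and> (\<forall>s\<in>S. (\<Oplus>j\<in>J. s (Us ! j) \<otimes> c j) = \<zero>)"
    by (rule homogeneous_system[OF M automorphismsD(1)[OF S]]) (use neg UM sM in \<open>auto simp: J_def\<close>)
  then obtain c j0 where c: "\<And>j. j \<in> J \<Longrightarrow> c j \<in> M" and j0: "j0 \<in> J" "c j0 \<noteq> \<zero>"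
    and rel: "\<And>s. s \<in> S \<Longrightarrow> (\<Oplus>j\<in>J. s (Us ! j) \<otimes> c j) = \<zero>" by auto
  obtain z where z: "z \<in> M" and tz: "(\<Oplus>s\<in>S. s (z \<otimes> c j0)) \<noteq> \<zero>"
    using trace_nonzero[OF M S c[OF j0(1)] j0(2)] by auto
  have zc: "z \<otimes> c j \<in> M" if "j \<in> J" for j using z c[OF that] Ms by auto
  define T where "T j = (\<Oplus>s\<in>S. s (z \<otimes> c j))" for j
  have TF: "T j \<in> F" if "j \<in> J" for j unfolding T_def F_def using trace_fixed[OF M S zc[OF that]] .
  \<comment> \<open>the trace of the solution, scaled by \<open>z\<close>, is a relation with coefficients in the fixed field\<close>
  have zero: "(\<Oplus>j\<in>J. t (z \<otimes> c j) \<otimes> Us ! j) = \<zero>" if t: "t \<in> S" for t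
  proof -
    \<comment> \<open>The equation indexed by u, the inverse of t, is the one whose image under t
      has the plain coefficients U_j.\<close>
    obtain u where u: "u \<in> S" "\<And>x. x \<in> M \<Longrightarrow> t (u x) = x"
      using automorphisms_inverse[OF M S t] by auto
    have te: "t \<in> endo M" using automorphismsD(2)[OF S t] .
    have "(\<Oplus>j\<in>J. t (z \<otimes> c j) \<otimes> Us ! j) = (\<Oplus>j\<in>J. t z \<otimes> t (u (Us ! j) \<otimes> c j))"
    proof (intro finsum_cong')
      show "(\<lambda>j. t z \<otimes> t (u (Us ! j) \<otimes> c j)) \<in> J \<rightarrow> carrier R"
        by (intro Pi_I m_closed subsetD[OF MR] sM[OF t] Ms(6) sM[OF u(1)] z c UM)
    next
      fix j assume j: "j \<in> J"
      have mem: "t z \<in> carrier R" "t (c j) \<in> carrier R" "u (Us ! j) \<in> M"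
        using sM[OF t] sM[OF u(1)] z c UM j MR by auto
      show "t (z \<otimes> c j) \<otimes> Us ! j = t z \<otimes> t (u (Us ! j) \<otimes> c j)"
        using endoD(2)[OF te z c[OF j]] endoD(2)[OF te mem(3) c[OF j]] u(2)[OF UM(1)[OF j]] mem UM(2)[OF j]
        by (simp add: m_assoc m_comm m_lcomm)
    qed simp
    also have "\<dots> = t z \<otimes> (\<Oplus>j\<in>J. t (u (Us ! j) \<otimes> c j))"
      by (intro finsum_rdistr[symmetric] Pi_I subsetD[OF MR] sM[OF t] Ms(6) sM[OF u(1)] z c UM) (auto simp: J_def)
    also have "(\<Oplus>j\<in>J. t (u (Us ! j) \<otimes> c j)) = t (\<Oplus>j\<in>J. u (Us ! j) \<otimes> c j)"
      by (intro endo_finsum[OF M te, symmetric] Ms(6) sM[OF u(1)] c UM)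
    also have "\<dots> = \<zero>" using rel[OF u(1)] endo_zero[OF M te] by simp
    finally show ?thesis using sM[OF t z] MR by auto
  qed
  have smem: "s (z \<otimes> c j) \<in> carrier R" "s (z \<otimes> c j) \<otimes> Us ! j \<in> carrier R" if "s \<in> S" "j \<in> J" for s j
  proof -
    show 1: "s (z \<otimes> c j) \<in> carrier R" using sM[OF that(1) zc[OF that(2)]] MR by auto
    show "s (z \<otimes> c j) \<otimes> Us ! j \<in> carrier R" by (intro m_closed 1 UM(2)[OF that(2)])
  qed
  have "(\<Oplus>j\<in>J. T j \<otimes> Us ! j) = (\<Oplus>j\<in>J. \<Oplus>s\<in>S. s (z \<otimes> c j) \<otimes> Us ! j)"
  proof (intro finsum_cong')
    fix j assume "j \<in> J"
    then show "T j \<otimes> Us ! j = (\<Oplus>s\<in>S. s (z \<otimes> c j) \<otimes> Us ! j)"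
      unfolding T_def by (intro finsum_ldistr automorphismsD(1)[OF S] UM Pi_I smem)
  next
    show "(\<lambda>j. \<Oplus>s\<in>S. s (z \<otimes> c j) \<otimes> Us ! j) \<in> J \<rightarrow> carrier R"
      by (intro Pi_I finsum_closed smem)
  qed simp
  also have "\<dots> = (\<Oplus>s\<in>S. \<Oplus>j\<in>J. s (z \<otimes> c j) \<otimes> Us ! j)"
  proof -
    have fin: "finite J" unfolding J_def by simp
    have mem: "s (z \<otimes> c j) \<otimes> Us ! j \<in> carrier R" if "s \<in> S" "j \<in> J" for s j
      using smem(2) that .
    show ?thesis using fin mem
    proof (induction J rule: finite_induct)
      case empty
      then show ?case by (simp add: finsum_zero)
    next
      case (insert i J)
      have "(\<Oplus>s\<in>S. \<Oplus>j\<in>insert i J. s (z \<otimes> c j) \<otimes> Us ! j)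
         = (\<Oplus>s\<in>S. s (z \<otimes> c i) \<otimes> Us ! i \<oplus> (\<Oplus>j\<in>J. s (z \<otimes> c j) \<otimes> Us ! j))"
        using insert by (intro finsum_cong') (auto simp: finsum_insert Pi_iff)
      also have "\<dots> = (\<Oplus>s\<in>S. s (z \<otimes> c i) \<otimes> Us ! i) \<oplus> (\<Oplus>s\<in>S. \<Oplus>j\<in>J. s (z \<otimes> c j) \<otimes> Us ! j)"
        using insert.prems by (intro finsum_addf) (auto intro!: finsum_closed)
      finally show ?case using insert by (simp add: finsum_insert Pi_iff)
    qed
  qed
  also have "\<dots> = (\<Oplus>s\<in>S. \<zero>)" using zero by (intro finsum_cong') auto
  finally have sum0: "(\<Oplus>j\<in>J. T j \<otimes> Us ! j) = \<zero>" by (simp add: finsum_zero)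
  define Ks where "Ks = map T [0..<length Us]"
  have Ks: "set Ks \<subseteq> F" "length Ks = length Us" "\<And>j. j \<in> J \<Longrightarrow> Ks ! j = T j"
    using TF by (auto simp: Ks_def J_def)
  have "combine Ks Us = (\<Oplus>j\<in>J. T j \<otimes> Us ! j)"
    unfolding combine_nth[OF subset_trans[OF Us(2) MR] subset_trans[OF Ks(1) FR] Ks(2)] J_def[symmetric]
    by (intro finsum_cong' Pi_I m_closed subsetD[OF FR TF] UM) (simp_all add: Ks(3))
  then have "set (take (length Us) Ks) \<subseteq> {\<zero>}"
    using independent_imp_trivial_combine[OF F Us(1)[folded F_def] Ks(1)] sum0 by simp
  moreover have "T j0 \<in> set Ks" using Ks(2,3) j0(1) by (metis J_def lessThan_iff nth_mem)
  ultimately show False using tz Ks(2) by (auto simp: T_def)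
qed

lemma artin:
  assumes M: "subfield M R" and S: "automorphisms M S"
  shows "\<exists>m\<le>card S. dimension m (fixed M S) M"
proof (rule dimension_of_bounded_independent)
  show F: "subfield (fixed M S) R" using fixed_subfield[OF M automorphismsD(6)[OF S]] .
  show "subalgebra (fixed M S) M R" using subfield_subalgebra[OF F M] by (auto simp: fixed_def)
qed (use artin_independent_bound[OF M S] in auto)

lemma gal_iff:
  assumes "subfield E R" "F \<subseteq> E"
  shows "s \<in> gal R F E \<longleftrightarrow> s \<in> endo E \<and> bij_betw s E E \<and> (\<forall>x\<in>F. s x = x) \<and> s \<in> extensional E"
  unfolding gal_def ring_iso_def by auto

text \<open>With more than n automorphisms, the equations over a basis of n vectors have a
  nontrivial solution c. The combination of the s with coefficients c s is F-linear and vanishes on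
  the basis, hence on E, against independence.\<close>

lemma dedekind_bound:
  assumes F: "subfield F R" and E: "subfield E R" and FE: "F \<subseteq> E"
    and S: "finite S" "S \<subseteq> gal R F E" and n: "dimension n F E"
  shows "card S \<le> n"
proof (rule ccontr)
  assume neg: "\<not> card S \<le> n"
  note ER = subfieldE(3)[OF E] and Es = subringE[OF subfieldE(1)[OF E]]
  have sE: "s \<in> endo E" "s \<in> extensional E" "\<And>x. x \<in> F \<Longrightarrow> s x = x" if "s \<in> S" for s
    using S(2) that gal_iff[OF E FE] by auto
  have sM: "s x \<in> E" "s x \<in> carrier R" if "s \<in> S" "x \<in> E" for s x
    using endoD(1)[OF sE(1)] that ER by auto
  obtain Us where Us: "set Us \<subseteq> carrier R" "independent F Us" "length Us = n" "Span F Us = E"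
    using exists_base[OF F n] by auto
  have UE: "set Us \<subseteq> E" using Span_base_incl[OF F Us(1)] Us(4) by simp
  have "\<exists>c. (\<forall>s\<in>S. c s \<in> E) \<and> (\<exists>s\<in>S. c s \<noteq> \<zero>) \<and> (\<forall>u\<in>set Us. (\<Oplus>s\<in>S. s u \<otimes> c s) = \<zero>)"
  proof (rule homogeneous_system[OF E _ S(1)])
    show "card (set Us) < card S" using neg Us(3) card_length[of Us] by simp
  qed (use sM UE in auto)
  then obtain c s0 where c: "\<And>s. s \<in> S \<Longrightarrow> c s \<in> E" and s0: "s0 \<in> S" "c s0 \<noteq> \<zero>"
    and rel: "\<And>u. u \<in> set Us \<Longrightarrow> (\<Oplus>s\<in>S. s u \<otimes> c s) = \<zero>" by auto
  have cR: "c s \<in> carrier R" if "s \<in> S" for s using c[OF that] ER by auto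
  have csR: "c s \<otimes> s x \<in> carrier R" if "s \<in> S" "x \<in> E" for s x
    using sM(2)[OF that] cR[OF that(1)] by simp
  define V where "V = {z \<in> E. (\<Oplus>s\<in>S. c s \<otimes> s z) = \<zero>}"
  have "subalgebra F V R"
  proof (intro subalgebra.intro subalgebra_axioms.intro)
    have add: "x \<oplus> y \<in> V" if xy: "x \<in> V" "y \<in> V" for x y
    proof -
      have xyE: "x \<in> E" "y \<in> E" using xy by (auto simp: V_def)
      have "(\<Oplus>s\<in>S. c s \<otimes> s (x \<oplus> y)) = (\<Oplus>s\<in>S. c s \<otimes> s x \<oplus> c s \<otimes> s y)"
      proof (intro finsum_cong')
        show "(\<lambda>s. c s \<otimes> s x \<oplus> c s \<otimes> s y) \<in> S \<rightarrow> carrier R"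
          using csR[OF _ xyE(1)] csR[OF _ xyE(2)] by blast
        fix s assume s: "s \<in> S"
        show "c s \<otimes> s (x \<oplus> y) = c s \<otimes> s x \<oplus> c s \<otimes> s y"
          using endoD(3)[OF sE(1)[OF s] xyE] cR[OF s] sM(2)[OF s] xyE by (simp add: r_distr)
      qed simp
      also have "\<dots> = (\<Oplus>s\<in>S. c s \<otimes> s x) \<oplus> (\<Oplus>s\<in>S. c s \<otimes> s y)"
        using csR[OF _ xyE(1)] csR[OF _ xyE(2)] by (intro finsum_addf) blast+
      finally show ?thesis using xy Es by (auto simp: V_def)
    qed
    have smult: "k \<otimes> x \<in> V" if k: "k \<in> F" and x: "x \<in> V" for k x
    proof -
      have kx: "k \<in> E" "x \<in> E" "k \<in> carrier R" using k x FE ER by (auto simp: V_def)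
      have "(\<Oplus>s\<in>S. c s \<otimes> s (k \<otimes> x)) = (\<Oplus>s\<in>S. k \<otimes> (c s \<otimes> s x))"
      proof (intro finsum_cong')
        show "(\<lambda>s. k \<otimes> (c s \<otimes> s x)) \<in> S \<rightarrow> carrier R"
          using csR[OF _ kx(2)] kx(3) by blast
        fix s assume s: "s \<in> S"
        show "c s \<otimes> s (k \<otimes> x) = k \<otimes> (c s \<otimes> s x)"
          using endoD(2)[OF sE(1)[OF s] kx(1,2)] sE(3)[OF s k] cR[OF s] sM(2)[OF s] kx by (simp add: m_lcomm)
      qed simp
      also have "\<dots> = k \<otimes> (\<Oplus>s\<in>S. c s \<otimes> s x)"
        using csR[OF _ kx(2)] kx(3) S(1) by (intro finsum_rdistr[symmetric]) blast+
      finally show ?thesis using x kx Es by (auto simp: V_def)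
    qed
    have "(\<Oplus>s\<in>S. c s \<otimes> s \<zero>) = (\<Oplus>s\<in>S. \<zero>)"
    proof (intro finsum_cong' Pi_I zero_closed)
      fix s assume s: "s \<in> S"
      show "c s \<otimes> s \<zero> = \<zero>" using endo_zero[OF E sE(1)[OF s]] cR[OF s] by simp
    qed auto
    then have zero: "\<zero> \<in> V" using Es by (simp add: V_def finsum_zero)
    show "subgroup V (add_monoid R)"
    proof (intro add.subgroupI)
      fix a assume a: "a \<in> V"
      then have "\<ominus> a = (\<ominus> \<one>) \<otimes> a" using ER by (auto simp: V_def l_minus)
      then show "\<ominus> a \<in> V" using smult[OF _ a, of "\<ominus> \<one>"] subringE(3,5)[OF subfieldE(1)[OF F]] by simp
    qed (use add zero ER V_def in auto)
    show "\<And>k v. k \<in> F \<Longrightarrow> v \<in> V \<Longrightarrow> k \<otimes> v \<in> V" using smult .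
  qed
  moreover have "set Us \<subseteq> V"
  proof
    fix u assume u: "u \<in> set Us"
    have "(\<Oplus>s\<in>S. c s \<otimes> s u) = (\<Oplus>s\<in>S. s u \<otimes> c s)"
      using u UE sM(2) cR by (intro finsum_cong' Pi_I m_closed) (auto simp: m_comm subset_iff)
    then show "u \<in> V" using rel u UE by (auto simp: V_def)
  qed
  ultimately have "E \<subseteq> V" using subalgebra_Span_incl[OF F] Us(4) by auto
  then have "c s0 = \<zero>"
    using independence_of_endomorphisms[OF E S(1), of c s0] sE cR s0 by (auto simp: V_def)
  then show False using s0 by simp
qed

text \<open>Finiteness itself comes from the uniform bound on the size of finite subsets.\<close>

lemma finite_gal:
  assumes "subfield F R" "subfield E R" "F \<subseteq> E" "dimension n F E"
  shows "finite (gal R F E)" "card (gal R F E) \<le> n"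
proof -
  show f: "finite (gal R F E)"
    using finite_if_finite_subsets_card_bdd[of "gal R F E" n] dedekind_bound[OF assms(1-3) _ _ assms(4)]
    by blast
  show "card (gal R F E) \<le> n" using dedekind_bound[OF assms(1-3) f _ assms(4)] by simp
qed

lemma automorphisms_bij:
  assumes M: "subfield M R" and S: "automorphisms M S" and s: "s \<in> S"
  shows "bij_betw s M M"
proof -
  obtain u where u: "u \<in> S" "\<forall>x\<in>M. s (u x) = x \<and> u (s x) = x" using automorphisms_inverse[OF M S s] by auto
  show ?thesis
    by (rule bij_betw_byWitness[of _ u])
       (use u endoD(1)[OF automorphismsD(2)[OF S]] s in auto)
qed

text \<open>The chain m \<le> card S \<le> card (gal) \<le> m, from Artin, inclusion and Dedekind,
  forces the number of automorphisms to be the degree.\<close>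

lemma galois_fixed:
  assumes M: "subfield M R" and S: "automorphisms M S"
  shows "galois R (fixed M S) M"
proof -
  have F: "subfield (fixed M S) R" using fixed_subfield[OF M automorphismsD(6)[OF S]] .
  have FM: "fixed M S \<subseteq> M" by (auto simp: fixed_def)
  obtain m where m: "m \<le> card S" "dimension m (fixed M S) M" using artin[OF M S] by auto
  have "S \<subseteq> gal R (fixed M S) M"
    using gal_iff[OF M FM] automorphismsD[OF S] automorphisms_bij[OF M S] by (auto simp: fixed_def)
  then have "card S \<le> card (gal R (fixed M S) M)" using finite_gal[OF F M FM m(2)] card_mono by blast
  then show ?thesis using finite_gal[OF F M FM m(2)] m F M FM dimI[OF F m(2)] finite_dimensionI[OF m(2)]
    unfolding galois_def over_def by auto
qed

lemma gal_automorphisms: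
  assumes F: "subfield F R" and E: "subfield E R" and FE: "F \<subseteq> E" and n: "dimension n F E"
  shows "automorphisms E (gal R F E)"
proof -
  note g = gal_iff[OF E FE]
  show ?thesis unfolding automorphisms_def
  proof (intro conjI ballI)
    show "gal R F E \<subseteq> endo E \<inter> extensional E" using g by auto
    show "(\<lambda>x\<in>E. x) \<in> gal R F E" unfolding g
    proof (intro conjI)
      show "bij_betw (\<lambda>x\<in>E. x) E E" by (simp add: bij_betw_def inj_on_def)
    qed (use FE subringE[OF subfieldE(1)[OF E]] in \<open>auto intro!: endoI\<close>)
    fix s t assume st: "s \<in> gal R F E" "t \<in> gal R F E"
    have "bij_betw (compose E s t) E E" using st unfolding g by (auto intro: bij_betw_compose)
    then show "compose E s t \<in> gal R F E" unfolding g using st endo_compose[OF E] FE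
      by (auto simp: g compose_def subset_iff)
  qed (rule finite_gal[OF F E FE n])
qed

text \<open>Let H be the fixed field. Artin and Dedekind give |E:H| = n = |E:F|, so |H:F| = 1 by
  multiplicativity of degrees, and the list [1] already spans H over F.\<close>

lemma galois_fixed_eq:
  assumes "galois R F E"
  shows "fixed E (gal R F E) = F"
proof -
  have F: "subfield F R" and E: "subfield E R" and FE: "F \<subseteq> E" and fd: "finite_dimension F E"
    and c: "card (gal R F E) = dim F E" using assms by (auto simp: galois_def)
  obtain n where n: "dimension n F E" using fd by auto
  have cn: "card (gal R F E) = n" using c dimI[OF F n] by (simp add: over_def)
  have n0: "n > 0" using dimension_pos[OF F E n] .
  note S = gal_automorphisms[OF F E FE n]
  define H where "H = fixed E (gal R F E)"
  have H: "subfield H R" "H \<subseteq> E" unfolding H_def using fixed_subfield[OF E automorphismsD(6)[OF S]] by (auto simp: fixed_def)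
  have FH: "F \<subseteq> H" using FE gal_iff[OF E FE] by (auto simp: H_def fixed_def)
  obtain m where m: "m \<le> n" "dimension m H E" using artin[OF E S] cn unfolding H_def by auto
  have "gal R F E \<subseteq> gal R H E" using gal_iff[OF E FE] gal_iff[OF E H(2)] by (auto simp: H_def fixed_def)
  then have "n \<le> m" using dedekind_bound[OF H(1) E H(2) automorphismsD(1)[OF S] _ m(2)] cn by simp
  then have mn: "m = n" using m by simp
  have "finite_dimension F H"
    using subalbegra_incl_imp_finite_dimension[OF F fd subfield_subalgebra[OF F H(1) FH] H(2)] .
  then obtain k where k: "dimension k F H" by auto
  have "dimension (k * n) F E" using telescopic_base[OF F H(1) k] m mn by simp
  then have "k * n = n" by (rule dimension_is_inj[OF F _ n])
  then have k1: "k = 1" using n0 by simp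
  have "H \<subseteq> F"
  proof -
    have ind: "independent F [\<one>]"
      by (intro li_Cons li_Nil) simp_all
    have "Span F [\<one>] = H"
    proof (rule iffD1[OF independent_length_eq_dimension[OF F k ind]])
      show "set [\<one>] \<subseteq> H" using subringE(3)[OF subfieldE(1)[OF H(1)]] by simp
    qed (simp add: k1)
    moreover have "Span F [\<one>] \<subseteq> F"
      using subringE(3)[OF subfieldE(1)[OF F]]
      by (intro subalgebra_Span_incl[OF F subfield_subalgebra[OF F F]]) auto
    ultimately show ?thesis by simp
  qed
  then show ?thesis using FH H_def by auto
qed

end

section \<open>Polynomials and their derivatives\<close>

text \<open>Coefficients are a function with an explicit number n of terms. No condition is put on
  the leading coefficient, which suits congruences: a nonzero coefficient may become zero modulo the
  maximal ideal.\<close>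

primrec (in ring) polyf :: "(nat \<Rightarrow> 'a) \<Rightarrow> nat \<Rightarrow> 'a \<Rightarrow> 'a" where
  "polyf c 0 x = \<zero>"
| "polyf c (Suc n) x = polyf c n x \<oplus> c n \<otimes> x [^] n"

text \<open>At n = 0 the truncated exponent n - 1 is harmless, because the multiple [0] annihilates
  the term.\<close>

primrec (in ring) dpolyf :: "(nat \<Rightarrow> 'a) \<Rightarrow> nat \<Rightarrow> 'a \<Rightarrow> 'a" where
  "dpolyf c 0 x = \<zero>"
| "dpolyf c (Suc n) x = dpolyf c n x \<oplus> c n \<otimes> ([n] \<cdot> (x [^] (n - 1)))"

context cring
begin

lemma add_pow_in_subring:
  assumes "subring B R" "x \<in> B" shows "[(n::nat)] \<cdot> x \<in> B"
  using subringE(2,7)[OF assms(1)] assms(2) by (induction n) auto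

lemma polyf_in_subring:
  assumes "subring B R" "\<And>j. j < n \<Longrightarrow> c j \<in> B" "x \<in> B"
  shows "polyf c n x \<in> B" "dpolyf c n x \<in> B"
  using assms(2) subringE(2,6,7)[OF assms(1)] subring_pow[OF assms(1,3)]
    add_pow_in_subring[OF assms(1) subring_pow[OF assms(1,3)]]
  by (induction n) auto

lemmas polyf_closed = polyf_in_subring[OF carrier_is_subring]

lemma polyf_cong: "(\<And>j. j < n \<Longrightarrow> c j = d j) \<Longrightarrow> polyf c n x = polyf d n x"
  by (induction n) auto

lemma polyf_add:
  assumes "\<And>j. j < n \<Longrightarrow> c j \<in> carrier R" "\<And>j. j < n \<Longrightarrow> d j \<in> carrier R" "x \<in> carrier R"
  shows "polyf (\<lambda>j. c j \<oplus> d j) n x = polyf c n x \<oplus> polyf d n x"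
  using assms(1,2)
proof (induction n)
  case (Suc n)
  have "polyf c n x \<in> carrier R" "polyf d n x \<in> carrier R"
    using polyf_in_subring(1)[OF carrier_is_subring] Suc.prems assms(3) by auto
  then show ?case using Suc assms(3) by (simp add: l_distr a_ac)
qed simp

lemma polyf_smult:
  assumes "\<And>j. j < n \<Longrightarrow> c j \<in> carrier R" "a \<in> carrier R" "x \<in> carrier R"
  shows "polyf (\<lambda>j. a \<otimes> c j) n x = a \<otimes> polyf c n x"
  using assms(1)
proof (induction n)
  case (Suc n)
  have "polyf c n x \<in> carrier R"
    using polyf_in_subring(1)[OF carrier_is_subring] Suc.prems assms(3) by auto
  then show ?case using Suc assms(2,3) by (simp add: r_distr m_assoc)
qed (simp add: assms)

text \<open>The quadratic remainder keeps its factor s in the subring B. For a valuation ring this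
  bounds the valuation of the remainder below by twice that of d.\<close>

lemma pow_taylor:
  assumes B: "subring B R" and x: "x \<in> B" and d: "d \<in> B"
  shows "\<exists>s\<in>B. (x \<oplus> d) [^] n = x [^] n \<oplus> d \<otimes> ([(n::nat)] \<cdot> (x [^] (n - 1))) \<oplus> d \<otimes> d \<otimes> s"
proof (induction n)
  case 0
  show ?case using subringE(1,2)[OF B] d by (intro bexI[of _ \<zero>]) auto
next
  case (Suc n)
  note Bs = subringE[OF B]
  define e where "e = [n] \<cdot> (x [^] (n - 1))"
  have eB: "e \<in> B" unfolding e_def using add_pow_in_subring[OF B subring_pow[OF B x]] .
  have ex: "e \<otimes> x = [n] \<cdot> (x [^] n)"
  proof (cases n)
    case (Suc m)
    then show ?thesis unfolding e_def using x Bs(1) by (simp add: add_pow_ldistr subset_iff del: add.nat_pow_Suc)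
  qed (use x Bs(1) in \<open>auto simp: e_def\<close>)
  obtain s where s: "s \<in> B" "(x \<oplus> d) [^] n = x [^] n \<oplus> d \<otimes> e \<oplus> d \<otimes> d \<otimes> s"
    using Suc by (auto simp: e_def)
  have C: "x \<in> carrier R" "d \<in> carrier R" "e \<in> carrier R" "s \<in> carrier R" "x [^] n \<in> carrier R" "[n] \<cdot> (x [^] n) \<in> carrier R"
    using x d eB s(1) Bs(1) by auto
  have "(x \<oplus> d) [^] Suc n = (x [^] n \<oplus> d \<otimes> e \<oplus> d \<otimes> d \<otimes> s) \<otimes> (x \<oplus> d)" using s(2) by simp
  also have "\<dots> = x [^] n \<otimes> x \<oplus> d \<otimes> (e \<otimes> x \<oplus> x [^] n) \<oplus> d \<otimes> d \<otimes> (e \<oplus> s \<otimes> x \<oplus> s \<otimes> d)"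
    using C by algebra
  also have "e \<otimes> x \<oplus> x [^] n = [Suc n] \<cdot> (x [^] n)" using ex by simp
  finally have "(x \<oplus> d) [^] Suc n = x [^] Suc n \<oplus> d \<otimes> ([Suc n] \<cdot> (x [^] (Suc n - 1))) \<oplus> d \<otimes> d \<otimes> (e \<oplus> s \<otimes> x \<oplus> s \<otimes> d)"
    by simp
  then show ?case using Bs x d eB s(1) by (intro bexI[of _ "e \<oplus> s \<otimes> x \<oplus> s \<otimes> d"]) auto
qed

lemma polyf_taylor:
  assumes B: "subring B R" and x: "x \<in> B" and d: "d \<in> B" and c: "\<And>j. j < n \<Longrightarrow> c j \<in> B"
  shows "\<exists>s\<in>B. polyf c n (x \<oplus> d) = polyf c n x \<oplus> d \<otimes> dpolyf c n x \<oplus> d \<otimes> d \<otimes> s"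
  using c
proof (induction n)
  case 0
  show ?case using subringE(1,2)[OF B] d by (intro bexI[of _ \<zero>]) auto
next
  case (Suc n)
  note Bs = subringE[OF B]
  obtain s where s: "s \<in> B" "polyf c n (x \<oplus> d) = polyf c n x \<oplus> d \<otimes> dpolyf c n x \<oplus> d \<otimes> d \<otimes> s"
    using Suc by auto
  obtain t where t: "t \<in> B" "(x \<oplus> d) [^] n = x [^] n \<oplus> d \<otimes> ([n] \<cdot> (x [^] (n - 1))) \<oplus> d \<otimes> d \<otimes> t"
    using pow_taylor[OF B x d] by auto
  have p: "polyf c n x \<in> B" "dpolyf c n x \<in> B" using polyf_in_subring[OF B _ x] Suc.prems by auto
  have e: "[n] \<cdot> (x [^] (n - 1)) \<in> B" using add_pow_in_subring[OF B subring_pow[OF B x]] .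
  have C: "x \<in> carrier R" "d \<in> carrier R" "s \<in> carrier R" "t \<in> carrier R" "x [^] n \<in> carrier R"
    "polyf c n x \<in> carrier R" "dpolyf c n x \<in> carrier R" "[n] \<cdot> (x [^] (n - 1)) \<in> carrier R" "c n \<in> carrier R"
    using x d s(1) t(1) p e Suc.prems Bs(1) by auto
  have "polyf c (Suc n) (x \<oplus> d) = polyf c (Suc n) x \<oplus> d \<otimes> dpolyf c (Suc n) x \<oplus> d \<otimes> d \<otimes> (s \<oplus> c n \<otimes> t)"
    unfolding polyf.simps dpolyf.simps s(2) t(2) using C by algebra
  then show ?case using Bs Suc.prems s(1) t(1) by (intro bexI[of _ "s \<oplus> c n \<otimes> t"]) auto
qed

text \<open>After this index shift the derivative is itself a \<open>polyf\<close>, so estimates for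
  values and residual independence apply to it.\<close>

lemma dpolyf_eq_polyf:
  assumes "\<And>j. j < Suc n \<Longrightarrow> c j \<in> carrier R" "x \<in> carrier R"
  shows "dpolyf c (Suc n) x = polyf (\<lambda>j. [Suc j] \<cdot> c (Suc j)) n x"
  using assms(1)
proof (induction n)
  case (Suc n)
  then show ?case
    using assms(2) by (simp add: add_pow_ldistr add_pow_rdistr del: add.nat_pow_Suc)
qed (use assms in simp)

end

subsection \<open>Derivatives of coefficient lists\<close>

text \<open>Leading coefficients come first, so the exponent of the head is the length of the tail;
  \<open>normalize\<close> only strips zeros and does not change values.\<close>

lemma (in ring) poly_deriv_eval_Cons:
  assumes "set (b # p) \<subseteq> carrier R" "x \<in> carrier R"
  shows "eval (poly_deriv R (b # p)) x = ([length p] \<cdot> b) \<otimes> x [^] (length p - 1) \<oplus> eval (poly_deriv R p) x"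
proof -
  define D where "D q = map2 (\<lambda>c (i::nat). [i] \<cdot> c) (butlast q) (rev [1..<length q])" for q
  have DC: "set (D q) \<subseteq> carrier R" if "set q \<subseteq> carrier R" for q
    using that by (auto simp: D_def dest!: set_zip_leftD in_set_butlastD)
  have e: "eval (poly_deriv R q) x = eval (D q) x" if "set q \<subseteq> carrier R" for q
    unfolding poly_deriv_def D_def[symmetric] using eval_normalize[OF DC[OF that] assms(2)] .
  show ?thesis
  proof (cases "p = []")
    case True
    then show ?thesis using assms e[of "[b]"] e[of "[]"] by (simp add: D_def)
  next
    case False
    have "D (b # p) = ([length p] \<cdot> b) # D p" using False by (cases p) (simp_all add: D_def)
    moreover have "length (D p) = length p - 1" by (simp add: D_def)
    ultimately show ?thesis using e[of p] e[of "b # p"] assms by simp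
  qed
qed

text \<open>The passage from the coefficient lists in which separability is defined to coefficient
  functions. The head of a list becomes the coefficient at position \<open>length p\<close>.\<close>

lemma (in cring) list_polyf:
  assumes "subring M R" "set p \<subseteq> M"
  shows "\<exists>c. (\<forall>j. c j \<in> M) \<and> (\<forall>x\<in>carrier R. eval p x = polyf c (length p) x \<and>
           eval (poly_deriv R p) x = dpolyf c (length p) x)"
  using assms(2)
proof (induction p)
  case Nil
  show ?case using subringE(2)[OF assms(1)] by (intro exI[of _ "\<lambda>_. \<zero>"]) (simp add: poly_deriv_def)
next
  case (Cons b p)
  note MR = subringE(1)[OF assms(1)]
  obtain c where c: "\<And>j. c j \<in> M"
    "\<And>x. x \<in> carrier R \<Longrightarrow> eval p x = polyf c (length p) x \<and> eval (poly_deriv R p) x = dpolyf c (length p) x"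
    using Cons by auto
  define d where "d = c(length p := b)"
  have dn: "polyf d n x = polyf c n x" "dpolyf d n x = dpolyf c n x" if "n \<le> length p" for n x
    using that by (induction n) (auto simp: d_def)
  have "eval (b # p) x = polyf d (length (b # p)) x \<and> eval (poly_deriv R (b # p)) x = dpolyf d (length (b # p)) x"
    if x: "x \<in> carrier R" for x
  proof
    have pM: "set p \<subseteq> carrier R" "set (b # p) \<subseteq> carrier R" "b \<in> carrier R" using Cons.prems MR by auto
    have cR: "c j \<in> carrier R" for j using c(1) MR by auto
    have cr: "polyf c (length p) x \<in> carrier R" "dpolyf c (length p) x \<in> carrier R"
      by (rule polyf_closed[OF cR x])+
    show "eval (b # p) x = polyf d (length (b # p)) x"
      using c(2)[OF x] dn[of "length p" x] pM x cr by (simp add: d_def a_comm)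
    show "eval (poly_deriv R (b # p)) x = dpolyf d (length (b # p)) x"
      unfolding poly_deriv_eval_Cons[OF pM(2) x]
      using c(2)[OF x] dn[of "length p" x] pM x cr by (simp add: d_def a_comm add_pow_ldistr add_pow_rdistr)
  qed
  moreover have "\<forall>j. d j \<in> M" using c(1) Cons.prems by (simp add: d_def)
  ultimately show ?case by blast
qed

text \<open>The ring of dual numbers turns the product rule into multiplicativity of evaluation.\<close>

definition dual_numbers :: "('a, 'b) ring_scheme \<Rightarrow> ('a \<times> 'a) ring" where
  "dual_numbers R = \<lparr>carrier = carrier R \<times> carrier R,
     monoid.mult = (\<lambda>x y. (fst x \<otimes>\<^bsub>R\<^esub> fst y, fst x \<otimes>\<^bsub>R\<^esub> snd y \<oplus>\<^bsub>R\<^esub> snd x \<otimes>\<^bsub>R\<^esub> fst y)),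
     monoid.one = (\<one>\<^bsub>R\<^esub>, \<zero>\<^bsub>R\<^esub>), ring.zero = (\<zero>\<^bsub>R\<^esub>, \<zero>\<^bsub>R\<^esub>),
     ring.add = (\<lambda>x y. (fst x \<oplus>\<^bsub>R\<^esub> fst y, snd x \<oplus>\<^bsub>R\<^esub> snd y))\<rparr>"

lemma (in cring) dual_numbers_cring: "cring (dual_numbers R)"
proof (rule cringI)
  show "abelian_group (dual_numbers R)"
  proof (rule abelian_groupI)
    fix x assume "x \<in> carrier (dual_numbers R)"
    then show "\<exists>y\<in>carrier (dual_numbers R). y \<oplus>\<^bsub>dual_numbers R\<^esub> x = \<zero>\<^bsub>dual_numbers R\<^esub>"
      by (intro bexI[of _ "(\<ominus> fst x, \<ominus> snd x)"]) (auto simp: dual_numbers_def l_neg)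
  qed (auto simp: dual_numbers_def a_ac)
  show "comm_monoid (dual_numbers R)"
  proof (rule comm_monoidI)
    fix x y z assume "x \<in> carrier (dual_numbers R)" "y \<in> carrier (dual_numbers R)" "z \<in> carrier (dual_numbers R)"
    then show "x \<otimes>\<^bsub>dual_numbers R\<^esub> y \<otimes>\<^bsub>dual_numbers R\<^esub> z = x \<otimes>\<^bsub>dual_numbers R\<^esub> (y \<otimes>\<^bsub>dual_numbers R\<^esub> z)"
      unfolding dual_numbers_def by (clarsimp, intro conjI; algebra)
  qed (auto simp: dual_numbers_def m_comm a_comm)
  fix x y z assume "x \<in> carrier (dual_numbers R)" "y \<in> carrier (dual_numbers R)" "z \<in> carrier (dual_numbers R)"
  then show "(x \<oplus>\<^bsub>dual_numbers R\<^esub> y) \<otimes>\<^bsub>dual_numbers R\<^esub> z = x \<otimes>\<^bsub>dual_numbers R\<^esub> z \<oplus>\<^bsub>dual_numbers R\<^esub> y \<otimes>\<^bsub>dual_numbers R\<^esub> z"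
    unfolding dual_numbers_def by (clarsimp, intro conjI; algebra)
qed

lemma (in cring) eval_deriv_mult:
  assumes p: "set p \<subseteq> carrier R" and q: "set q \<subseteq> carrier R" and a: "a \<in> carrier R"
  shows "eval (poly_deriv R (poly_mult p q)) a
    = eval p a \<otimes> eval (poly_deriv R q) a \<oplus> eval (poly_deriv R p) a \<otimes> eval q a"
proof -
  let ?D = "dual_numbers R"
  define h where "h c = (c, \<zero>)" for c :: 'a
  have ds: "carrier ?D = carrier R \<times> carrier R" "\<zero>\<^bsub>?D\<^esub> = (\<zero>, \<zero>)" "\<one>\<^bsub>?D\<^esub> = (\<one>, \<zero>)"
    "\<And>x y u v. (x, y) \<oplus>\<^bsub>?D\<^esub> (u, v) = (x \<oplus> u, y \<oplus> v)"
    "\<And>x y u v. (x, y) \<otimes>\<^bsub>?D\<^esub> (u, v) = (x \<otimes> u, x \<otimes> v \<oplus> y \<otimes> u)"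
    by (simp_all add: dual_numbers_def)
  have hom: "h \<in> ring_hom R ?D" unfolding ring_hom_def by (simp add: dual_numbers_def h_def)
  interpret D: cring ?D by (rule dual_numbers_cring)
  interpret h: ring_hom_ring R ?D h by (rule ring_hom_ringI2[OF ring_axioms D.ring_axioms hom])
  have aD: "(a, \<one>) \<in> carrier ?D" using a by (simp add: ds)
  \<comment> \<open>In the powers of a + epsilon the second component is the derivative of X^n at
    a.\<close>
  have pw: "(a, \<one>) [^]\<^bsub>?D\<^esub> n = (a [^] n, [n] \<cdot> (a [^] (n - 1)))" for n :: nat
  proof (induction n)
    case (Suc n)
    have "[n] \<cdot> (a [^] (n - 1)) \<otimes> a = [n] \<cdot> (a [^] n)"
      using a by (cases n) (simp_all add: add_pow_ldistr del: add.nat_pow_Suc)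
    moreover have "(a, \<one>) [^]\<^bsub>?D\<^esub> Suc n = (a [^] n \<otimes> a, a [^] n \<otimes> \<one> \<oplus> [n] \<cdot> (a [^] (n - 1)) \<otimes> a)"
      unfolding D.nat_pow_Suc Suc.IH ds(5) ..
    ultimately show ?case using a a_comm[of "a [^] n" "[n] \<cdot> (a [^] n)"] by simp
  qed (simp add: ds)
  have ev: "D.eval (map h r) (a, \<one>) = (eval r a, eval (poly_deriv R r) a)" if "set r \<subseteq> carrier R" for r
    using that
  proof (induction r)
    case Nil
    have "eval (poly_deriv R []) a = \<zero>" by (simp add: poly_deriv_def)
    moreover have "D.eval (map h []) (a, \<one>) = \<zero>\<^bsub>?D\<^esub>" by (simp only: D.eval.simps list.map)
    ultimately show ?case by (simp only: ds eval.simps)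
  next
    case (Cons b r)
    have "D.eval (map h (b # r)) (a, \<one>) = h b \<otimes>\<^bsub>?D\<^esub> (a [^] length r, [length r] \<cdot> (a [^] (length r - 1))) \<oplus>\<^bsub>?D\<^esub> (eval r a, eval (poly_deriv R r) a)"
      using Cons by (simp add: pw)
    also have "\<dots> = (eval (b # r) a, eval (poly_deriv R (b # r)) a)"
      unfolding poly_deriv_eval_Cons[OF Cons.prems a]
      using Cons.prems a by (simp add: ds h_def add_pow_ldistr add_pow_rdistr)
    finally show ?case .
  qed
  have mC: "set (map h r) \<subseteq> carrier ?D" if "set r \<subseteq> carrier R" for r
    using that by (auto simp: ds h_def)
  have pq: "set (poly_mult p q) \<subseteq> carrier R" using poly_mult_in_carrier[OF p q] .
  have "D.eval (map h (poly_mult p q)) (a, \<one>) = D.eval (D.normalize (map h (poly_mult p q))) (a, \<one>)"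
    using D.eval_normalize[OF mC[OF pq] aD] by simp
  also have "\<dots> = D.eval (map h p) (a, \<one>) \<otimes>\<^bsub>?D\<^esub> D.eval (map h q) (a, \<one>)"
    unfolding h.poly_mult_hom'[OF p q] using D.eval_poly_mult[OF mC[OF p] mC[OF q] aD] .
  finally show ?thesis unfolding ev[OF p] ev[OF q] ev[OF pq] by (simp add: ds)
qed

subsection \<open>Separability from a group of automorphisms\<close>

text \<open>A common divisor of the irreducible f and of f' is a unit or associated to f. Hence
  separability means that f does not divide f', and by minimality of f this is f'(a) \<noteq> 0; the
  case f' = 0 is covered.\<close>

lemma (in field) separable_irr_iff:
  assumes F: "subfield F R" and a: "a \<in> carrier R" "(algebraic over F) a"
  shows "separable_poly R F (Irr F a) \<longleftrightarrow> eval (poly_deriv R (Irr F a)) a \<noteq> \<zero>"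
proof -
  define f where "f = Irr F a"
  note I = IrrE[OF F a, folded f_def]
  interpret UF: domain "F[X]" using univ_poly_is_domain[OF subfieldE(1)[OF F]] .
  interpret ev: ring_hom_ring "F[X]" R "\<lambda>p. eval p a" using eval_ring_hom[OF subfieldE(1)[OF F] a(1)] .
  have fC: "set f \<subseteq> F" using I(1) polynomial_incl univ_poly_carrier by blast
  have fR: "set f \<subseteq> carrier R" using fC subfieldE(3)[OF F] by auto
  have f': "poly_deriv R f \<in> carrier (F[X])"
  proof -
    have "[(i::nat)] \<cdot> c \<in> F" if "c \<in> F" for i c using add_pow_in_subring[OF subfieldE(1)[OF F] that] .
    then have "set (map2 (\<lambda>c (i::nat). [i] \<cdot> c) (butlast f) (rev [1..<length f])) \<subseteq> F"
      using fC by (auto dest!: set_zip_leftD in_set_butlastD)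
    then show ?thesis unfolding poly_deriv_def univ_poly_carrier[symmetric]
      using normalize_gives_polynomial by blast
  qed
  show ?thesis unfolding f_def[symmetric]
  proof
    assume s: "separable_poly R F f"
    show "eval (poly_deriv R f) a \<noteq> \<zero>"
    proof
      assume "eval (poly_deriv R f) a = \<zero>"
      then have "f pdivides poly_deriv R f" using Irr_minimal[OF F a f'] f_def by simp
      then have "f divides\<^bsub>F[X]\<^esub> poly_deriv R f" using pdivides_iff_shell[OF F I(1) f'] by simp
      then have "degree f = 0" using s I(1) by (auto simp: separable_poly_def)
      then show False using pirreducible_degree[OF F I(1,2)] by simp
    qed
  next
    assume n: "eval (poly_deriv R f) a \<noteq> \<zero>"
    show "separable_poly R F f" unfolding separable_poly_def
    proof (intro ballI impI)
      fix d assume d: "d \<in> carrier (F[X])" "d divides\<^bsub>F[X]\<^esub> f \<and> d divides\<^bsub>F[X]\<^esub> poly_deriv R f"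
      show "degree d = 0"
      proof (rule ccontr)
        assume deg: "degree d \<noteq> 0"
        have "d \<notin> Units (F[X])"
        proof
          assume "d \<in> Units (F[X])"
          then obtain k where "d = [k]" unfolding univ_poly_units[OF F] by blast
          then show False using deg by simp
        qed
        then have "d \<sim>\<^bsub>F[X]\<^esub> f" using divides_pirreducible_condition[OF I(2) d(1)] d(2) by blast
        then obtain g where g: "g \<in> carrier (F[X])" "d = f \<otimes>\<^bsub>F[X]\<^esub> g" unfolding associated_def factor_def by blast
        obtain e where e: "e \<in> carrier (F[X])" "poly_deriv R f = d \<otimes>\<^bsub>F[X]\<^esub> e" using d(2) unfolding factor_def by blast
        have "eval d a = \<zero>" using g I(1,4) ev.hom_mult[OF I(1) g(1)] ev.hom_closed[OF g(1)] by simp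
        then have "eval (poly_deriv R f) a = \<zero>" using e ev.hom_mult[OF d(1) e(1)] ev.hom_closed[OF e(1)] by simp
        then show False using n by simp
      qed
    qed
  qed
qed

text \<open>The product of the X - r over such a finite set A is invariant under G, so it has
  coefficients in F, and a is a simple root of it. The minimal polynomial of a divides this product
  and inherits the simple root.\<close>

lemma (in field) separable_extI:
  assumes F: "subfield F R"
    and G: "\<And>s. s \<in> G \<Longrightarrow> s \<in> ring_hom R R"
    and orb: "\<And>a. a \<in> carrier R \<Longrightarrow> \<exists>A. finite A \<and> a \<in> A \<and> A \<subseteq> carrier R \<and> (\<forall>s\<in>G. s ` A = A)"
    and fixF: "\<And>x. x \<in> carrier R \<Longrightarrow> (\<And>s. s \<in> G \<Longrightarrow> s x = x) \<Longrightarrow> x \<in> F"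
  shows "separable_ext R F"
  unfolding separable_ext_def
proof (intro ballI)
  fix a assume a: "a \<in> carrier R"
  obtain A where AA: "finite A \<and> a \<in> A \<and> A \<subseteq> carrier R \<and> (\<forall>s\<in>G. s ` A = A)" using orb[OF a] by (rule exE)
  have A: "finite A" "a \<in> A" "A \<subseteq> carrier R" using AA by simp_all
  have A4: "s ` A = A" if "s \<in> G" for s using AA that by blast
  let ?P = "(carrier R)[X]"
  interpret UP: domain ?P using univ_poly_is_domain[OF carrier_is_subring] .
  define l where "l r = [\<one>, \<ominus> r]" for r
  have lC: "l r \<in> carrier ?P" if "r \<in> carrier R" for r
    using that by (simp add: l_def univ_poly_carrier[symmetric] polynomial_def)
  define g where "g = finprod ?P l A"
  define q where "q = finprod ?P l (A - {a})"
  have lA: "l \<in> A \<rightarrow> carrier ?P" using lC A(3) by auto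
  have qC: "q \<in> carrier ?P" unfolding q_def using lA by (intro UP.finprod_closed) auto
  have gC: "g \<in> carrier ?P" unfolding g_def using lA by (intro UP.finprod_closed) auto
  have gq: "g = l a \<otimes>\<^bsub>?P\<^esub> q"
  proof -
    have "insert a (A - {a}) = A" using A(2) by auto
    then show ?thesis unfolding g_def q_def
      using UP.finprod_insert[of "A - {a}" a l] A(1) lA lC[OF a] by (simp add: Pi_iff)
  qed
  interpret ev: ring_hom_cring ?P R "\<lambda>p. eval p a" using eval_cring_hom[OF carrier_is_subring a] .
  have "eval (finprod ?P l B) a \<noteq> \<zero>" if "finite B" "B \<subseteq> carrier R - {a}" for B
    using that
  proof (induction B rule: finite_induct)
    case empty
    then show ?case using ev.hom_one by (simp add: UP.finprod_empty)
  next
    case (insert r B)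
    have C: "l \<in> B \<rightarrow> carrier ?P" "l r \<in> carrier ?P" using lC insert.prems by auto
    have "eval (l r) a = a \<ominus> r" using a insert.prems by (simp add: l_def a_minus_def)
    then have "eval (l r) a \<noteq> \<zero>" using a insert.prems by auto
    moreover have "eval (finprod ?P l B) a \<noteq> \<zero>" using insert by auto
    ultimately show ?case using insert.hyps C UP.finprod_insert[of B r l] ev.hom_mult[of "l r" "finprod ?P l B"]
        UP.finprod_closed[OF C(1)] ev.hom_closed integral[of "eval (l r) a" "eval (finprod ?P l B) a"] by auto
  qed
  then have q0: "eval q a \<noteq> \<zero>" unfolding q_def using A(1,3) by auto
  have setC: "set p \<subseteq> carrier R" if "p \<in> carrier ?P" for p
    using that polynomial_incl univ_poly_carrier by blast
  have la: "eval (l a) a = \<zero>" using a by (simp add: l_def r_neg)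
  have la': "eval (poly_deriv R (l a)) a = \<one>"
    using poly_deriv_eval_Cons[of \<one> "[\<ominus> a]" a] poly_deriv_eval_Cons[of "\<ominus> a" "[]" a] a
    by (simp add: l_def poly_deriv_def)
  have dC: "eval (poly_deriv R p) a \<in> carrier R" if p: "p \<in> carrier ?P" for p
  proof -
    obtain c where "\<forall>j. c j \<in> carrier R" "eval (poly_deriv R p) a = dpolyf c (length p) a"
      using list_polyf[OF carrier_is_subring setC[OF p]] a by auto
    then show ?thesis using polyf_closed(2)[of "length p" c a] a by auto
  qed
  have g0: "eval g a = \<zero>" using ev.hom_mult[OF lC[OF a] qC] gq la ev.hom_closed[OF qC] by simp
  \<comment> \<open>By the product rule the derivative of (X - a) q at a is q(a).\<close>
  have g1: "eval (poly_deriv R g) a \<noteq> \<zero>"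
    using eval_deriv_mult[OF setC[OF lC[OF a]] setC[OF qC] a] gq la la' q0 dC[OF qC] ev.hom_closed[OF qC]
    by (simp add: univ_poly_mult)
  have gF: "g \<in> carrier (F[X])"
  proof -
    have "map s g = g" if s: "s \<in> G" for s
    proof -
      interpret s: ring_hom_ring R R s by (rule ring_hom_ringI2[OF ring_axioms ring_axioms G[OF s]])
      have inj: "inj_on s (carrier R)" by (rule non_trivial_field_hom_is_inj[OF G[OF s] field_axioms field_axioms])
      have norm: "normalize (map s p) = map s p" if "p \<in> carrier ?P" for p
      proof (cases p)
        case (Cons b r)
        then have "b \<noteq> \<zero>" "b \<in> carrier R" using that by (auto simp: univ_poly_carrier[symmetric] polynomial_def)
        then have "s b \<noteq> \<zero>" using inj by (metis inj_onD s.hom_zero zero_closed)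
        then show ?thesis using Cons by simp
      qed simp
      have map_mult: "map s (p \<otimes>\<^bsub>?P\<^esub> r) = map s p \<otimes>\<^bsub>?P\<^esub> map s r" if "p \<in> carrier ?P" "r \<in> carrier ?P" for p r
        using s.poly_mult_hom'[OF setC[OF that(1)] setC[OF that(2)]] norm[OF UP.m_closed[OF that]]
        by (simp add: univ_poly_mult)
      have "map s (finprod ?P l B) = finprod ?P (\<lambda>r. l (s r)) B" if "finite B" "B \<subseteq> carrier R" for B
        using that
      proof (induction B rule: finite_induct)
        case empty
        then show ?case by (simp add: univ_poly_one)
      next
        case (insert r B)
        have C: "l \<in> B \<rightarrow> carrier ?P" "l r \<in> carrier ?P" using lC insert.prems by auto
        have C': "(\<lambda>r. l (s r)) \<in> B \<rightarrow> carrier ?P" "l (s r) \<in> carrier ?P" using lC insert.prems by auto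
        have "map s (l r) = l (s r)" using insert.prems by (simp add: l_def)
        then show ?case using insert C C' UP.finprod_insert[of B r l] UP.finprod_insert[of B r "\<lambda>r. l (s r)"]
            map_mult[OF C(2) UP.finprod_closed[OF C(1)]] by simp
      qed
      then have "map s g = finprod ?P (\<lambda>r. l (s r)) A" unfolding g_def using A(1,3) by blast
      also have "\<dots> = finprod ?P l (s ` A)"
        unfolding A4[OF s] using inj_on_subset[OF inj A(3)] lA
        by (subst (2) A4[OF s, symmetric], intro UP.finprod_reindex[symmetric]) (simp_all add: A4[OF s])
      finally show ?thesis using A4[OF s] by (simp add: g_def)
    qed
    then have "\<And>s c. s \<in> G \<Longrightarrow> c \<in> set g \<Longrightarrow> s c = c" by (metis map_idI map_eq_conv list.map_ident)
    then have "set g \<subseteq> F" using fixF setC[OF gC] by blast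
    then show ?thesis using gC by (auto simp: univ_poly_carrier[symmetric] polynomial_def)
  qed
  have "g \<noteq> []" using g1 by (auto simp: poly_deriv_def)
  then have alg: "(algebraic over F) a" using algebraicI[OF gF _ g0] by simp
  note I = IrrE[OF F a alg]
  have IC: "Irr F a \<in> carrier ?P" using I(1) carrier_polynomial_shell[OF subfieldE(1)[OF F]] by auto
  obtain h where h: "h \<in> carrier ?P" "g = Irr F a \<otimes>\<^bsub>?P\<^esub> h"
    using Irr_minimal[OF F a alg gF g0] unfolding pdivides_def factor_def by auto
  have "eval (poly_deriv R (Irr F a)) a \<noteq> \<zero>"
    using eval_deriv_mult[OF setC[OF IC] setC[OF h(1)] a] h(2) g1 I(4) dC[OF h(1)] ev.hom_closed[OF h(1)]
    by (auto simp: univ_poly_mult)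
  then show "ring.algebraic R F a \<and> separable_poly R F (ring.Irr R F a)"
    using separable_irr_iff[OF F a alg] alg by (simp add: over_def)
qed

section \<open>Valued fields\<close>

locale valued_field = field R for R (structure) +
  fixes w :: "'a \<Rightarrow> ereal"
  assumes val: "valuation R w"
begin

lemma w_inf: "x \<in> carrier R \<Longrightarrow> w x = \<infinity> \<longleftrightarrow> x = \<zero>"
  and w_minf: "x \<in> carrier R \<Longrightarrow> w x \<noteq> -\<infinity>"
  and w_mult: "x \<in> carrier R \<Longrightarrow> y \<in> carrier R \<Longrightarrow> w (x \<otimes> y) = w x + w y"
  and w_add: "x \<in> carrier R \<Longrightarrow> y \<in> carrier R \<Longrightarrow> min (w x) (w y) \<le> w (x \<oplus> y)"
  using val unfolding valuation_def by blast+

lemma w_zero [simp]: "w \<zero> = \<infinity>" using w_inf[of \<zero>] by simp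

lemma w_real:
  assumes "x \<in> carrier R" "x \<noteq> \<zero>"
  obtains r where "w x = ereal r"
  using w_inf[OF assms(1)] w_minf[OF assms(1)] assms(2) by (cases "w x") auto

lemma w_one [simp]: "w \<one> = 0"
proof -
  obtain r where r: "w \<one> = ereal r" using w_real[of \<one>] by auto
  have "w \<one> = w \<one> + w \<one>" using w_mult[of \<one> \<one>] by simp
  then show ?thesis using r by (simp add: zero_ereal_def)
qed

lemma w_uminus [simp]: assumes "x \<in> carrier R" shows "w (\<ominus> x) = w x"
proof -
  obtain r where r: "w (\<ominus> \<one>) = ereal r" using w_real[of "\<ominus> \<one>"] by auto
  have "(\<ominus> \<one>) \<otimes> (\<ominus> \<one>) = \<one>" by (simp add: l_minus r_minus)
  then have "w (\<ominus> \<one>) + w (\<ominus> \<one>) = 0" using w_mult[of "\<ominus> \<one>" "\<ominus> \<one>"] by simp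
  then have "w (\<ominus> \<one>) = 0" using r by (simp add: zero_ereal_def)
  moreover have "\<ominus> x = (\<ominus> \<one>) \<otimes> x" using assms by (simp add: l_minus)
  ultimately show ?thesis using w_mult[of "\<ominus> \<one>" x] assms by simp
qed

lemma w_inv: assumes "x \<in> carrier R" "x \<noteq> \<zero>" shows "w (inv x) = - w x"
proof -
  have i: "inv x \<in> carrier R" "x \<otimes> inv x = \<one>" "inv x \<noteq> \<zero>" using assms field_Units by (auto simp: nonzero_imp_inverse_nonzero)
  obtain r s where "w x = ereal r" "w (inv x) = ereal s" using w_real assms i by metis
  moreover have "w x + w (inv x) = 0" using w_mult[OF assms(1) i(1)] i(2) by simp
  ultimately show ?thesis by (simp add: zero_ereal_def)
qed

lemma w_pow: "x \<in> carrier R \<Longrightarrow> x \<noteq> \<zero> \<Longrightarrow> w x = ereal r \<Longrightarrow> w (x [^] (n::nat)) = ereal (real n * r)"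
proof (induction n)
  case (Suc n)
  then show ?case using w_mult[of "x [^] n" x] by (simp add: algebra_simps)
qed (simp add: zero_ereal_def)

lemma w_add_ge: "x \<in> carrier R \<Longrightarrow> y \<in> carrier R \<Longrightarrow> r \<le> w x \<Longrightarrow> r \<le> w y \<Longrightarrow> r \<le> w (x \<oplus> y)"
  using w_add[of x y] by (meson min.boundedI order_trans)

lemma w_add_gt: "x \<in> carrier R \<Longrightarrow> y \<in> carrier R \<Longrightarrow> r < w x \<Longrightarrow> r < w y \<Longrightarrow> r < w (x \<oplus> y)"
  using w_add[of x y] by (meson min_less_iff_conj order_less_le_trans)

lemma w_minus_ge: "x \<in> carrier R \<Longrightarrow> y \<in> carrier R \<Longrightarrow> r \<le> w x \<Longrightarrow> r \<le> w y \<Longrightarrow> r \<le> w (x \<ominus> y)"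
  unfolding a_minus_def using w_add_ge[of x "\<ominus> y"] by simp

lemma w_minus_gt: "x \<in> carrier R \<Longrightarrow> y \<in> carrier R \<Longrightarrow> r < w x \<Longrightarrow> r < w y \<Longrightarrow> r < w (x \<ominus> y)"
  unfolding a_minus_def using w_add_gt[of x "\<ominus> y"] by simp

lemma w_minus_commute: "x \<in> carrier R \<Longrightarrow> y \<in> carrier R \<Longrightarrow> w (x \<ominus> y) = w (y \<ominus> x)"
  using w_uminus[of "x \<ominus> y"] by (simp add: a_minus_def minus_add a_comm)

lemma w_add_eq:
  assumes "x \<in> carrier R" "y \<in> carrier R" "w x < w y"
  shows "w (x \<oplus> y) = w x"
proof (rule antisym)
  show "w x \<le> w (x \<oplus> y)" using w_add_ge assms by auto
  show "w (x \<oplus> y) \<le> w x"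
  proof (rule ccontr)
    assume "\<not> ?thesis"
    then have "w x < w ((x \<oplus> y) \<ominus> y)" using assms by (intro w_minus_gt) auto
    moreover have "(x \<oplus> y) \<ominus> y = x" using assms by (simp add: a_minus_def a_assoc r_neg)
    ultimately show False by simp
  qed
qed

lemma w_eq_of_close:
  assumes "x \<in> carrier R" "y \<in> carrier R" "w x < w (x \<ominus> y)"
  shows "w y = w x"
proof -
  have "y = x \<oplus> (\<ominus> (x \<ominus> y))" using assms by algebra
  then show ?thesis using w_add_eq[of x "\<ominus> (x \<ominus> y)"] assms by simp
qed

lemma w_mult_ge: "x \<in> carrier R \<Longrightarrow> y \<in> carrier R \<Longrightarrow> 0 \<le> w x \<Longrightarrow> r \<le> w y \<Longrightarrow> r \<le> w (x \<otimes> y)"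
  using w_mult[of x y] add_mono[of 0 "w x" r "w y"] by simp

lemma w_mult_gt: "x \<in> carrier R \<Longrightarrow> y \<in> carrier R \<Longrightarrow> 0 \<le> w x \<Longrightarrow> r < w y \<Longrightarrow> r < w (x \<otimes> y)"
  using w_mult[of x y] w_mult_ge[of x y "w y"] by fastforce

text \<open>The bound has to be finite: for y = 0 and an infinite bound strictness fails. This is
  why many later estimates are stated with a real r.\<close>

lemma w_mult_gt':
  assumes "x \<in> carrier R" "y \<in> carrier R" "0 < w x" "ereal r \<le> w y"
  shows "ereal r < w (x \<otimes> y)"
  using assms by (cases "w x"; cases "w y") (auto simp: w_mult)

lemma w_mult_unit: "x \<in> carrier R \<Longrightarrow> y \<in> carrier R \<Longrightarrow> w x = 0 \<Longrightarrow> w (x \<otimes> y) = w y"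
  using w_mult[of x y] by simp

lemma w_divide_ge:
  assumes "x \<in> carrier R" "y \<in> carrier R" "y \<noteq> \<zero>" "w y \<le> w x"
  shows "0 \<le> w (inv y \<otimes> x)"
proof -
  have i: "inv y \<in> carrier R" using assms field_Units by auto
  obtain s where "w y = ereal s" using w_real assms by metis
  then show ?thesis using w_mult[OF i assms(1)] w_inv[OF assms(2,3)] assms(4) by (cases "w x") auto
qed

lemma vring_subring:
  assumes "subfield M R" shows "subring (vring w M) R"
proof (rule subringI)
  note Ms = subringE[OF subfieldE(1)[OF assms]]
  show "vring w M \<subseteq> carrier R" using Ms(1) by (auto simp: vring_def)
  show "\<one> \<in> vring w M" using Ms(3) by (simp add: vring_def)
  show "\<ominus> h \<in> vring w M" if "h \<in> vring w M" for h using that Ms by (auto simp: vring_def)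
  fix h k assume "h \<in> vring w M" "k \<in> vring w M"
  then have hk: "h \<in> M" "k \<in> M" "h \<in> carrier R" "k \<in> carrier R" "0 \<le> w h" "0 \<le> w k" using Ms(1) by (auto simp: vring_def)
  then show "h \<otimes> k \<in> vring w M" "h \<oplus> k \<in> vring w M"
    using Ms(6,7) w_mult_ge[of h k 0] w_add_ge[of h k 0] by (auto simp: vring_def)
qed

lemma vringD: "x \<in> vring w M \<Longrightarrow> x \<in> M" "x \<in> vring w M \<Longrightarrow> 0 \<le> w x"
  by (auto simp: vring_def)

lemma vringI: "x \<in> M \<Longrightarrow> 0 \<le> w x \<Longrightarrow> x \<in> vring w M"
  by (auto simp: vring_def)

lemma w_polyf_taylor:
  assumes c: "\<And>j. j < n \<Longrightarrow> c j \<in> vring w (carrier R)" and x: "x \<in> vring w (carrier R)" and y: "y \<in> vring w (carrier R)"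
  shows "\<exists>s\<in>vring w (carrier R). polyf c n y \<ominus> polyf c n x = (y \<ominus> x) \<otimes> (dpolyf c n x \<oplus> (y \<ominus> x) \<otimes> s)"
proof -
  note V = vring_subring[OF carrier_is_subfield]
  note Vs = subringE[OF V]
  have d: "y \<ominus> x \<in> vring w (carrier R)" using Vs x y by (simp add: a_minus_def)
  obtain s where s: "s \<in> vring w (carrier R)"
    "polyf c n (x \<oplus> (y \<ominus> x)) = polyf c n x \<oplus> (y \<ominus> x) \<otimes> dpolyf c n x \<oplus> (y \<ominus> x) \<otimes> (y \<ominus> x) \<otimes> s"
    using polyf_taylor[OF V x d, of n c] c by auto
  have p: "polyf c n x \<in> carrier R" "dpolyf c n x \<in> carrier R" "s \<in> carrier R" "x \<in> carrier R" "y \<in> carrier R"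
    using polyf_in_subring[OF V, of n c x] c s(1) Vs(1) x y by auto
  have "x \<oplus> (y \<ominus> x) = y" using p by algebra
  then have "polyf c n y = polyf c n x \<oplus> (y \<ominus> x) \<otimes> dpolyf c n x \<oplus> (y \<ominus> x) \<otimes> (y \<ominus> x) \<otimes> s" using s(2) by simp
  then have "polyf c n y \<ominus> polyf c n x = (y \<ominus> x) \<otimes> (dpolyf c n x \<oplus> (y \<ominus> x) \<otimes> s)" using p by algebra
  then show ?thesis using s(1) by auto
qed

text \<open>All three parts read off the factorisation f(y) - f(x) = (y - x) (f'(x) + (y - x) s):
  the second factor is integral and, for y congruent to x, lies in the maximal ideal if f'(x) does
  and is a unit if f'(x) is.\<close>

lemma w_polyf_diff:
  assumes c: "\<And>j. j < n \<Longrightarrow> c j \<in> vring w (carrier R)" and x: "x \<in> vring w (carrier R)" and y: "y \<in> vring w (carrier R)"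
  shows "w (y \<ominus> x) \<le> w (polyf c n y \<ominus> polyf c n x)"
    and "0 < w (dpolyf c n x) \<Longrightarrow> 0 < w (y \<ominus> x) \<Longrightarrow> ereal r \<le> w (y \<ominus> x) \<Longrightarrow> ereal r < w (polyf c n y \<ominus> polyf c n x)"
    and "w (dpolyf c n x) = 0 \<Longrightarrow> 0 < w (y \<ominus> x) \<Longrightarrow> w (polyf c n y \<ominus> polyf c n x) = w (y \<ominus> x)"
proof -
  note V = vring_subring[OF carrier_is_subfield]
  note Vs = subringE[OF V]
  obtain s where s: "s \<in> vring w (carrier R)" "polyf c n y \<ominus> polyf c n x = (y \<ominus> x) \<otimes> (dpolyf c n x \<oplus> (y \<ominus> x) \<otimes> s)"
    using w_polyf_taylor[of n c x y] c x y by auto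
  have d: "y \<ominus> x \<in> vring w (carrier R)" using Vs x y by (simp add: a_minus_def)
  have D: "dpolyf c n x \<in> vring w (carrier R)" using polyf_in_subring[OF V, of n c x] c x by auto
  have C: "y \<ominus> x \<in> carrier R" "dpolyf c n x \<in> carrier R" "s \<in> carrier R" using d D s Vs(1) by auto
  have ge: "0 \<le> w (dpolyf c n x \<oplus> (y \<ominus> x) \<otimes> s)" using Vs d D s(1) by (intro vringD(2)[of _ "carrier R"]) auto
  show "w (y \<ominus> x) \<le> w (polyf c n y \<ominus> polyf c n x)"
    unfolding s(2) using C ge w_mult_ge[of "dpolyf c n x \<oplus> (y \<ominus> x) \<otimes> s" "y \<ominus> x"] by (simp add: m_comm)
  have ds: "0 < w ((y \<ominus> x) \<otimes> s)" if "0 < w (y \<ominus> x)"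
    using w_mult_gt[of s "y \<ominus> x" 0] C vringD(2)[OF s(1)] that by (simp add: m_comm)
  show "ereal r < w (polyf c n y \<ominus> polyf c n x)" if "0 < w (dpolyf c n x)" "0 < w (y \<ominus> x)" "ereal r \<le> w (y \<ominus> x)"
  proof -
    have "0 < w (dpolyf c n x \<oplus> (y \<ominus> x) \<otimes> s)" using ds that C by (intro w_add_gt) auto
    then show ?thesis unfolding s(2)
      using w_mult_gt'[of "dpolyf c n x \<oplus> (y \<ominus> x) \<otimes> s" "y \<ominus> x" r] C that(3) by (simp add: m_comm)
  qed
  show "w (polyf c n y \<ominus> polyf c n x) = w (y \<ominus> x)" if "w (dpolyf c n x) = 0" "0 < w (y \<ominus> x)"
  proof -
    have "w (dpolyf c n x \<oplus> (y \<ominus> x) \<otimes> s) = 0" using w_add_eq[of "dpolyf c n x" "(y \<ominus> x) \<otimes> s"] ds that C by simp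
    then show ?thesis unfolding s(2) using w_mult_unit[of "dpolyf c n x \<oplus> (y \<ominus> x) \<otimes> s" "y \<ominus> x"] C by (simp add: m_comm)
  qed
qed

end

subsection \<open>Norms on finite-dimensional spaces over a complete field\<close>

text \<open>The sum of \<open>combine\<close>, with coordinates given by a total function on the
  naturals; sequences and limits of coordinate vectors can then be taken index by index. Values
  beyond the list do not matter.\<close>

primrec (in ring) lincomb :: "(nat \<Rightarrow> 'a) \<Rightarrow> 'a list \<Rightarrow> 'a" where
  "lincomb a [] = \<zero>"
| "lincomb a (u # Us) = a 0 \<otimes> u \<oplus> lincomb (\<lambda>i. a (Suc i)) Us"

context field
begin

lemma lincomb_closed: "(\<And>i. a i \<in> carrier R) \<Longrightarrow> set Us \<subseteq> carrier R \<Longrightarrow> lincomb a Us \<in> carrier R"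
  by (induction Us arbitrary: a) auto

lemma lincomb_minus:
  "(\<And>i. a i \<in> carrier R) \<Longrightarrow> (\<And>i. b i \<in> carrier R) \<Longrightarrow> set Us \<subseteq> carrier R \<Longrightarrow>
    lincomb (\<lambda>i. a i \<ominus> b i) Us = lincomb a Us \<ominus> lincomb b Us"
proof (induction Us arbitrary: a b)
  case (Cons u Us)
  define p q where "p = lincomb (\<lambda>i. a (Suc i)) Us" and "q = lincomb (\<lambda>i. b (Suc i)) Us"
  have C: "a 0 \<in> carrier R" "b 0 \<in> carrier R" "u \<in> carrier R" "p \<in> carrier R" "q \<in> carrier R"
    unfolding p_def q_def using Cons.prems by (auto intro: lincomb_closed)
  have IH: "lincomb (\<lambda>i. a (Suc i) \<ominus> b (Suc i)) Us = lincomb (\<lambda>i. a (Suc i)) Us \<ominus> lincomb (\<lambda>i. b (Suc i)) Us"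
    by (rule Cons.IH) (use Cons.prems in auto)
  show ?case unfolding lincomb.simps IH p_def[symmetric] q_def[symmetric] using C by algebra
qed (simp add: a_minus_def)

lemma lincomb_smult:
  "(\<And>i. a i \<in> carrier R) \<Longrightarrow> k \<in> carrier R \<Longrightarrow> set Us \<subseteq> carrier R \<Longrightarrow>
    lincomb (\<lambda>i. k \<otimes> a i) Us = k \<otimes> lincomb a Us"
proof (induction Us arbitrary: a)
  case (Cons u Us)
  define p where "p = lincomb (\<lambda>i. a (Suc i)) Us"
  have C: "a 0 \<in> carrier R" "u \<in> carrier R" "p \<in> carrier R"
    unfolding p_def using Cons.prems by (auto intro: lincomb_closed)
  have IH: "lincomb (\<lambda>i. k \<otimes> a (Suc i)) Us = k \<otimes> lincomb (\<lambda>i. a (Suc i)) Us"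
    by (rule Cons.IH) (use Cons.prems in auto)
  show ?case unfolding lincomb.simps IH p_def[symmetric] using C Cons.prems by algebra
qed simp

lemma Span_eq_lincomb:
  assumes K: "subfield K R" and Us: "set Us \<subseteq> carrier R"
  shows "Span K Us = {lincomb a Us | a. \<forall>i. a i \<in> K}"
proof -
  have *: "combine Ks Us = lincomb (\<lambda>i. if i < length Us then Ks ! i else \<zero>) Us" if "length Ks = length Us" for Ks
    using that
  proof (induction Ks Us rule: list_induct2)
    case (Cons k Ks u Us)
    have "lincomb (\<lambda>i. if Suc i < length (u # Us) then (k # Ks) ! Suc i else \<zero>) Us = lincomb (\<lambda>i. if i < length Us then Ks ! i else \<zero>) Us"
      by (rule arg_cong[of _ _ "\<lambda>f. lincomb f Us"]) auto
    then show ?case using Cons by simp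
  qed simp
  have **: "lincomb a Us = combine (map a [0..<length Us]) Us" for a
  proof (induction Us arbitrary: a)
    case (Cons u Us)
    have "map a [0..<length (u # Us)] = a 0 # map (\<lambda>i. a (Suc i)) [0..<length Us]"
      by (simp add: upt_conv_Cons map_Suc_upt[symmetric] del: upt_Suc)
    then show ?case using Cons[of "\<lambda>i. a (Suc i)"] by simp
  qed simp
  show ?thesis
  proof
    show "Span K Us \<subseteq> {lincomb a Us | a. \<forall>i. a i \<in> K}"
    proof
      fix x assume "x \<in> Span K Us"
      then obtain Ks where Ks: "set Ks \<subseteq> K" "length Ks = length Us" "x = combine Ks Us"
        using Span_mem_iff_length_version[OF K Us] by auto
      then have "\<forall>i. (if i < length Us then Ks ! i else \<zero>) \<in> K"
        using subringE(2)[OF subfieldE(1)[OF K]] by (auto simp: subset_iff)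
      then show "x \<in> {lincomb a Us | a. \<forall>i. a i \<in> K}" using *[OF Ks(2)] Ks(3) by blast
    qed
    show "{lincomb a Us | a. \<forall>i. a i \<in> K} \<subseteq> Span K Us"
    proof
      fix x assume "x \<in> {lincomb a Us | a. \<forall>i. a i \<in> K}"
      then obtain a where a: "\<And>i. a i \<in> K" "x = lincomb a Us" by blast
      show "x \<in> Span K Us" unfolding Span_eq_combine_set[OF K Us] a(2) ** using a(1) by (auto intro!: exI[of _ "map a [0..<length Us]"])
    qed
  qed
qed

lemma endo_lincomb:
  assumes M: "subfield M R" and s: "s \<in> endo M" and "\<And>i. a i \<in> M" "\<And>i. s (a i) = a i" "set Us \<subseteq> M"
  shows "s (lincomb a Us) = lincomb a (map s Us) \<and> lincomb a Us \<in> M"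
  using assms(3-5)
proof (induction Us arbitrary: a)
  case Nil
  then show ?case using endo_zero[OF M s] subringE(2)[OF subfieldE(1)[OF M]] by simp
next
  case (Cons u Us)
  note Ms = subringE[OF subfieldE(1)[OF M]]
  have IH: "s (lincomb (\<lambda>i. a (Suc i)) Us) = lincomb (\<lambda>i. a (Suc i)) (map s Us)" "lincomb (\<lambda>i. a (Suc i)) Us \<in> M"
    using Cons.IH[of "\<lambda>i. a (Suc i)"] Cons.prems by auto
  have u: "u \<in> M" "a 0 \<otimes> u \<in> M" using Cons.prems Ms(6) by auto
  show ?case using endoD(3)[OF s u(2) IH(2)] endoD(2)[OF s Cons.prems(1) u(1), of 0] Cons.prems(2)[of 0] IH u Ms(7) by simp
qed

end

context valued_field
begin

text \<open>The easy half of the equivalence of norms: combinations are continuous in their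
  coordinates, and -B is a common lower bound for the valuations of the vectors.\<close>

lemma lincomb_lower_bound:
  assumes "set Us \<subseteq> carrier R"
  shows "\<exists>B. \<forall>a r. (\<forall>i. a i \<in> carrier R) \<longrightarrow> (\<forall>i<length Us. ereal r \<le> w (a i)) \<longrightarrow> ereal (r - B) \<le> w (lincomb a Us)"
  using assms
proof (induction Us)
  case (Cons u Us)
  obtain B where B0: "\<forall>a r. (\<forall>i. a i \<in> carrier R) \<longrightarrow> (\<forall>i<length Us. ereal r \<le> w (a i)) \<longrightarrow> ereal (r - B) \<le> w (lincomb a Us)"
    using Cons by auto
  have B: "ereal (r - B) \<le> w (lincomb a Us)"
    if "\<And>i. a i \<in> carrier R" "\<And>i. i < length Us \<Longrightarrow> ereal r \<le> w (a i)" for a r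
    using B0 that by blast
  have u: "u \<in> carrier R" using Cons.prems by simp
  obtain b where b: "ereal (- b) \<le> w u"
  proof (cases "u = \<zero>")
    case False
    then obtain t where "w u = ereal t" using w_real u by metis
    then show ?thesis using that[of "-t"] by simp
  qed (use that[of 0] in simp)
  have "ereal (r - max B b) \<le> w (lincomb a (u # Us))"
    if a: "\<And>i. a i \<in> carrier R" "\<And>i. i < length (u # Us) \<Longrightarrow> ereal r \<le> w (a i)" for a r
  proof -
    have "ereal (r - B) \<le> w (lincomb (\<lambda>i. a (Suc i)) Us)" by (rule B) (use a in auto)
    then have 1: "ereal (r - max B b) \<le> w (lincomb (\<lambda>i. a (Suc i)) Us)"
      by (rule order_trans[rotated]) simp
    have "ereal r + ereal (- b) \<le> w (a 0) + w u" using a(2)[of 0] b by (intro add_mono) auto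
    then have "ereal (r - b) \<le> w (a 0 \<otimes> u)" using w_mult[OF a(1) u] by simp
    then have 2: "ereal (r - max B b) \<le> w (a 0 \<otimes> u)" by (rule order_trans[rotated]) simp
    have "lincomb (\<lambda>i. a (Suc i)) Us \<in> carrier R" using a(1) Cons.prems by (intro lincomb_closed) auto
    then show ?thesis using w_add_ge[OF m_closed[OF a(1) u] _ 2 1] by simp
  qed
  then show ?case by blast
qed simp

text \<open>A span with controlled coordinates over a complete field is closed. If vectors v n of
  the span approached u arbitrarily well, the estimate C would make their coordinates Cauchy
  sequences in K, and the combination of the limits would equal u.\<close>

lemma complete_span_distance:
  assumes K: "subfield K R" and compl: "complete_on R w K" and Us: "set Us \<subseteq> carrier R"
    and C: "\<And>a i. (\<And>i. a i \<in> K) \<Longrightarrow> i < length Us \<Longrightarrow> w (lincomb a Us) \<le> w (a i) + ereal C"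
    and u: "u \<in> carrier R" "u \<notin> Span K Us"
  shows "\<exists>r. \<forall>v\<in>Span K Us. w (u \<ominus> v) \<le> ereal r"
proof (rule ccontr)
  assume neg: "\<not> ?thesis"
  note KR = subfieldE(3)[OF K] and Ks = subringE[OF subfieldE(1)[OF K]]
  have "\<forall>n::nat. \<exists>a. (\<forall>i. a i \<in> K) \<and> ereal (real n) < w (u \<ominus> lincomb a Us)"
  proof
    fix n :: nat
    obtain v where v: "v \<in> Span K Us" "\<not> w (u \<ominus> v) \<le> ereal (real n)" using neg by blast
    then obtain a where "\<forall>i. a i \<in> K" "v = lincomb a Us" unfolding Span_eq_lincomb[OF K Us] by blast
    then show "\<exists>a. (\<forall>i. a i \<in> K) \<and> ereal (real n) < w (u \<ominus> lincomb a Us)" using v(2) by (intro exI[of _ a]) auto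
  qed
  then obtain a where a: "\<And>n i. a n i \<in> K" "\<And>n. ereal (real n) < w (u \<ominus> lincomb (a n) Us)" by metis
  have aR: "a n i \<in> carrier R" for n i using a(1) KR by auto
  define v where "v n = lincomb (a n) Us" for n
  have vR: "v n \<in> carrier R" for n unfolding v_def using aR Us by (intro lincomb_closed) auto
  have near: "ereal (real (min m n)) \<le> w (v m \<ominus> v n)" for m n
  proof -
    have "v m \<ominus> v n = (u \<ominus> v n) \<ominus> (u \<ominus> v m)" using u(1) vR[of m] vR[of n] by algebra
    moreover have "ereal (real (min m n)) \<le> w (u \<ominus> v n)" "ereal (real (min m n)) \<le> w (u \<ominus> v m)"
      using order_trans[OF _ less_imp_le[OF a(2)[of n]], of "ereal (real (min m n))"]
        order_trans[OF _ less_imp_le[OF a(2)[of m]], of "ereal (real (min m n))"] unfolding v_def by simp_all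
    ultimately show ?thesis using w_minus_ge[of "u \<ominus> v n" "u \<ominus> v m"] u(1) vR by simp
  qed
  have cau: "ereal (real (min m n) - C) \<le> w (a m i \<ominus> a n i)" if i: "i < length Us" for m n i
  proof -
    have "w (lincomb (\<lambda>i. a m i \<ominus> a n i) Us) \<le> w (a m i \<ominus> a n i) + ereal C"
      by (rule C) (use a(1) Ks i in \<open>auto simp: a_minus_def\<close>)
    also have "lincomb (\<lambda>i. a m i \<ominus> a n i) Us = v m \<ominus> v n"
      unfolding v_def using aR Us by (intro lincomb_minus) auto
    finally have "ereal (real (min m n)) \<le> w (a m i \<ominus> a n i) + ereal C" using near[of m n] by (rule order_trans[rotated])
    then show ?thesis by (cases "w (a m i \<ominus> a n i)") auto
  qed
  have "\<exists>x\<in>K. \<forall>M::real. \<exists>N. \<forall>n. N \<le> n \<longrightarrow> ereal M \<le> w (a n i \<ominus> x)" if i: "i < length Us" for i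
  proof -
    have "\<exists>N. \<forall>m n. N \<le> m \<longrightarrow> N \<le> n \<longrightarrow> ereal M \<le> w (a m i \<ominus> a n i)" for M
    proof (intro exI allI impI)
      fix m n assume mn: "nat \<lceil>M + C\<rceil> \<le> m" "nat \<lceil>M + C\<rceil> \<le> n"
      have "M \<le> real (min m n) - C" using mn by linarith
      then show "ereal M \<le> w (a m i \<ominus> a n i)" using cau[OF i, of m n] by (meson ereal_less_eq(3) order_trans)
    qed
    then show ?thesis using compl[unfolded complete_on_def, rule_format, of "\<lambda>n. a n i"] a(1) by blast
  qed
  then obtain b where b: "\<And>i. i < length Us \<Longrightarrow> b i \<in> K"
    "\<And>i M. i < length Us \<Longrightarrow> \<exists>N. \<forall>n. N \<le> n \<longrightarrow> ereal M \<le> w (a n i \<ominus> b i)" by metis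
  \<comment> \<open>Padding with zero beyond the list keeps the coordinate function total with
    values in K.\<close>
  define c where "c i = (if i < length Us then b i else \<zero>)" for i
  have cK: "c i \<in> K" for i using b(1) Ks by (auto simp: c_def)
  have cR: "c i \<in> carrier R" for i using cK KR by auto
  obtain B where B: "\<And>d r. (\<And>i. d i \<in> carrier R) \<Longrightarrow> (\<And>i. i < length Us \<Longrightarrow> ereal r \<le> w (d i)) \<Longrightarrow> ereal (r - B) \<le> w (lincomb d Us)"
    using lincomb_lower_bound[OF Us] by blast
  define x where "x = lincomb c Us"
  have xR: "x \<in> carrier R" unfolding x_def using cR Us by (intro lincomb_closed) auto
  have "ereal M \<le> w (u \<ominus> x)" for M
  proof -
    have "\<exists>N. \<forall>i<length Us. \<forall>n\<ge>N. ereal (M + B) \<le> w (a n i \<ominus> c i)"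
    proof -
      obtain N where N: "\<And>i n. i < length Us \<Longrightarrow> N i \<le> n \<Longrightarrow> ereal (M + B) \<le> w (a n i \<ominus> b i)"
      proof -
        have "\<forall>i\<in>{..<length Us}. \<exists>N. \<forall>n. N \<le> n \<longrightarrow> ereal (M + B) \<le> w (a n i \<ominus> b i)" using b(2) by blast
        then obtain N where "\<forall>i\<in>{..<length Us}. \<forall>n. N i \<le> n \<longrightarrow> ereal (M + B) \<le> w (a n i \<ominus> b i)"
          using bchoice[of "{..<length Us}"] by meson
        then show ?thesis using that[of N] by blast
      qed
      show ?thesis
      proof (intro exI allI impI)
        fix i n assume i: "i < length Us" and n: "Max (N ` {..<length Us}) \<le> n"
        have "N i \<le> Max (N ` {..<length Us})" using i by (intro Max_ge) auto
        then show "ereal (M + B) \<le> w (a n i \<ominus> c i)" using N[OF i, of n] order_trans[OF _ n] i by (simp add: c_def)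
      qed
    qed
    then obtain N where N: "\<And>i n. i < length Us \<Longrightarrow> N \<le> n \<Longrightarrow> ereal (M + B) \<le> w (a n i \<ominus> c i)" by blast
    \<comment> \<open>Beyond N the coordinates are close enough to their limits, and n \<ge> M makes
      v n close enough to u.\<close>
    define n where "n = max N (nat \<lceil>M\<rceil>)"
    have "ereal (M + B - B) \<le> w (lincomb (\<lambda>i. a n i \<ominus> c i) Us)"
      by (rule B) (use aR cR N in \<open>auto simp: n_def\<close>)
    moreover have "lincomb (\<lambda>i. a n i \<ominus> c i) Us = v n \<ominus> x"
      unfolding v_def x_def using aR cR Us by (intro lincomb_minus) auto
    ultimately have 1: "ereal M \<le> w (v n \<ominus> x)" by simp
    have "M \<le> real n" unfolding n_def by linarith
    then have 2: "ereal M \<le> w (u \<ominus> v n)" using a(2)[of n] unfolding v_def by (meson ereal_less_eq(3) less_imp_le order_trans)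
    have "u \<ominus> x = (u \<ominus> v n) \<oplus> (v n \<ominus> x)" using u(1) vR[of n] xR by algebra
    then show ?thesis using w_add_ge[OF _ _ 2 1] u(1) vR[of n] xR by simp
  qed
  then have "w (u \<ominus> x) = \<infinity>" by (intro ereal_top)
  then have "u \<ominus> x = \<zero>" using w_inf[of "u \<ominus> x"] u(1) xR by simp
  then have "u = x" using u(1) xR by simp
  then have "u \<in> Span K Us" unfolding Span_eq_lincomb[OF K Us] x_def using cK by blast
  then show False using u(2) by simp
qed

text \<open>The hard half of the equivalence of norms, by induction on the list. The distance r from
  u to the span of the other vectors bounds w x by w (a 0) + r; subtracting a 0 u from x then loses
  at most D in valuation, and the induction hypothesis bounds the remaining coordinates.\<close>

lemma complete_coordinates_bound:
  assumes K: "subfield K R" and compl: "complete_on R w K" and Us: "independent K Us"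
  shows "\<exists>C. \<forall>a. (\<forall>i. a i \<in> K) \<longrightarrow> (\<forall>i<length Us. w (lincomb a Us) \<le> w (a i) + ereal C)"
  using Us
proof (induction Us rule: list.induct)
  case (Cons u Us)
  note KR = subfieldE(3)[OF K] and Ks = subringE[OF subfieldE(1)[OF K]]
  have ind: "independent K Us" "u \<notin> Span K Us" and uR: "u \<in> carrier R" and UsR: "set Us \<subseteq> carrier R"
    using independent_backwards[OF Cons.prems] independent_in_carrier[OF Cons.prems] by auto
  obtain C where C: "\<And>a i. (\<And>i. a i \<in> K) \<Longrightarrow> i < length Us \<Longrightarrow> w (lincomb a Us) \<le> w (a i) + ereal C"
    using Cons.IH[OF ind(1)] by blast
  obtain r where r: "\<And>v. v \<in> Span K Us \<Longrightarrow> w (u \<ominus> v) \<le> ereal r"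
    using complete_span_distance[OF K compl UsR C uR ind(2)] by blast
  have "\<zero> \<in> Span K Us" using Span_subgroup_props(2)[OF K UsR] by simp
  then have u0: "u \<noteq> \<zero>" using ind(2) by auto
  then obtain t where t: "w u = ereal t" using w_real uR by metis
  \<comment> \<open>With w u = t, the bound w x \<le> w (a 0) + r gives w (a 0 u) \<ge> w x - (r -
    t), so the difference loses at most the positive part of r - t.\<close>
  define D where "D = max 0 (r - t)"
  define m where "m = max r (C + D)"
  have m: "r \<le> m" "C + D \<le> m" by (auto simp: m_def)
  have "w (lincomb a (u # Us)) \<le> w (a i) + ereal (m)"
    if a: "\<And>i. a i \<in> K" and i: "i < length (u # Us)" for a i
  proof -
    have aR: "a j \<in> carrier R" for j using a KR by auto
    define y where "y = lincomb (\<lambda>i. a (Suc i)) Us"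
    define x where "x = lincomb a (u # Us)"
    have x: "x = a 0 \<otimes> u \<oplus> y" by (simp add: x_def y_def)
    have yR: "y \<in> carrier R" unfolding y_def using aR UsR by (intro lincomb_closed) auto
    have xR: "x \<in> carrier R" using x yR aR uR by simp
    have yC: "w y \<le> w (a (Suc j)) + ereal C" if "j < length Us" for j
      unfolding y_def using C[of "\<lambda>i. a (Suc i)" j] a that by simp
    have D0: "0 \<le> D" by (simp add: D_def)
    show ?thesis unfolding x_def[symmetric]
    proof (cases "a 0 = \<zero>")
      case True
      show "w x \<le> w (a i) + ereal (m)"
      proof (cases i)
        case 0
        then show ?thesis using True by simp
      next
        case (Suc j)
        have "w x = w y" using x True yR uR by simp
        also have "\<dots> \<le> w (a i) + ereal C" using yC[of j] Suc i by simp
        also have "\<dots> \<le> w (a i) + ereal (m)" proof (intro add_left_mono)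
          have "C \<le> m" using D0 m by linarith
          then show "ereal C \<le> ereal (m)" unfolding ereal_less_eq(3) .
        qed
        finally show ?thesis .
      qed
    next
      case False
      then obtain s where s: "w (a 0) = ereal s" using w_real aR by metis
      define z where "z = inv (a 0) \<otimes> y"
      have iK: "inv (a 0) \<in> K" "inv (a 0) \<in> carrier R" "a 0 \<otimes> inv (a 0) = \<one>"
        using subfield_inv[OF K a[of 0] False] KR field_Units aR False by auto
      have zR: "z \<in> carrier R" unfolding z_def using iK yR by simp
      have "z = lincomb (\<lambda>i. inv (a 0) \<otimes> a (Suc i)) Us"
        unfolding z_def y_def using aR iK UsR by (intro lincomb_smult[symmetric]) auto
      moreover have "\<And>i. inv (a 0) \<otimes> a (Suc i) \<in> K" using iK a Ks by auto
      ultimately have zS: "z \<in> Span K Us" unfolding Span_eq_lincomb[OF K UsR] by blast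
      then have "\<ominus> z \<in> Span K Us" using Span_subgroup_props(4)[OF K UsR] by simp
      then have "w (u \<ominus> (\<ominus> z)) \<le> ereal r" using r by blast
      moreover have "a 0 \<otimes> z = y" unfolding z_def using m_assoc[of "a 0" "inv (a 0)" y] iK aR yR by simp
      then have "x = a 0 \<otimes> (u \<ominus> (\<ominus> z))" using x aR uR zR by (simp add: a_minus_def r_distr)
      then have "w x = w (a 0) + w (u \<ominus> (\<ominus> z))" using w_mult[of "a 0" "u \<ominus> (\<ominus> z)"] aR uR zR by simp
      ultimately have wx: "w x \<le> ereal (s + r)" using s by (cases "w (u \<ominus> (\<ominus> z))") auto
      then have "x \<noteq> \<zero>" by auto
      then obtain q where q: "w x = ereal q" using w_real xR by metis
      have qs: "q \<le> s + r" using wx q by simp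
      show "w x \<le> w (a i) + ereal (m)"
      proof (cases i)
        case 0
        then show ?thesis using q s qs m by simp
      next
        case (Suc j)
        have "y = x \<ominus> a 0 \<otimes> u" using x aR[of 0] uR yR by algebra
        moreover have "ereal (q - D) \<le> w x" using q D0 by simp
        moreover have "ereal (q - D) \<le> w (a 0 \<otimes> u)"
          using w_mult[OF aR[of 0] uR] s t qs by (simp add: D_def)
        ultimately have "ereal (q - D) \<le> w y" using w_minus_ge[of x "a 0 \<otimes> u"] xR aR uR by simp
        also have "w y \<le> w (a i) + ereal C" using yC[of j] Suc i by simp
        finally have "ereal (q - D) \<le> w (a i) + ereal C" .
        then show ?thesis using q m by (cases "w (a i)") auto
      qed
    qed
  qed
  then show ?case by blast
qed simp

text \<open>Comparing coordinates gives w (s y) \<ge> w y - C - B for all y. Applied to the powers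
  x^m this divides the error by m, so w (s x) \<ge> w x; the inverse automorphism gives
  equality.\<close>

theorem w_endo_invariant:
  assumes K: "subfield K R" and L: "subfield L R" and KL: "K \<subseteq> L" and n: "dimension n K L"
    and compl: "complete_on R w K" and s: "s \<in> gal R K L" and x: "x \<in> L"
  shows "w (s x) = w x"
proof -
  note LR = subfieldE(3)[OF L]
  have le: "w x \<le> w (s x)" if s: "s \<in> gal R K L" and x: "x \<in> L" for s x
  proof (cases "x = \<zero>")
    case True
    have "s \<in> endo L" using s gal_iff[OF L KL] by blast
    then show ?thesis using endo_zero[OF L, of s] True by simp
  next
    case False
    have se: "s \<in> endo L" "\<And>k. k \<in> K \<Longrightarrow> s k = k" using s gal_iff[OF L KL] by auto
    obtain Us where Us: "set Us \<subseteq> carrier R" "independent K Us" "length Us = n" "Span K Us = L"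
      using exists_base[OF K n] by auto
    have UL: "set Us \<subseteq> L" using Span_base_incl[OF K Us(1)] Us(4) by simp
    have sUR: "set (map s Us) \<subseteq> carrier R" using UL endoD(1)[OF se(1)] LR by auto
    obtain C where C: "\<And>a i. (\<And>i. a i \<in> K) \<Longrightarrow> i < length Us \<Longrightarrow> w (lincomb a Us) \<le> w (a i) + ereal C"
      using complete_coordinates_bound[OF K compl Us(2)] by blast
    obtain B where B: "\<And>a r. (\<And>i. a i \<in> carrier R) \<Longrightarrow> (\<And>i. i < length (map s Us) \<Longrightarrow> ereal r \<le> w (a i)) \<Longrightarrow> ereal (r - B) \<le> w (lincomb a (map s Us))"
      using lincomb_lower_bound[OF sUR] by blast
    have bound: "ereal (r - C - B) \<le> w (s y)" if y: "y \<in> L" and r: "w y = ereal r" for y r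
    proof -
      obtain a where a: "\<And>i. a i \<in> K" "y = lincomb a Us" using y Us(4) Span_eq_lincomb[OF K Us(1)] by blast
      have "ereal (r - C) \<le> w (a i)" if "i < length Us" for i
        using C[of a i] a that r by (cases "w (a i)") auto
      then have "ereal (r - C - B) \<le> w (lincomb a (map s Us))"
        using a(1) subfieldE(3)[OF K] by (intro B) auto
      moreover have "lincomb a (map s Us) = s y"
        using endo_lincomb[OF L se(1) subsetD[OF KL a(1)] se(2)[OF a(1)] UL] a(2) by simp
      ultimately show ?thesis by simp
    qed
    obtain r where r: "w x = ereal r" using w_real x LR False by (metis subsetD)
    have xR: "x \<in> carrier R" "s x \<in> carrier R" using x LR endoD(1)[OF se(1) x] by auto
    have "s x \<noteq> \<zero>" using endo_nonzero[OF L se(1) x False] .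
    then obtain t where t: "w (s x) = ereal t" using w_real xR by metis
    have nt: "real m * (r - t) \<le> C + B" for m
    proof -
      have "x [^] m \<in> L" using subring_pow[OF subfieldE(1)[OF L] x] .
      then have "ereal (real m * r - C - B) \<le> w (s (x [^] m))" using bound w_pow[OF xR(1) False r] by simp
      also have "s (x [^] m) = s x [^] m" using endo_pow[OF L se(1) x] .
      also have "w (s x [^] m) = ereal (real m * t)" using w_pow[OF xR(2) \<open>s x \<noteq> \<zero>\<close> t] .
      finally show ?thesis by (simp add: algebra_simps)
    qed
    have "r \<le> t"
    proof (rule ccontr)
      assume "\<not> r \<le> t"
      then obtain m :: nat where "C + B < real m * (r - t)" using reals_Archimedean3[of "r - t"] by auto
      then show False using nt[of m] by simp
    qed
    then show ?thesis using r t by simp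
  qed
  have S: "automorphisms L (gal R K L)" using gal_automorphisms[OF K L KL n] .
  obtain u where u: "u \<in> gal R K L" "u (s x) = x" using automorphisms_inverse[OF L S s] x by auto
  have "s x \<in> L" using endoD(1)[OF automorphismsD(2)[OF S s] x] .
  then show ?thesis using le[OF s x] le[OF u(1), of "s x"] u(2) by simp
qed

end

section \<open>Galois extensions of complete discretely valued fields\<close>

context field
begin

lemma finprod_in_subring:
  assumes "subring M R" "\<And>i. i \<in> A \<Longrightarrow> f i \<in> M"
  shows "finprod R f A \<in> M"
proof (cases "finite A")
  case True
  have MR: "M \<subseteq> carrier R" using subringE(1)[OF assms(1)] .
  show ?thesis using True assms(2)
  proof (induction A)
    case empty thus ?case using subringE(3)[OF assms(1)] by simp
  next
    case (insert a A)
    then have "f \<in> A \<rightarrow> carrier R" "f a \<in> carrier R" using MR by auto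
    then show ?case using insert subringE(6)[OF assms(1)] by (simp add: finprod_insert)
  qed
next
  case False
  thus ?thesis using subringE(3)[OF assms(1)] by (simp add: finprod_infinite)
qed

lemma endo_finprod:
  assumes M: "subfield M R" and s: "s \<in> endo M" and "\<And>i. i \<in> A \<Longrightarrow> f i \<in> M" "finite A"
  shows "s (\<Otimes>i\<in>A. f i) = (\<Otimes>i\<in>A. s (f i))"
  using assms(4,3)
proof (induction A)
  case empty thus ?case using endoD(4)[OF s] by simp
next
  case (insert a A)
  note MR = subfieldE(3)[OF M]
  have f: "f \<in> A \<rightarrow> carrier R" "f a \<in> carrier R" using insert MR by auto
  have sf: "(\<lambda>i. s (f i)) \<in> A \<rightarrow> carrier R" "s (f a) \<in> carrier R"
    using insert.prems endoD(1)[OF s] MR by auto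
  have "finprod R f A \<in> M" by (rule finprod_in_subring[OF subfieldE(1)[OF M]]) (use insert.prems in auto)
  then show ?case using insert f sf endoD(2)[OF s] by (simp add: finprod_insert)
qed

lemma norm_fixed:
  assumes M: "subfield M R" and S: "automorphisms M S" and x: "x \<in> M"
  shows "(\<Otimes>s\<in>S. s x) \<in> fixed M S"
proof -
  note MR = subfieldE(3)[OF M]
  have sx: "\<And>s. s \<in> S \<Longrightarrow> s x \<in> M" using endoD(1)[OF automorphismsD(2)[OF S]] x by auto
  have "t (\<Otimes>s\<in>S. s x) = (\<Otimes>s\<in>S. s x)" if t: "t \<in> S" for t
  proof -
    have "t (\<Otimes>s\<in>S. s x) = (\<Otimes>s\<in>S. t (s x))"
      by (rule endo_finprod[OF M automorphismsD(2)[OF S t] _ automorphismsD(1)[OF S]]) (rule sx)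
    also have "\<dots> = (\<Otimes>s\<in>S. compose M t s x)" using x by (simp add: compose_def)
    also have "\<dots> = (\<Otimes>s\<in>compose M t ` S. s x)"
      using automorphisms_compose_bij[OF M S t] sx MR by (intro finprod_reindex[symmetric]) auto
    finally show ?thesis using automorphisms_compose_bij(1)[OF M S t] by simp
  qed
  moreover have "(\<Otimes>s\<in>S. s x) \<in> M" by (rule finprod_in_subring[OF subfieldE(1)[OF M]]) (rule sx)
  ultimately show ?thesis by (simp add: fixed_def)
qed

lemma dimension_fixed:
  assumes M: "subfield M R" and S: "automorphisms M S"
  shows "dimension (card S) (fixed M S) M"
proof -
  have F: "subfield (fixed M S) R" using fixed_subfield[OF M automorphismsD(6)[OF S]] .
  have FM: "fixed M S \<subseteq> M" by (auto simp: fixed_def)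
  obtain m where m: "m \<le> card S" "dimension m (fixed M S) M" using artin[OF M S] by auto
  have "S \<subseteq> gal R (fixed M S) M"
    using gal_iff[OF M FM] automorphismsD[OF S] automorphisms_bij[OF M S] by (auto simp: fixed_def)
  then have "card S \<le> m" using dedekind_bound[OF F M FM automorphismsD(1)[OF S] _ m(2)] by simp
  then show ?thesis using m by simp
qed

text \<open>The set of restrictions may be smaller than S. The lemma serves the full Galois group
  acting on E and inertia acting on the last field of the descent.\<close>

lemma automorphisms_restrict:
  assumes L: "subfield L R" and S: "automorphisms L S" and M: "subfield M R" and M_L: "M \<subseteq> L"
    and st: "\<And>s x. s \<in> S \<Longrightarrow> x \<in> M \<Longrightarrow> s x \<in> M"
  shows "automorphisms M ((\<lambda>s. restrict s M) ` S)" "fixed M ((\<lambda>s. restrict s M) ` S) = fixed L S \<inter> M"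
proof -
  have one: "\<one> \<in> M" using subringE(3)[OF subfieldE(1)[OF M]] .
  have cl: "x \<otimes> y \<in> M" "x \<oplus> y \<in> M" if "x \<in> M" "y \<in> M" for x y
    using subringE(6,7)[OF subfieldE(1)[OF M]] that by auto
  show "automorphisms M ((\<lambda>s. restrict s M) ` S)"
    unfolding automorphisms_def
  proof (intro conjI ballI)
    show "finite ((\<lambda>s. restrict s M) ` S)" using automorphismsD(1)[OF S] by simp
    show "(\<lambda>s. restrict s M) ` S \<subseteq> endo M \<inter> extensional M"
    proof
      fix t assume "t \<in> (\<lambda>s. restrict s M) ` S"
      then obtain s where s: "s \<in> S" "t = restrict s M" by auto
      have se: "s \<in> endo L" using automorphismsD(2)[OF S s(1)] .
      have "t \<in> endo M" unfolding s(2)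
      proof (intro endoI)
        fix x y assume xy: "x \<in> M" "y \<in> M"
        then have "x \<in> L" "y \<in> L" using M_L by auto
        then show "restrict s M (x \<otimes> y) = restrict s M x \<otimes> restrict s M y"
          "restrict s M (x \<oplus> y) = restrict s M x \<oplus> restrict s M y"
          using endoD(2,3)[OF se, of x y] xy cl[OF xy] by simp_all
      qed (use st[OF s(1)] endoD(4)[OF se] one in auto)
      then show "t \<in> endo M \<inter> extensional M" using s by auto
    qed
    show "(\<lambda>x\<in>M. x) \<in> (\<lambda>s. restrict s M) ` S"
      using automorphismsD(4)[OF S] M_L by (intro image_eqI[of _ _ "\<lambda>x\<in>L. x"]) (auto simp: Int_absorb1)
    fix s t assume "s \<in> (\<lambda>s. restrict s M) ` S" "t \<in> (\<lambda>s. restrict s M) ` S"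
    then obtain a b where ab: "a \<in> S" "s = restrict a M" "b \<in> S" "t = restrict b M" by auto
    have "compose M s t = restrict (compose L a b) M"
      unfolding ab compose_def using st[OF ab(3)] M_L by (intro restrict_ext) auto
    then show "compose M s t \<in> (\<lambda>s. restrict s M) ` S" using automorphismsD(5)[OF S ab(1,3)] by auto
  qed
  show "fixed M ((\<lambda>s. restrict s M) ` S) = fixed L S \<inter> M"
    unfolding fixed_def using M_L by auto
qed

end

lemma (in ring) minus_self: "x \<in> carrier R \<Longrightarrow> x \<ominus> x = \<zero>"
  by (simp add: a_minus_def r_neg)

section \<open>Congruences modulo the maximal ideal\<close>

context valued_field
begin

lemma w_finsum_ge:
  assumes "\<And>i. i \<in> A \<Longrightarrow> f i \<in> carrier R" "\<And>i. i \<in> A \<Longrightarrow> r \<le> w (f i)"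
  shows "r \<le> w (finsum R f A)"
proof (cases "finite A")
  case True
  then show ?thesis using assms
  proof (induction A)
    case (insert a A)
    have "finsum R f A \<in> carrier R" using insert by (intro finsum_closed) auto
    then show ?case using insert w_add_ge[of "f a" "finsum R f A" r] by (simp add: finsum_insert Pi_iff)
  qed simp
qed (simp add: finsum_infinite)

lemma w_finsum_gt:
  assumes "\<And>i. i \<in> A \<Longrightarrow> f i \<in> carrier R" "\<And>i. i \<in> A \<Longrightarrow> ereal r < w (f i)"
  shows "ereal r < w (finsum R f A)"
proof (cases "finite A")
  case True
  then show ?thesis using assms
  proof (induction A)
    case (insert a A)
    have "finsum R f A \<in> carrier R" using insert by (intro finsum_closed) auto
    then show ?case using insert w_add_gt[of "f a" "finsum R f A" "ereal r"] by (simp add: finsum_insert Pi_iff)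
  qed simp
qed (simp add: finsum_infinite)

lemma vmax_mult: "x \<in> carrier R \<Longrightarrow> y \<in> carrier R \<Longrightarrow> 0 \<le> w x \<Longrightarrow> 0 < w y \<Longrightarrow> 0 < w (x \<otimes> y)"
  using w_mult_gt[of x y 0] .

lemma cong_trans: "x \<in> carrier R \<Longrightarrow> y \<in> carrier R \<Longrightarrow> z \<in> carrier R \<Longrightarrow> r < w (x \<ominus> y) \<Longrightarrow> r < w (y \<ominus> z) \<Longrightarrow> r < w (x \<ominus> z)"
proof -
  assume a: "x \<in> carrier R" "y \<in> carrier R" "z \<in> carrier R" "r < w (x \<ominus> y)" "r < w (y \<ominus> z)"
  have "x \<ominus> z = (x \<ominus> y) \<oplus> (y \<ominus> z)" using a(1-3) by algebra
  then show ?thesis using a w_add_gt[of "x \<ominus> y" "y \<ominus> z" r] by simp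
qed

lemma cong_mult:
  assumes "x \<in> carrier R" "y \<in> carrier R" "u \<in> carrier R" "v \<in> carrier R" "0 \<le> w u" "0 \<le> w y"
    "0 < w (x \<ominus> y)" "0 < w (u \<ominus> v)"
  shows "0 < w (x \<otimes> u \<ominus> y \<otimes> v)"
proof -
  have "x \<otimes> u \<ominus> y \<otimes> v = u \<otimes> (x \<ominus> y) \<oplus> y \<otimes> (u \<ominus> v)" using assms(1-4) by algebra
  then show ?thesis
    using w_add_gt[of "u \<otimes> (x \<ominus> y)" "y \<otimes> (u \<ominus> v)" 0] vmax_mult[of u "x \<ominus> y"] vmax_mult[of y "u \<ominus> v"] assms by simp
qed

lemma cong_nonneg:
  assumes "x \<in> carrier R" "y \<in> carrier R" "0 \<le> w x" "0 < w (x \<ominus> y)" shows "0 \<le> w y"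
proof -
  have "y = x \<ominus> (x \<ominus> y)" using assms by algebra
  then show ?thesis using w_minus_ge[of x "x \<ominus> y" 0] assms by simp
qed

lemma cong_pow:
  assumes "x \<in> carrier R" "y \<in> carrier R" "0 \<le> w x" "0 < w (x \<ominus> y)"
  shows "0 < w (x [^] (n::nat) \<ominus> y [^] n)"
proof (induction n)
  case (Suc n)
  have y: "0 \<le> w y" using cong_nonneg[OF assms] .
  have "y [^] n \<in> vring w (carrier R)"
    using subring_pow[OF vring_subring[OF carrier_is_subfield]] y assms by (simp add: vring_def)
  then show ?case using cong_mult[of "x [^] n" "y [^] n" x y] Suc assms by (simp add: vring_def)
qed (simp add: minus_self)

text \<open>Applied to norms: if all conjugates of x are congruent to x, the norm is congruent to a
  power of x, and for a group of p-power order this is a power of Frobenius.\<close>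

lemma cong_finprod:
  assumes "finite A" "\<And>i. i \<in> A \<Longrightarrow> f i \<in> carrier R" "x \<in> carrier R" "0 \<le> w x" "\<And>i. i \<in> A \<Longrightarrow> 0 < w (f i \<ominus> x)"
  shows "0 < w (finprod R f A \<ominus> x [^] card A)"
  using assms(1,2,5)
proof (induction A)
  case (insert a A)
  have c: "finprod R f A \<in> carrier R" "f a \<in> carrier R" using insert by (auto intro!: finprod_closed)
  have "x \<in> vring w (carrier R)" using assms by (simp add: vring_def)
  then have "x [^] card A \<in> vring w (carrier R)" using subring_pow[OF vring_subring[OF carrier_is_subfield]] by auto
  then have xA: "0 \<le> w (x [^] card A)" by (simp add: vring_def)
  have 1: "0 < w (finprod R f A \<ominus> x [^] card A)" using insert by auto
  have "0 < w (x \<ominus> f a)" using insert.prems(2)[of a] w_minus_commute[of x "f a"] c(2) assms(3) by simp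
  then have fa: "0 \<le> w (f a)" using cong_nonneg[of x "f a"] c assms by auto
  have "0 < w (finprod R f A \<otimes> f a \<ominus> x [^] card A \<otimes> x)"
    using cong_mult[OF c(1) _ c(2) assms(3) fa xA 1] insert.prems(2)[of a] assms(3) by simp
  then show ?case using insert c by (simp add: finprod_insert m_comm Pi_iff)
qed (simp add: minus_self)

lemma w_finprod_const:
  assumes "finite A" "\<And>i. i \<in> A \<Longrightarrow> f i \<in> carrier R" "\<And>i. i \<in> A \<Longrightarrow> w (f i) = ereal r"
  shows "w (finprod R f A) = ereal (real (card A) * r)"
  using assms
proof (induction A)
  case (insert a A)
  have c: "finprod R f A \<in> carrier R" "f a \<in> carrier R" using insert by (auto intro!: finprod_closed)
  show ?case using insert c w_mult[OF c(2,1)] by (simp add: finprod_insert Pi_iff algebra_simps)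
qed (simp add: zero_ereal_def)

lemma w_add_pow_ge:
  assumes "x \<in> carrier R" "0 \<le> w x" shows "0 \<le> w ([(n::nat)] \<cdot> x)"
  using add_pow_in_subring[OF vring_subring[OF carrier_is_subfield], of x n] assms by (simp add: vring_def)

end

section \<open>The Galois group, discreteness of the valuation on L, and inertia\<close>

locale galois_valued = valued_field +
  fixes K L :: "'a set" and p :: nat
  assumes disc: "discrete_on R w K" and compl: "complete_on R w K"
    and p_prime: "Factorial_Ring.prime p" and char_p: "add_pow R p \<one> \<in> vmax w K"
    and gal_L: "galois R K L" and p_ext: "\<exists>n. dim K L = p ^ n"
begin

abbreviation "G \<equiv> gal R K L"
abbreviation "O\<^sub>L \<equiv> vring w L"

definition inertia :: "('a \<Rightarrow> 'a) set" where
  "inertia = {s \<in> G. \<forall>x\<in>O\<^sub>L. 0 < w (s x \<ominus> x)}"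

definition E :: "'a set" where "E = fixed L inertia"

lemma KL: "subfield K R" "subfield L R" "K \<subseteq> L" and K_carrier: "K \<subseteq> carrier R" and L_carrier: "L \<subseteq> carrier R"
  using gal_L subfieldE(3) unfolding galois_def by auto

lemma L_closed:
  "\<zero> \<in> L" "\<one> \<in> L" "x \<in> L \<Longrightarrow> \<ominus> x \<in> L" "x \<in> L \<Longrightarrow> y \<in> L \<Longrightarrow> x \<otimes> y \<in> L"
  "x \<in> L \<Longrightarrow> y \<in> L \<Longrightarrow> x \<oplus> y \<in> L" "x \<in> L \<Longrightarrow> y \<in> L \<Longrightarrow> x \<ominus> y \<in> L" "x \<in> L \<Longrightarrow> x [^] (n::nat) \<in> L"
  "x \<in> L \<Longrightarrow> x \<in> carrier R"
  using subringE[OF subfieldE(1)[OF KL(2)]] subring_pow[OF subfieldE(1)[OF KL(2)]] by (auto simp: a_minus_def)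

lemma L_dimension: "\<exists>n. dimension (p ^ n) K L"
proof -
  obtain n where "dim K L = p ^ n" using p_ext by blast
  moreover have "finite_dimension K L" using gal_L by (simp add: galois_def)
  ultimately show ?thesis using finite_dimensionE[OF KL(1)] by (metis over_def)
qed

lemma G_automorphisms: "automorphisms L G"
  using L_dimension gal_automorphisms[OF KL] by blast

lemma G_fixed: "fixed L G = K" using galois_fixed_eq[OF gal_L] .

lemma G_inv: "s \<in> G \<Longrightarrow> x \<in> L \<Longrightarrow> w (s x) = w x"
  using w_endo_invariant[OF KL _ compl] L_dimension by blast

lemma G_endo: "s \<in> G \<Longrightarrow> s \<in> endo L"
  using automorphismsD(2)[OF G_automorphisms] .

lemma G_closed: "s \<in> G \<Longrightarrow> x \<in> L \<Longrightarrow> s x \<in> L"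
  using endoD(1)[OF G_endo] .

text \<open>The norm to K multiplies the valuation by m = card G, because conjugates have equal
  valuation. Hence the finite values on L lie in (c/m) times the integers.\<close>

lemma discrete_L: "\<exists>e>0. \<forall>x\<in>L - {\<zero>}. \<exists>k::int. w x = ereal (e * real_of_int k)"
proof -
  obtain c where c: "c > 0" "w ` (K - {\<zero>}) = {ereal (c * real_of_int n) | n. True}"
    using disc unfolding discrete_on_def by blast
  define m where "m = card G"
  have m: "m > 0" unfolding m_def using automorphismsD(1,7)[OF G_automorphisms] by (simp add: card_gt_0_iff)
  have "\<exists>k::int. w x = ereal (c / real m * real_of_int k)" if x: "x \<in> L - {\<zero>}" for x
  proof -
    have xR: "x \<in> carrier R" "x \<noteq> \<zero>" using x L_carrier by auto
    obtain r where r: "w x = ereal r" using w_real xR by metis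
    have sx: "s x \<in> carrier R" "w (s x) = ereal r" if "s \<in> G" for s
      using G_closed[OF that, of x] G_inv[OF that, of x] x r L_carrier by auto
    define N where "N = (\<Otimes>s\<in>G. s x)"
    have "w N = ereal (real m * r)"
      unfolding N_def m_def using automorphismsD(1)[OF G_automorphisms] sx by (intro w_finprod_const)
    moreover have "N \<in> K" unfolding N_def using norm_fixed[OF KL(2) G_automorphisms, of x] x G_fixed by simp
    moreover have "N \<noteq> \<zero>" using calculation(1) by auto
    ultimately have "ereal (real m * r) \<in> w ` (K - {\<zero>})" by force
    then obtain k where "real m * r = c * real_of_int k" using c(2) by auto
    then have "r = c / real m * real_of_int k" using m by (simp add: field_simps)
    then show ?thesis using r by blast
  qed
  then show ?thesis using c(1) m by (intro exI[of _ "c / real m"]) auto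
qed

text \<open>Values of nonzero integral elements of L are natural multiples of one e > 0, so a least
  value is attained; zero, of infinite value, is the minimum only if A contains nothing
  else.\<close>

lemma min_value:
  assumes "A \<subseteq> O\<^sub>L" "A \<noteq> {}"
  shows "\<exists>x\<in>A. \<forall>y\<in>A. w x \<le> w y"
proof (cases "A \<subseteq> {\<zero>}")
  case True
  then show ?thesis using assms by auto
next
  case False
  then obtain x0 where x0: "x0 \<in> A" "x0 \<noteq> \<zero>" by auto
  obtain e where e: "e > 0" "\<And>x. x \<in> L - {\<zero>} \<Longrightarrow> \<exists>k::int. w x = ereal (e * real_of_int k)"
    using discrete_L by blast
  define P where "P x \<longleftrightarrow> x \<in> A \<and> x \<noteq> \<zero>" for x
  have k: "\<exists>k::nat. w x = ereal (e * real k)" if "P x" for x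
  proof -
    have "x \<in> L - {\<zero>}" "0 \<le> w x" using that assms(1) by (auto simp: P_def vring_def)
    then obtain k :: int where k: "w x = ereal (e * real_of_int k)" using e(2) by blast
    then have "0 \<le> e * real_of_int k" using \<open>0 \<le> w x\<close> by simp
    then have "k \<ge> 0" using e(1) by (simp add: zero_le_mult_iff)
    then show ?thesis using k by (intro exI[of _ "nat k"]) simp
  qed
  then obtain f where f: "\<And>x. P x \<Longrightarrow> w x = ereal (e * real (f x))" by metis
  have "P x0" using x0 by (simp add: P_def)
  then obtain x where x: "P x" "\<And>y. P y \<Longrightarrow> f x \<le> f y" using ex_has_least_nat[of P x0 f] by auto
  have "w x \<le> w y" if "y \<in> A" for y
  proof (cases "y = \<zero>")
    case False
    then show ?thesis using f x that e(1) by (simp add: P_def mult_left_mono)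
  qed simp
  then show ?thesis using x(1) by (auto simp: P_def)
qed

lemma uniformizer_exists:
  "\<exists>u\<in>L. u \<noteq> \<zero> \<and> 0 < w u \<and> (\<forall>x\<in>L. 0 < w x \<longrightarrow> w u \<le> w x)"
proof -
  obtain c where c: "c > 0" "w ` (K - {\<zero>}) = {ereal (c * real_of_int n) | n. True}"
    using disc unfolding discrete_on_def by blast
  have "ereal c \<in> w ` (K - {\<zero>})" unfolding c(2) by (intro CollectI exI[of _ 1]) simp
  then obtain k where k: "k \<in> K" "w k = ereal c" by (metis DiffD1 imageE)
  define A where "A = {x \<in> L. 0 < w x}"
  have kA: "k \<in> A" using k c(1) KL(3) by (auto simp: A_def)
  obtain u where u: "u \<in> A" "\<And>y. y \<in> A \<Longrightarrow> w u \<le> w y"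
  proof -
    have "A \<subseteq> O\<^sub>L" "A \<noteq> {}" using kA by (auto simp: A_def vring_def)
    then show ?thesis using min_value[of A] that by blast
  qed
  have "w u \<le> ereal c" using u(2)[OF kA] k(2) by simp
  then have "u \<noteq> \<zero>" by auto
  then show ?thesis using u by (auto simp: A_def)
qed

lemma inertiaD: "s \<in> inertia \<Longrightarrow> s \<in> G" "s \<in> inertia \<Longrightarrow> x \<in> O\<^sub>L \<Longrightarrow> 0 < w (s x \<ominus> x)"
  by (auto simp: inertia_def)

lemma O_closed: "s \<in> G \<Longrightarrow> x \<in> O\<^sub>L \<Longrightarrow> s x \<in> O\<^sub>L"
  using G_closed G_inv by (simp add: vring_def)

text \<open>This is the normality of inertia in the Galois group, in the form needed for
  \<open>E_stable\<close>.\<close>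

lemma inertia_conj:
  assumes "s \<in> G" "t \<in> inertia" "u \<in> G" "\<And>x. x \<in> L \<Longrightarrow> s (u x) = x" "x \<in> O\<^sub>L"
  shows "0 < w (s (t (u x)) \<ominus> x)"
proof -
  have ux: "u x \<in> O\<^sub>L" using O_closed assms by simp
  then have t: "0 < w (t (u x) \<ominus> u x)" using inertiaD(2)[OF assms(2)] by simp
  have L: "u x \<in> L" "t (u x) \<in> L" using ux O_closed[OF inertiaD(1)[OF assms(2)] ux] by (auto simp: vring_def)
  have "s (t (u x) \<ominus> u x) = s (t (u x)) \<ominus> s (u x)" using endo_minus[OF KL(2) G_endo[OF assms(1)] L(2,1)] .
  then show ?thesis using G_inv[OF assms(1), of "t (u x) \<ominus> u x"] t L L_closed(6) assms(4)[of x] assms(5)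
    by (simp add: vring_def)
qed

lemma inertia_automorphisms: "automorphisms L inertia"
  unfolding automorphisms_def
proof (intro conjI ballI)
  note S = G_automorphisms
  show "finite inertia" using finite_subset[OF _ automorphismsD(1)[OF S]] by (auto simp: inertia_def)
  show "inertia \<subseteq> endo L \<inter> extensional L" using automorphismsD(2,3)[OF S] by (auto simp: inertia_def)
  have "0 < w ((\<lambda>x\<in>L. x) x \<ominus> x)" if "x \<in> O\<^sub>L" for x
    using that L_carrier by (auto simp: vring_def minus_self subset_iff)
  then show "(\<lambda>x\<in>L. x) \<in> inertia" using automorphismsD(4)[OF S] by (simp add: inertia_def)
  fix s t assume s: "s \<in> inertia" and t: "t \<in> inertia"
  have "0 < w (compose L s t x \<ominus> x)" if x: "x \<in> O\<^sub>L" for x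
  proof -
    have tx: "t x \<in> O\<^sub>L" using O_closed inertiaD t x by blast
    then have "s (t x) \<in> O\<^sub>L" using O_closed inertiaD s by blast
    then have "0 < w (s (t x) \<ominus> x)"
      using cong_trans[of "s (t x)" "t x" x 0] inertiaD(2)[OF s tx] inertiaD(2)[OF t x] tx x L_carrier by (auto simp: vring_def)
    then show ?thesis using x by (simp add: compose_def vring_def)
  qed
  then show "compose L s t \<in> inertia"
    using automorphismsD(5)[OF S inertiaD(1)[OF s] inertiaD(1)[OF t]] by (simp add: inertia_def)
qed

lemma E_subfield: "subfield E R" and E_L: "E \<subseteq> L" and K_E: "K \<subseteq> E"
proof -
  show "subfield E R" unfolding E_def using fixed_subfield[OF KL(2) automorphismsD(6)[OF inertia_automorphisms]] .
  show "E \<subseteq> L" by (auto simp: E_def fixed_def)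
  show "K \<subseteq> E" using KL(3) gal_iff[OF KL(2,3)] by (auto simp: E_def fixed_def inertia_def)
qed

lemma E_fixed: "s \<in> inertia \<Longrightarrow> x \<in> E \<Longrightarrow> s x = x" by (simp add: E_def fixed_def)

lemma finite_dimension_intermediate:
  assumes "subfield M R" "K \<subseteq> M" "M \<subseteq> L" shows "finite_dimension K M"
  using subalbegra_incl_imp_finite_dimension[OF KL(1) _ subfield_subalgebra[OF KL(1) assms(1,2)] assms(3)] gal_L
  by (simp add: galois_def)

text \<open>The order of inertia is the degree of L/E, a divisor of the p-power degree of
  L/K.\<close>

lemma card_inertia: "\<exists>m. card inertia = p ^ m"
proof -
  obtain n where n: "dimension (p ^ n) K L" using L_dimension by blast
  obtain k where k: "dimension k K E" using finite_dimension_intermediate[OF E_subfield K_E E_L] by auto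
  have "dimension (k * card inertia) K L"
    using telescopic_base[OF KL(1) E_subfield k] dimension_fixed[OF KL(2) inertia_automorphisms] by (simp add: E_def)
  then have "k * card inertia = p ^ n" by (rule dimension_is_inj[OF KL(1) _ n])
  then have "card inertia dvd p ^ n" by (metis dvd_triv_right)
  then show ?thesis using divides_primepow_nat[OF p_prime] by blast
qed

text \<open>Each conjugate of x under inertia is congruent to x, so the power of x to the order of
  inertia is congruent to the norm of x, which lies in E.\<close>

lemma residue_purely_inseparable:
  assumes x: "x \<in> O\<^sub>L"
  shows "\<exists>m. \<exists>b\<in>vring w E. 0 < w (x [^] (p ^ m) \<ominus> b)"
proof -
  obtain m where m: "card inertia = p ^ m" using card_inertia by blast
  note S = inertia_automorphisms
  define N where "N = (\<Otimes>s\<in>inertia. s x)"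
  have xR: "x \<in> carrier R" "0 \<le> w x" "x \<in> L" using x L_carrier by (auto simp: vring_def)
  have NE: "N \<in> E" unfolding N_def E_def using norm_fixed[OF KL(2) S xR(3)] .
  have NR: "N \<in> carrier R" using NE E_L L_carrier by auto
  have sx: "s x \<in> carrier R" if "s \<in> inertia" for s using G_closed[OF inertiaD(1)[OF that] xR(3)] L_carrier by auto
  have 1: "0 < w (N \<ominus> x [^] (p ^ m))"
    unfolding N_def m[symmetric] using automorphismsD(1)[OF S] sx xR inertiaD(2)[OF _ x] by (intro cong_finprod)
  have xp: "x [^] (p ^ m) \<in> carrier R" "0 \<le> w (x [^] (p ^ m))"
    using subring_pow[OF vring_subring[OF KL(2)] x, of "p ^ m"] L_carrier by (auto simp: vring_def)
  have 2: "0 < w (x [^] (p ^ m) \<ominus> N)" using 1 w_minus_commute[OF NR xp(1)] by simp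
  have "N \<in> vring w E" using NE cong_nonneg[OF xp(1) NR xp(2) 2] by (rule vringI)
  then show ?thesis using 2 by blast
qed

text \<open>Newton approximation to finite order makes the conjugates under inertia arbitrarily close;
  averaging with a weight of nonzero trace then produces an element of \<open>E\<close>, without any limit.\<close>

lemma newton_step:
  assumes c: "\<And>j. c j \<in> O\<^sub>L" and y: "y \<in> O\<^sub>L" and r: "0 < r" "ereal r \<le> w (polyf c n y)"
    and d: "w (dpolyf c n y) = 0"
  shows "\<exists>z\<in>O\<^sub>L. 0 < w (z \<ominus> y) \<and> ereal (2 * r) \<le> w (polyf c n z) \<and> w (dpolyf c n z) = 0"
proof -
  have OR: "O\<^sub>L \<subseteq> vring w (carrier R)" using L_carrier by (auto simp: vring_def)
  note OLs = vring_subring[OF KL(2)]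
  define f g where "f = polyf c n y" and "g = dpolyf c n y"
  have fg: "f \<in> O\<^sub>L" "g \<in> O\<^sub>L" unfolding f_def g_def using polyf_in_subring[OF OLs, of n c y] c y by auto
  have R: "f \<in> carrier R" "g \<in> carrier R" "y \<in> carrier R" using fg y L_carrier by (auto simp: vring_def)
  have g0: "g \<noteq> \<zero>" using d by (auto simp: g_def)
  have ig: "inv g \<in> L" "g \<otimes> inv g = \<one>" "inv g \<in> carrier R" "w (inv g) = 0"
    using subfield_inv[OF KL(2) _ g0] fg g0 R field_Units w_inv[OF R(2) g0] d by (auto simp: vring_def g_def)
  \<comment> \<open>The Newton correction -f(y)/f'(y): it cancels the linear term, and the remaining
    quadratic term doubles the accuracy.\<close>
  define e where "e = \<ominus> (inv g \<otimes> f)"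
  have eR: "e \<in> carrier R" unfolding e_def using ig R by simp
  have we: "w e = w f" unfolding e_def using w_mult_unit[OF ig(3) R(1) ig(4)] ig R by simp
  have eO: "e \<in> O\<^sub>L" using we fg L_closed(3,4) ig unfolding e_def vring_def by auto
  define z where "z = y \<oplus> e"
  have zO: "z \<in> O\<^sub>L" unfolding z_def using eO y subringE(7)[OF OLs] by simp
  obtain s where s: "s \<in> O\<^sub>L" "polyf c n (y \<oplus> e) = polyf c n y \<oplus> e \<otimes> dpolyf c n y \<oplus> e \<otimes> e \<otimes> s"
    using polyf_taylor[OF OLs y eO, of n c] c by auto
  have sR: "s \<in> carrier R" "0 \<le> w s" using s L_carrier by (auto simp: vring_def)
  have "e \<otimes> g = \<ominus> (g \<otimes> inv g \<otimes> f)" unfolding e_def using ig(3) R by algebra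
  then have "e \<otimes> g = \<ominus> f" using ig R by simp
  then have "polyf c n z = e \<otimes> e \<otimes> s" using s(2) R eR sR unfolding z_def f_def g_def by (simp add: r_neg)
  moreover have "ereal (2 * r) \<le> w (e \<otimes> e \<otimes> s)"
  proof -
    have "ereal r + ereal r \<le> w e + w e" using r(2) we by (intro add_mono) (auto simp: f_def)
    then have "ereal (2 * r) \<le> w (e \<otimes> e)" using w_mult[OF eR eR] by simp
    then show ?thesis using w_mult_ge[of s "e \<otimes> e" "ereal (2 * r)"] eR sR by (simp add: m_comm)
  qed
  moreover have zy: "z \<ominus> y = e" unfolding z_def using R(3) eR by algebra
  moreover have e0: "0 < w e" using we r f_def by (metis ereal_less(2) order_less_le_trans)
  \<comment> \<open>The derivative changes by an integral multiple of e, which lies in the maximal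
    ideal, so it remains a unit.\<close>
  moreover have "w (dpolyf c n z) = 0"
  proof (cases n)
    case (Suc m)
    have "\<And>j. [Suc j] \<cdot> c (Suc j) \<in> vring w (carrier R)"
      using add_pow_in_subring[OF OLs c] OR by blast
    then have "w (z \<ominus> y) \<le> w (dpolyf c n z \<ominus> dpolyf c n y)"
      using w_polyf_diff(1)[of m "\<lambda>j. [Suc j] \<cdot> c (Suc j)" y z] y zO OR dpolyf_eq_polyf[of m c] c L_carrier
      unfolding Suc by (auto simp: vring_def subset_iff)
    then have "0 < w (dpolyf c n z \<ominus> g)" using e0 zy by (simp add: g_def)
    moreover have "dpolyf c n z \<in> carrier R"
      using polyf_in_subring(2)[OF OLs, of n c z] c zO L_carrier by (auto simp: vring_def)
    ultimately show ?thesis using w_eq_of_close[of g "dpolyf c n z"] R(2) d w_minus_commute[of g "dpolyf c n z"] by (simp add: g_def)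
  qed (use d in simp)
  ultimately show ?thesis using zO by (intro bexI[of _ z]) auto
qed

lemma newton_approximation:
  assumes c: "\<And>j. c j \<in> O\<^sub>L" and x: "x \<in> O\<^sub>L" "0 < w (polyf c n x)" "w (dpolyf c n x) = 0"
  shows "\<exists>y\<in>O\<^sub>L. 0 < w (y \<ominus> x) \<and> ereal M \<le> w (polyf c n y) \<and> w (dpolyf c n y) = 0"
proof -
  have xR: "x \<in> carrier R" using x L_carrier by (auto simp: vring_def)
  \<comment> \<open>If the value at x is exactly zero, any positive r serves as starting
    accuracy.\<close>
  obtain r where r: "0 < r" "ereal r \<le> w (polyf c n x)"
  proof (cases "w (polyf c n x)")
    case (real r)
    then show ?thesis using that[of r] x(2) by simp
  qed (use x(2) that[of 1] in auto)
  have "\<exists>y\<in>O\<^sub>L. 0 < w (y \<ominus> x) \<and> ereal (2 ^ k * r) \<le> w (polyf c n y) \<and> w (dpolyf c n y) = 0" for k :: nat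
  proof (induction k)
    case 0
    then show ?case using x r xR by (intro bexI[of _ x]) (auto simp: minus_self)
  next
    case (Suc k)
    then obtain y where y: "y \<in> O\<^sub>L" "0 < w (y \<ominus> x)" "ereal (2 ^ k * r) \<le> w (polyf c n y)" "w (dpolyf c n y) = 0" by auto
    obtain z where z: "z \<in> O\<^sub>L" "0 < w (z \<ominus> y)" "ereal (2 * (2 ^ k * r)) \<le> w (polyf c n z)" "w (dpolyf c n z) = 0"
      using newton_step[OF c y(1) _ y(3,4)] r by auto
    have "0 < w (z \<ominus> x)" using cong_trans[of z y x 0] z y xR L_carrier by (auto simp: vring_def)
    then show ?case using z by (intro bexI[of _ z]) (auto simp: algebra_simps)
  qed
  moreover obtain k :: nat where "M \<le> 2 ^ k * r"
  proof -
    obtain k :: nat where "M / r < 2 ^ k" using real_arch_pow[of 2 "M / r"] by auto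
    then have "M \<le> 2 ^ k * r" using r(1) by (simp add: divide_simps)
    then show ?thesis using that by blast
  qed
  ultimately show ?thesis by (meson ereal_less_eq(3) order_trans)
qed

text \<open>Used through its contrapositive in \<open>res_indep_mult_p\<close>: if the residue of x
  is not in k_E, a polynomial over k_E that vanishes there has vanishing derivative there.\<close>

lemma simple_root_residue:
  assumes c: "\<And>j. c j \<in> vring w E" and x: "x \<in> O\<^sub>L" "0 < w (polyf c n x)" "w (dpolyf c n x) = 0"
  shows "\<exists>b\<in>vring w E. 0 < w (x \<ominus> b)"
proof -
  note S = inertia_automorphisms
  have cO: "c j \<in> O\<^sub>L" for j using c E_L by (auto simp: vring_def)
  have OR: "O\<^sub>L \<subseteq> vring w (carrier R)" using L_carrier by (auto simp: vring_def)
  obtain z where z: "z \<in> L" "(\<Oplus>s\<in>inertia. s (z \<otimes> \<one>)) \<noteq> \<zero>"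
    using trace_nonzero[OF KL(2) S L_closed(2)] by auto
  define t where "t = (\<Oplus>s\<in>inertia. s z)"
  have zR: "z \<in> carrier R" using z L_carrier by auto
  have t0: "t \<noteq> \<zero>" using z zR by (simp add: t_def)
  have tE: "t \<in> E" unfolding t_def E_def using trace_fixed[OF KL(2) S z(1)] .
  have tR: "t \<in> carrier R" using tE E_L L_carrier by auto
  have "z \<noteq> \<zero>"
  proof
    assume "z = \<zero>"
    then have "t = (\<Oplus>s\<in>inertia. \<zero>)" unfolding t_def using endo_zero[OF KL(2) G_endo] inertiaD(1)
      by (intro finsum_cong') auto
    then show False using t0 by (simp add: finsum_zero)
  qed
  then obtain a where a: "w z = ereal a" using w_real zR by metis
  obtain b where b: "w t = ereal b" using w_real tR t0 by metis
  \<comment> \<open>The average v/t formed below differs from y by the sum of s z (s y - y) divided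
    by t, of valuation at least a + (b - a + 1) - b = 1.\<close>
  obtain y where y: "y \<in> O\<^sub>L" "0 < w (y \<ominus> x)" "ereal (b - a + 1) \<le> w (polyf c n y)" "w (dpolyf c n y) = 0"
    using newton_approximation[OF cO x] by blast
  have yL: "y \<in> L" "y \<in> carrier R" using y L_carrier by (auto simp: vring_def)
  have fy: "polyf c n y \<in> L" using polyf_in_subring(1)[OF vring_subring[OF KL(2)], of n c y] cO y by (auto simp: vring_def)
  have conj: "ereal (b - a + 1) \<le> w (s y \<ominus> y)" if s: "s \<in> inertia" for s
  proof -
    have sG: "s \<in> G" using inertiaD(1)[OF s] .
    have sy: "s y \<in> O\<^sub>L" using O_closed[OF sG y(1)] .
    have f: "s (polyf c m y) = polyf c m (s y) \<and> polyf c m y \<in> L" for m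
    proof (induction m)
      case 0
      then show ?case using endo_zero[OF KL(2) G_endo[OF sG]] L_closed by simp
    next
      case (Suc m)
      have cj: "c m \<in> L" "s (c m) = c m" using cO[of m] c[of m] E_fixed[OF s] by (auto simp: vring_def)
      have "s (c m \<otimes> y [^] m) = c m \<otimes> s y [^] m"
        using endoD(2)[OF G_endo[OF sG] cj(1) L_closed(7)[OF yL(1)]] cj(2) endo_pow[OF KL(2) G_endo[OF sG] yL(1)] by simp
      moreover have "c m \<otimes> y [^] m \<in> L" using cj yL L_closed by simp
      ultimately show ?case using Suc endoD(3)[OF G_endo[OF sG], of "polyf c m y" "c m \<otimes> y [^] m"] L_closed(5) by simp
    qed
    \<comment> \<open>As f'(y) is a unit, s y - y has the valuation of f(s y) - f(y), and f(s y) = s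
      (f(y)) is as small as f(y).\<close>
    have "w (s y \<ominus> y) = w (polyf c n (s y) \<ominus> polyf c n y)"
      using w_polyf_diff(3)[of n c y "s y"] cO OR y sy inertiaD(2)[OF s y(1)] by (auto simp: subset_iff)
    also have "ereal (b - a + 1) \<le> \<dots>"
      using w_minus_ge[of "polyf c n (s y)" "polyf c n y"] f[of n] y(3) G_inv[OF sG fy] fy G_closed[OF sG fy] L_carrier by auto
    finally show ?thesis .
  qed
  define v where "v = (\<Oplus>s\<in>inertia. s (z \<otimes> y))"
  have zyL: "z \<otimes> y \<in> L" using z yL L_closed by simp
  have vE: "v \<in> E" unfolding v_def E_def using trace_fixed[OF KL(2) S zyL] .
  have vR: "v \<in> carrier R" using vE E_L L_carrier by auto
  have sz: "s z \<in> carrier R" "s y \<in> carrier R" if "s \<in> inertia" for s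
    using G_closed[OF inertiaD(1)[OF that]] z(1) yL L_carrier by auto
  have "v = (\<Oplus>s\<in>inertia. s z \<otimes> (s y \<ominus> y) \<oplus> s z \<otimes> y)"
    unfolding v_def
  proof (intro finsum_cong')
    show "(\<lambda>s. s z \<otimes> (s y \<ominus> y) \<oplus> s z \<otimes> y) \<in> inertia \<rightarrow> carrier R" using sz yL by auto
    fix s assume s: "s \<in> inertia"
    show "s (z \<otimes> y) = s z \<otimes> (s y \<ominus> y) \<oplus> s z \<otimes> y"
      using endoD(2)[OF G_endo[OF inertiaD(1)[OF s]] z(1) yL(1)] sz[OF s] yL(2) by simp algebra
  qed simp
  also have "\<dots> = (\<Oplus>s\<in>inertia. s z \<otimes> (s y \<ominus> y)) \<oplus> (\<Oplus>s\<in>inertia. s z \<otimes> y)"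
    using sz yL by (intro finsum_addf) auto
  also have "(\<Oplus>s\<in>inertia. s z \<otimes> y) = t \<otimes> y"
    unfolding t_def using sz yL automorphismsD(1)[OF S] by (intro finsum_ldistr[symmetric]) auto
  finally have v: "v = (\<Oplus>s\<in>inertia. s z \<otimes> (s y \<ominus> y)) \<oplus> t \<otimes> y" .
  define q where "q = (\<Oplus>s\<in>inertia. s z \<otimes> (s y \<ominus> y))"
  have qR: "q \<in> carrier R" unfolding q_def using sz yL by (intro finsum_closed) auto
  have wq: "ereal (b + 1) \<le> w q" unfolding q_def
  proof (rule w_finsum_ge)
    fix s assume s: "s \<in> inertia"
    show "s z \<otimes> (s y \<ominus> y) \<in> carrier R" using sz[OF s] yL by simp
    have "ereal a + ereal (b - a + 1) \<le> w (s z) + w (s y \<ominus> y)"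
      using conj[OF s] G_inv[OF inertiaD(1)[OF s] z(1)] a by (intro add_mono) auto
    then show "ereal (b + 1) \<le> w (s z \<otimes> (s y \<ominus> y))" using w_mult[of "s z" "s y \<ominus> y"] sz[OF s] yL by simp
  qed
  have it: "inv t \<in> E" "inv t \<in> carrier R" "inv t \<otimes> t = \<one>" "w (inv t) = ereal (- b)"
    using subfield_inv[OF E_subfield tE t0] field_Units tR t0 w_inv[OF tR t0] b by auto
  define h where "h = inv t \<otimes> v"
  have hE: "h \<in> E" unfolding h_def using it vE subringE(6)[OF subfieldE(1)[OF E_subfield]] by simp
  have hR: "h \<in> carrier R" using hE E_L L_carrier by auto
  have "h = inv t \<otimes> q \<oplus> inv t \<otimes> t \<otimes> y" unfolding h_def v q_def[symmetric] using it(2) qR tR yL(2) by algebra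
  then have "h \<ominus> y = inv t \<otimes> q" using it qR yL(2) by (simp add: a_minus_def a_assoc r_neg)
  then have "w (h \<ominus> y) = ereal (- b) + w q" using w_mult[OF it(2) qR] it(4) by simp
  then have hy: "0 < w (h \<ominus> y)" using wq by (cases "w q") auto
  have xR: "x \<in> carrier R" "0 \<le> w x" using x L_carrier by (auto simp: vring_def)
  have "0 < w (x \<ominus> h)"
    using cong_trans[of h y x 0] hy y(2) hR yL xR w_minus_commute[of x h] by simp
  moreover have "0 \<le> w h" using cong_nonneg[OF xR(1) hR xR(2) calculation] .
  ultimately show ?thesis using hE by (intro bexI[of _ h]) (auto simp: vring_def)
qed

end

section \<open>Residue fields\<close>

context valued_field
begin

abbreviation cl :: "'a set \<Rightarrow> 'a \<Rightarrow> 'a set" where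
  "cl M x \<equiv> a_r_coset R (vmax w M) x"

abbreviation rf :: "'a set \<Rightarrow> 'a set ring" where
  "rf M \<equiv> residue_field R w M"

context
  fixes M assumes M: "subfield M R"
begin

lemma vmax_ideal: "ideal (vmax w M) (R\<lparr>carrier := vring w M\<rparr>)"
proof -
  note V = vring_subring[OF M]
  note VR = subringE(1)[OF V] and Vs = subringE[OF V]
  interpret B: ring "R\<lparr>carrier := vring w M\<rparr>" using subring_is_ring[OF V] .
  have ainv: "\<ominus>\<^bsub>R\<lparr>carrier := vring w M\<rparr>\<^esub> x = \<ominus> x" if "x \<in> vring w M" for x
    using that VR Vs(5)[OF that] B.minus_equality[of "\<ominus> x" x] by (simp add: l_neg subset_iff)
  have sub: "vmax w M \<subseteq> vring w M" by (auto simp: vmax_def vring_def)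
  show ?thesis
  proof (rule idealI[OF B.ring_axioms])
    show "subgroup (vmax w M) (add_monoid (R\<lparr>carrier := vring w M\<rparr>))"
    proof (rule B.add.subgroupI)
      show "vmax w M \<subseteq> carrier (R\<lparr>carrier := vring w M\<rparr>)" using sub by simp
      show "vmax w M \<noteq> {}" using subringE(2)[OF subfieldE(1)[OF M]] by (auto simp: vmax_def)
      fix a assume a: "a \<in> vmax w M"
      then have "a \<in> vring w M" "\<ominus> a \<in> M" "a \<in> carrier R" using sub subringE(5)[OF subfieldE(1)[OF M]] subfieldE(3)[OF M] by (auto simp: vmax_def)
      then show "\<ominus>\<^bsub>R\<lparr>carrier := vring w M\<rparr>\<^esub> a \<in> vmax w M" using a ainv by (simp add: vmax_def)
      fix b assume b: "b \<in> vmax w M"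
      then have "b \<in> carrier R" using subfieldE(3)[OF M] by (auto simp: vmax_def)
      then show "a \<oplus>\<^bsub>R\<lparr>carrier := vring w M\<rparr>\<^esub> b \<in> vmax w M"
        using a b \<open>a \<in> carrier R\<close> subringE(7)[OF subfieldE(1)[OF M]] w_add_gt[of a b 0] by (simp add: vmax_def)
    qed
    fix a x assume ax: "a \<in> vmax w M" "x \<in> carrier (R\<lparr>carrier := vring w M\<rparr>)"
    then have "a \<in> M" "x \<in> M" "a \<in> carrier R" "x \<in> carrier R" "0 < w a" "0 \<le> w x"
      using subfieldE(3)[OF M] by (auto simp: vmax_def vring_def)
    then show "x \<otimes>\<^bsub>R\<lparr>carrier := vring w M\<rparr>\<^esub> a \<in> vmax w M" "a \<otimes>\<^bsub>R\<lparr>carrier := vring w M\<rparr>\<^esub> x \<in> vmax w M"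
      using vmax_mult[of x a] subringE(6)[OF subfieldE(1)[OF M]] by (auto simp: vmax_def m_comm)
  qed
qed

lemma cl_eq_coset: "a_r_coset (R\<lparr>carrier := vring w M\<rparr>) (vmax w M) x = cl M x"
  unfolding a_r_coset_def r_coset_def by simp

lemma cl_hom: "(\<lambda>x. cl M x) \<in> ring_hom (R\<lparr>carrier := vring w M\<rparr>) (rf M)"
  using ideal.rcos_ring_hom[OF vmax_ideal] unfolding residue_field_def cl_eq_coset[abs_def] .

lemma rf_carrier: "carrier (rf M) = cl M ` vring w M"
  unfolding residue_field_def FactRing_def A_RCOSETS_def' cl_eq_coset by auto

lemma cl_simps:
  "x \<in> vring w M \<Longrightarrow> cl M x \<in> carrier (rf M)"
  "x \<in> vring w M \<Longrightarrow> y \<in> vring w M \<Longrightarrow> cl M (x \<oplus> y) = cl M x \<oplus>\<^bsub>rf M\<^esub> cl M y"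
  "x \<in> vring w M \<Longrightarrow> y \<in> vring w M \<Longrightarrow> cl M (x \<otimes> y) = cl M x \<otimes>\<^bsub>rf M\<^esub> cl M y"
  "cl M \<one> = \<one>\<^bsub>rf M\<^esub>"
  using cl_hom unfolding ring_hom_def by auto

text \<open>Through this equivalence, arguments about residue classes are carried out with
  representatives.\<close>

lemma cl_eq_iff:
  assumes x: "x \<in> vring w M" and y: "y \<in> vring w M"
  shows "cl M x = cl M y \<longleftrightarrow> 0 < w (x \<ominus> y)"
proof -
  note Ms = subringE[OF subfieldE(1)[OF M]]
  have R: "x \<in> carrier R" "y \<in> carrier R" "x \<in> M" "y \<in> M" using x y subfieldE(3)[OF M] by (auto simp: vring_def)
  have mem: "z \<in> cl M v \<longleftrightarrow> (\<exists>h\<in>vmax w M. z = h \<oplus> v)" for z v unfolding a_r_coset_def' by auto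
  have d: "x \<ominus> y \<in> M" using R Ms by (simp add: a_minus_def)
  show ?thesis
  proof
    assume "cl M x = cl M y"
    moreover have "x \<in> cl M x" unfolding mem using R Ms(2) by (intro bexI[of _ \<zero>]) (auto simp: vmax_def)
    ultimately obtain h where h: "h \<in> vmax w M" "x = h \<oplus> y" using mem by blast
    have hR: "h \<in> carrier R" using h Ms(1) by (auto simp: vmax_def)
    have "x \<ominus> y = h" using h(2) hR R(2) by (simp add: a_minus_def a_assoc r_neg)
    then show "0 < w (x \<ominus> y)" using h by (simp add: vmax_def)
  next
    have sub: "cl M x \<subseteq> cl M y" if "0 < w (x \<ominus> y)" "x \<in> M" "y \<in> M" for x y
    proof
      fix z assume "z \<in> cl M x"
      then obtain h where h: "h \<in> vmax w M" "z = h \<oplus> x" using mem by blast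
      have R: "h \<in> carrier R" "x \<in> carrier R" "y \<in> carrier R" "h \<in> M" using h that Ms(1) by (auto simp: vmax_def)
      have "z = (h \<oplus> (x \<ominus> y)) \<oplus> y" using h(2) R by algebra
      moreover have "h \<oplus> (x \<ominus> y) \<in> vmax w M"
        using h R that Ms w_add_gt[of h "x \<ominus> y" 0] by (auto simp: vmax_def a_minus_def)
      ultimately show "z \<in> cl M y" using mem by blast
    qed
    assume "0 < w (x \<ominus> y)"
    then show "cl M x = cl M y" using sub[of x y] sub[of y x] R w_minus_commute[of x y] by auto
  qed
qed

lemma rf_zero: "\<zero>\<^bsub>rf M\<^esub> = cl M \<zero>"
proof -
  have "\<zero>\<^bsub>rf M\<^esub> = vmax w M" by (simp add: residue_field_def FactRing_def)
  also have "\<dots> = cl M \<zero>" unfolding a_r_coset_def' using subfieldE(3)[OF M] by (force simp: vmax_def)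
  finally show ?thesis .
qed

lemma cl_zero_iff: "x \<in> vring w M \<Longrightarrow> cl M x = \<zero>\<^bsub>rf M\<^esub> \<longleftrightarrow> 0 < w x"
  unfolding rf_zero using cl_eq_iff[of x \<zero>] subringE(2)[OF vring_subring[OF M]] subringE(1)[OF vring_subring[OF M]]
  by (auto simp: a_minus_def subset_iff)

lemma rf_field: "field (rf M)"
proof -
  note V = vring_subring[OF M]
  have "subcring (vring w M) R" using subcringI'[OF V] .
  then have "cring (R\<lparr>carrier := vring w M\<rparr>)" using subcring_iff[OF subringE(1)[OF V]] by simp
  then interpret Q: cring "rf M" unfolding residue_field_def by (rule ideal.quotient_is_cring[OF vmax_ideal])
  have one0: "\<one>\<^bsub>rf M\<^esub> \<noteq> \<zero>\<^bsub>rf M\<^esub>"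
    using cl_zero_iff[of \<one>] cl_simps(4) subringE(3)[OF V] by auto
  show ?thesis
  proof (rule Q.cring_fieldI)
    show "Units (rf M) = carrier (rf M) - {\<zero>\<^bsub>rf M\<^esub>}"
    proof
      show "Units (rf M) \<subseteq> carrier (rf M) - {\<zero>\<^bsub>rf M\<^esub>}"
      proof
        fix u assume u: "u \<in> Units (rf M)"
        have "u \<noteq> \<zero>\<^bsub>rf M\<^esub>"
        proof
          assume "u = \<zero>\<^bsub>rf M\<^esub>"
          moreover obtain v where "v \<in> carrier (rf M)" "u \<otimes>\<^bsub>rf M\<^esub> v = \<one>\<^bsub>rf M\<^esub>" using u Q.Units_r_inv_ex by blast
          ultimately show False using one0 by simp
        qed
        then show "u \<in> carrier (rf M) - {\<zero>\<^bsub>rf M\<^esub>}" using u by auto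
      qed
      show "carrier (rf M) - {\<zero>\<^bsub>rf M\<^esub>} \<subseteq> Units (rf M)"
      proof
        fix u assume u: "u \<in> carrier (rf M) - {\<zero>\<^bsub>rf M\<^esub>}"
        then obtain x where x: "x \<in> vring w M" "u = cl M x" using rf_carrier by auto
        have xM: "x \<in> M" "x \<in> carrier R" "0 \<le> w x" using x subfieldE(3)[OF M] by (auto simp: vring_def)
        have "\<not> 0 < w x" using u x cl_zero_iff by auto
        then have wx: "w x = 0" using xM by auto
        then have x0: "x \<noteq> \<zero>" by auto
        have i: "inv x \<in> M" "inv x \<in> carrier R" "x \<otimes> inv x = \<one>" "w (inv x) = 0"
          using subfield_inv[OF M xM(1) x0] field_Units xM x0 w_inv[OF xM(2) x0] wx by auto
        have iv: "inv x \<in> vring w M" using i by (simp add: vring_def)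
        have "u \<otimes>\<^bsub>rf M\<^esub> cl M (inv x) = \<one>\<^bsub>rf M\<^esub>" using cl_simps(3)[OF x(1) iv] cl_simps(4) x(2) i(3) by simp
        then show "u \<in> Units (rf M)" using u cl_simps(1)[OF iv] Q.m_comm unfolding Units_def by force
      qed
    qed
  qed
qed

lemma res_img_subfield:
  assumes F: "subfield F R" and FM: "F \<subseteq> M"
  shows "subfield (res_img R w F M) (rf M)"
proof -
  interpret Q: field "rf M" by (rule rf_field)
  have im: "res_img R w F M = cl M ` vring w F" unfolding res_img_def by auto
  have sub: "vring w F \<subseteq> vring w M" using FM by (auto simp: vring_def)
  note V = subringE[OF vring_subring[OF F]]
  show ?thesis unfolding im
  proof (rule Q.subfieldI')
    show "subring (cl M ` vring w F) (rf M)"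
    proof (rule Q.subringI)
      show "cl M ` vring w F \<subseteq> carrier (rf M)" using cl_simps(1) sub by auto
      show "\<one>\<^bsub>rf M\<^esub> \<in> cl M ` vring w F" using cl_simps(4) V(3) by (metis imageI)
      fix h assume "h \<in> cl M ` vring w F"
      then obtain x where x: "x \<in> vring w F" "h = cl M x" by auto
      have nx: "\<ominus> x \<in> vring w F" using V(5) x by simp
      have "cl M (\<ominus> x) \<oplus>\<^bsub>rf M\<^esub> h = \<zero>\<^bsub>rf M\<^esub>"
        using cl_simps(2)[of "\<ominus> x" x] sub nx x rf_zero V(1) by (auto simp: l_neg subset_iff)
      then have "\<ominus>\<^bsub>rf M\<^esub> h = cl M (\<ominus> x)" using Q.minus_equality cl_simps(1) sub nx x by blast
      then show "\<ominus>\<^bsub>rf M\<^esub> h \<in> cl M ` vring w F" using nx by simp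
      fix k assume "k \<in> cl M ` vring w F"
      then obtain y where y: "y \<in> vring w F" "k = cl M y" by auto
      have "h \<otimes>\<^bsub>rf M\<^esub> k = cl M (x \<otimes> y)" "h \<oplus>\<^bsub>rf M\<^esub> k = cl M (x \<oplus> y)"
        using cl_simps(2,3)[of x y] x y sub by auto
      then show "h \<otimes>\<^bsub>rf M\<^esub> k \<in> cl M ` vring w F" "h \<oplus>\<^bsub>rf M\<^esub> k \<in> cl M ` vring w F"
        using V(6,7) x y by auto
    qed
    fix k assume k: "k \<in> cl M ` vring w F - {\<zero>\<^bsub>rf M\<^esub>}"
    then obtain x where x: "x \<in> vring w F" "k = cl M x" by auto
    have xF: "x \<in> F" "x \<in> carrier R" "0 \<le> w x" "x \<in> vring w M" using x sub subfieldE(3)[OF F] by (auto simp: vring_def)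
    have "\<not> 0 < w x" using k x cl_zero_iff[OF xF(4)] by auto
    then have wx: "w x = 0" using xF by auto
    then have x0: "x \<noteq> \<zero>" by auto
    have i: "inv x \<in> F" "inv x \<in> carrier R" "x \<otimes> inv x = \<one>" "w (inv x) = 0"
      using subfield_inv[OF F xF(1) x0] field_Units xF x0 w_inv[OF xF(2) x0] wx by auto
    have iv: "inv x \<in> vring w F" using i by (simp add: vring_def)
    have "k \<otimes>\<^bsub>rf M\<^esub> cl M (inv x) = \<one>\<^bsub>rf M\<^esub>" using cl_simps(3)[of x "inv x"] cl_simps(4) x(2) i(3) xF(4) iv sub by auto
    moreover have kC: "k \<in> carrier (rf M)" "cl M (inv x) \<in> carrier (rf M)" using cl_simps(1) xF iv sub x by auto
    ultimately have "inv\<^bsub>rf M\<^esub> k = cl M (inv x)" by (metis Q.comm_inv_char)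
    then show "inv\<^bsub>rf M\<^esub> k \<in> cl M ` vring w F" using iv by simp
  qed
qed

lemma cl_pow: "x \<in> vring w M \<Longrightarrow> cl M (x [^] (n::nat)) = cl M x [^]\<^bsub>rf M\<^esub> n"
proof (induction n)
  case 0
  interpret Q: field "rf M" by (rule rf_field)
  show ?case using cl_simps(4) by simp
next
  case (Suc n)
  interpret Q: field "rf M" by (rule rf_field)
  show ?case using Suc cl_simps(3)[OF subring_pow[OF vring_subring[OF M] Suc.prems] Suc.prems] by simp
qed

lemma cl_add_pow: "x \<in> vring w M \<Longrightarrow> cl M ([(n::nat)] \<cdot> x) = [n] \<cdot>\<^bsub>rf M\<^esub> cl M x"
proof (induction n)
  case 0
  interpret Q: field "rf M" by (rule rf_field)
  show ?case using rf_zero by simp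
next
  case (Suc n)
  interpret Q: field "rf M" by (rule rf_field)
  show ?case using Suc cl_simps(2)[OF add_pow_in_subring[OF vring_subring[OF M] Suc.prems] Suc.prems] by simp
qed

lemma cl_polyf:
  assumes c: "\<And>j. c j \<in> vring w M" and x: "x \<in> vring w M"
  shows "cl M (polyf c n x) = ring.polyf (rf M) (\<lambda>j. cl M (c j)) n (cl M x)"
    "cl M (dpolyf c n x) = ring.dpolyf (rf M) (\<lambda>j. cl M (c j)) n (cl M x)"
proof -
  interpret Q: field "rf M" by (rule rf_field)
  note V = vring_subring[OF M]
  note Vs = subringE[OF V]
  have p: "polyf c n x \<in> vring w M" "dpolyf c n x \<in> vring w M" for n
    using polyf_in_subring[OF V, of n c x] c x by auto
  have xn: "x [^] n \<in> vring w M" "[k] \<cdot> (x [^] n) \<in> vring w M" for n k :: nat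
    using subring_pow[OF V x] add_pow_in_subring[OF V] by auto
  show "cl M (polyf c n x) = Q.polyf (\<lambda>j. cl M (c j)) n (cl M x)"
  proof (induction n)
    case (Suc n)
    then show ?case
      using cl_simps(2)[OF p(1)[of n] Vs(6)[OF c[of n] xn(1)[of n]]] cl_simps(3)[OF c[of n] xn(1)[of n]] cl_pow[OF x, of n] by simp
  qed (simp add: rf_zero)
  show "cl M (dpolyf c n x) = Q.dpolyf (\<lambda>j. cl M (c j)) n (cl M x)"
  proof (induction n)
    case (Suc n)
    then show ?case
      using cl_simps(2)[OF p(2)[of n] Vs(6)[OF c[of n] xn(2)[of n "n - 1"]]] cl_simps(3)[OF c[of n] xn(2)[of n "n - 1"]]
        cl_add_pow[OF xn(1)[of "n - 1"], of n] cl_pow[OF x, of "n - 1"] by simp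
  qed (simp add: rf_zero)
qed

text \<open>The coefficients of the minimal polynomial of the residue are lifted one by one to
  integral elements of F; separability says that the derivative at x is a unit.\<close>

lemma separable_lift:
  assumes F: "subfield F R" "F \<subseteq> M" and sep: "separable_ext (rf M) (res_img R w F M)" and x: "x \<in> vring w M"
  shows "\<exists>c n. (\<forall>j. c j \<in> vring w F) \<and> 0 < w (polyf c n x) \<and> w (dpolyf c n x) = 0"
proof -
  interpret Q: field "rf M" by (rule rf_field)
  define A where "A = res_img R w F M"
  have A: "subfield A (rf M)" unfolding A_def using res_img_subfield[OF F] .
  have xc: "cl M x \<in> carrier (rf M)" using cl_simps(1)[OF x] .
  have alg: "(Q.algebraic over A) (cl M x)" and sp: "separable_poly (rf M) A (Q.Irr A (cl M x))"
    using sep xc unfolding separable_ext_def A_def over_def by auto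
  note I = Q.IrrE[OF A xc alg]
  have fA: "set (Q.Irr A (cl M x)) \<subseteq> A" using I(1) Q.polynomial_incl univ_poly_carrier by blast
  have ne: "Q.eval (poly_deriv (rf M) (Q.Irr A (cl M x))) (cl M x) \<noteq> \<zero>\<^bsub>rf M\<^esub>"
    using sp Q.separable_irr_iff[OF A xc alg] by simp
  obtain d where d: "\<And>j. d j \<in> A"
    "Q.eval (Q.Irr A (cl M x)) (cl M x) = Q.polyf d (length (Q.Irr A (cl M x))) (cl M x)"
    "Q.eval (poly_deriv (rf M) (Q.Irr A (cl M x))) (cl M x) = Q.dpolyf d (length (Q.Irr A (cl M x))) (cl M x)"
    using Q.list_polyf[OF subfieldE(1)[OF A] fA] xc by blast
  define n where "n = length (Q.Irr A (cl M x))"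
  have "\<forall>j. \<exists>c. c \<in> vring w F \<and> d j = cl M c" using d(1) unfolding A_def res_img_def by blast
  then obtain c where c: "\<And>j. c j \<in> vring w F" "\<And>j. d j = cl M (c j)" by metis
  have cM: "c j \<in> vring w M" for j using c(1)[of j] F(2) by (auto simp: vring_def)
  have dd: "d = (\<lambda>j. cl M (c j))" using c(2) by auto
  have p: "polyf c n x \<in> vring w M" "dpolyf c n x \<in> vring w M"
    using polyf_in_subring[OF vring_subring[OF M], of n c x] cM x by auto
  have "cl M (polyf c n x) = \<zero>\<^bsub>rf M\<^esub>" using cl_polyf(1)[of c x n, OF cM x] d(2) I(4) unfolding dd n_def by simp
  then have "0 < w (polyf c n x)" using cl_zero_iff[OF p(1)] by simp
  moreover have "cl M (dpolyf c n x) \<noteq> \<zero>\<^bsub>rf M\<^esub>" using cl_polyf(2)[of c x n, OF cM x] d(3) ne unfolding dd n_def by simp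
  then have "w (dpolyf c n x) = 0" using cl_zero_iff[OF p(2)] p(2) by (auto simp: vring_def)
  ultimately show ?thesis using c(1) by blast
qed

end

end

subsection \<open>Frobenius on the residue field\<close>

lemma (in cring) binomial:
  assumes x: "x \<in> carrier R" and y: "y \<in> carrier R"
  shows "(x \<oplus> y) [^] n = (\<Oplus>k\<in>{..n}. [(n choose k)] \<cdot> (x [^] k \<otimes> y [^] (n - k)))"
proof (induction n)
  case 0
  then show ?case by simp
next
  case (Suc n)
  define f where "f k = [(n choose k)] \<cdot> (x [^] k \<otimes> y [^] (n - k))" for k
  define g where "g k = [(n choose k)] \<cdot> (x [^] k \<otimes> y [^] (Suc n - k))" for k
  define h where "h k = [(Suc n choose k)] \<cdot> (x [^] k \<otimes> y [^] (Suc n - k))" for k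
  have C: "f k \<in> carrier R" "g k \<in> carrier R" "h k \<in> carrier R" for k unfolding f_def g_def h_def using x y by auto
  have fx: "f k \<otimes> x = [(n choose k)] \<cdot> (x [^] Suc k \<otimes> y [^] (n - k))" for k
    unfolding f_def using x y by (simp add: add_pow_ldistr add_pow_rdistr m_ac)
  have fy: "f k \<otimes> y = g k" if "k \<le> n" for k
    unfolding f_def g_def using x y that by (simp add: add_pow_ldistr add_pow_rdistr m_ac Suc_diff_le)
  have hs: "h (Suc k) = f k \<otimes> x \<oplus> g (Suc k)" for k
    unfolding fx h_def g_def using x y by (simp add: add.nat_pow_mult[symmetric])
  have "(x \<oplus> y) [^] Suc n = (\<Oplus>k\<in>{..n}. f k) \<otimes> x \<oplus> (\<Oplus>k\<in>{..n}. f k) \<otimes> y"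
    using Suc x y C unfolding f_def[symmetric] by (simp add: r_distr)
  also have "(\<Oplus>k\<in>{..n}. f k) \<otimes> x = (\<Oplus>k\<in>{..n}. f k \<otimes> x)"
    using C x by (intro finsum_ldistr) auto
  also have "(\<Oplus>k\<in>{..n}. f k) \<otimes> y = (\<Oplus>k\<in>{..n}. f k \<otimes> y)"
    using C y by (intro finsum_ldistr) auto
  also have "\<dots> = (\<Oplus>k\<in>{..n}. g k)" using fy C by (intro finsum_cong') auto
  also have "\<dots> = (\<Oplus>k\<in>{..Suc n}. g k)"
  proof -
    have "g (Suc n) = \<zero>" by (simp add: g_def binomial_eq_0)
    then show ?thesis using finsum_Suc[of g n] C by simp
  qed
  also have "\<dots> = (\<Oplus>k\<in>{..n}. g (Suc k)) \<oplus> g 0" using C by (intro finsum_Suc2) auto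
  also have "(\<Oplus>k\<in>{..n}. f k \<otimes> x) \<oplus> ((\<Oplus>k\<in>{..n}. g (Suc k)) \<oplus> g 0) = (\<Oplus>k\<in>{..n}. f k \<otimes> x \<oplus> g (Suc k)) \<oplus> g 0"
    using C x by (subst finsum_addf) (auto simp: a_assoc)
  also have "\<dots> = (\<Oplus>k\<in>{..n}. h (Suc k)) \<oplus> h 0" unfolding hs by (simp add: g_def h_def)
  also have "\<dots> = (\<Oplus>k\<in>{..Suc n}. h k)" using C by (intro finsum_Suc2[symmetric]) auto
  finally show ?case unfolding h_def .
qed

context galois_valued
begin

lemma w_p: "0 < w ([p] \<cdot> \<one>)" using char_p by (simp add: vmax_def)

lemma w_multiple_of_p: assumes "x \<in> carrier R" "0 \<le> w x" "p dvd n" shows "0 < w ([(n::nat)] \<cdot> x)"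
proof -
  obtain m where m: "n = p * m" using assms(3) by auto
  have "[n] \<cdot> x = [p] \<cdot> \<one> \<otimes> [m] \<cdot> x"
    unfolding m using assms(1) by (simp add: add.nat_pow_pow add_pow_ldistr mult.commute)
  then show ?thesis using vmax_mult[of "[m] \<cdot> x" "[p] \<cdot> \<one>"] w_p w_add_pow_ge[OF assms(1,2)] assms(1) by (simp add: m_comm)
qed

text \<open>A Bezout relation b j = a p + 1 makes b j times 1 a unit, so its integral factor [j] 1
  is a unit as well.\<close>

lemma w_coprime_multiple: assumes "x \<in> carrier R" "0 < j" "j < p" shows "w ([(j::nat)] \<cdot> x) = w x"
proof -
  have "coprime j p" using p_prime assms by (metis coprime_commute nat_dvd_not_less prime_imp_coprime_nat)
  then have "coprime p j" by (simp add: coprime_commute)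
  then obtain a b where ab: "b * j = a * p + 1"
    using bezout_nat[of j p] assms(2) \<open>coprime j p\<close> by (metis coprime_imp_gcd_eq_1 less_not_refl2 mult.commute)
  define u where "u = [j] \<cdot> \<one>"
  have uR: "u \<in> carrier R" "0 \<le> w u" unfolding u_def using w_add_pow_ge[of \<one> j] by auto
  have "[b] \<cdot> u = [(b * j)] \<cdot> \<one>" unfolding u_def by (simp add: add.nat_pow_pow mult.commute)
  also have "\<dots> = [(a * p)] \<cdot> \<one> \<oplus> \<one>" unfolding ab by simp
  finally have bu: "[b] \<cdot> u = \<one> \<oplus> [(a * p)] \<cdot> \<one>" by (simp add: a_comm)
  have "w ([b] \<cdot> u) = 0"
    unfolding bu using w_add_eq[of \<one> "[(a * p)] \<cdot> \<one>"] w_multiple_of_p[of \<one> "a * p"] by simp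
  moreover have "[b] \<cdot> u = [b] \<cdot> \<one> \<otimes> u" using uR by (simp add: add_pow_ldistr)
  moreover have "0 \<le> w ([b] \<cdot> \<one>)" using w_add_pow_ge[of \<one> b] by simp
  ultimately have "w u = 0" using vmax_mult[of "[b] \<cdot> \<one>" u] uR by fastforce
  moreover have "[j] \<cdot> x = u \<otimes> x" unfolding u_def using assms(1) by (simp add: add_pow_ldistr)
  ultimately show ?thesis using w_mult_unit[of u x] uR assms(1) by simp
qed

lemma frobenius_add:
  assumes x: "x \<in> carrier R" "0 \<le> w x" and y: "y \<in> carrier R" "0 \<le> w y"
  shows "0 < w ((x \<oplus> y) [^] p \<ominus> (x [^] p \<oplus> y [^] p))"
proof -
  \<comment> \<open>Writing p = m + 2 lets the two end terms k = p and k = 0 be split off; the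
    binomial coefficients with 0 < k < p that remain are divisible by p.\<close>
  obtain m where m: "p = Suc (Suc m)" using prime_ge_2_nat[OF p_prime] by (metis Suc_diff_Suc Suc_1 Suc_le_lessD diff_Suc_1 le_add_diff_inverse numeral_2_eq_2 plus_1_eq_Suc add_Suc)
  define f where "f k = [(p choose k)] \<cdot> (x [^] k \<otimes> y [^] (p - k))" for k
  have C: "f k \<in> carrier R" for k unfolding f_def using x y by auto
  have "(x \<oplus> y) [^] p = (\<Oplus>k\<in>{..Suc (Suc m)}. f k)" unfolding f_def binomial[OF x(1) y(1)] m ..
  also have "\<dots> = f (Suc (Suc m)) \<oplus> (\<Oplus>k\<in>{..Suc m}. f k)" using C by (intro finsum_Suc) auto
  also have "(\<Oplus>k\<in>{..Suc m}. f k) = (\<Oplus>k\<in>{..m}. f (Suc k)) \<oplus> f 0" using C by (intro finsum_Suc2) auto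
  finally have e: "(x \<oplus> y) [^] p = f p \<oplus> ((\<Oplus>k\<in>{..m}. f (Suc k)) \<oplus> f 0)" by (simp add: m)
  define t where "t = (\<Oplus>k\<in>{..m}. f (Suc k))"
  have tR: "t \<in> carrier R" unfolding t_def using C by (intro finsum_closed) auto
  have fp: "f p = x [^] p" "f 0 = y [^] p" unfolding f_def using x y by auto
  have "(x \<oplus> y) [^] p \<ominus> (x [^] p \<oplus> y [^] p) = t"
  proof -
    have "x [^] p \<in> carrier R" "y [^] p \<in> carrier R" using x y by auto
    then show ?thesis unfolding e t_def[symmetric] fp using tR by algebra
  qed
  moreover have "ereal 0 < w t" unfolding t_def
  proof (rule w_finsum_gt)
    fix k assume "k \<in> {..m}"
    then have "p dvd (p choose Suc k)" using p_prime by (intro dvd_choose_prime) (auto simp: m)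
    moreover have "x [^] Suc k \<otimes> y [^] (p - Suc k) \<in> vring w (carrier R)"
      using subring_pow[OF vring_subring[OF carrier_is_subfield]] subringE(6)[OF vring_subring[OF carrier_is_subfield]] x y
      by (simp add: vring_def del: nat_pow_Suc)
    ultimately show "ereal 0 < w (f (Suc k))" unfolding f_def
      using w_multiple_of_p[of "x [^] Suc k \<otimes> y [^] (p - Suc k)"] by (simp add: vring_def zero_ereal_def del: nat_pow_Suc)
  qed (rule C)
  ultimately show ?thesis by (simp add: zero_ereal_def)
qed

text \<open>With d = x - y, additivity of the p-th power modulo the maximal ideal makes d^p
  congruent to x^p - y^p, so d^p and therefore d lies in that ideal.\<close>

lemma frobenius_inj:
  assumes x: "x \<in> carrier R" "0 \<le> w x" and y: "y \<in> carrier R" "0 \<le> w y"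
    and "0 < w (x [^] (p ^ m) \<ominus> y [^] (p ^ m))"
  shows "0 < w (x \<ominus> y)"
  using assms
proof (induction m arbitrary: x y)
  case 0
  then show ?case by simp
next
  case (Suc m)
  note V = vring_subring[OF carrier_is_subfield]
  have xp: "x [^] p \<in> carrier R" "0 \<le> w (x [^] p)" "y [^] p \<in> carrier R" "0 \<le> w (y [^] p)"
    using subring_pow[OF V, of x p] subring_pow[OF V, of y p] Suc.prems by (auto simp: vring_def)
  have "0 < w ((x [^] p) [^] (p ^ m) \<ominus> (y [^] p) [^] (p ^ m))"
    using Suc.prems by (simp add: nat_pow_pow)
  then have 1: "0 < w (x [^] p \<ominus> y [^] p)" using Suc.IH xp by blast
  define d where "d = x \<ominus> y"
  have d: "d \<in> carrier R" "0 \<le> w d" unfolding d_def using Suc.prems w_minus_ge[of x y 0] by auto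
  have "d \<oplus> y = x" unfolding d_def using Suc.prems(1,3) by algebra
  then have 2: "0 < w (x [^] p \<ominus> (d [^] p \<oplus> y [^] p))" using frobenius_add[OF d Suc.prems(3,4)] by simp
  have "d [^] p = (x [^] p \<ominus> y [^] p) \<ominus> (x [^] p \<ominus> (d [^] p \<oplus> y [^] p))" 
  proof -
    have "d [^] p \<in> carrier R" using d by simp
    then show ?thesis using xp by algebra
  qed
  then have dp: "0 < w (d [^] p)" using w_minus_gt[of "x [^] p \<ominus> y [^] p" "x [^] p \<ominus> (d [^] p \<oplus> y [^] p)" 0] 1 2 xp d by simp
  have "w d \<noteq> 0"
  proof
    assume "w d = 0"
    then have "w (d [^] p) = 0" using w_pow[of d 0 p] d(1) by (cases "d = \<zero>") (auto simp: zero_ereal_def)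
    then show False using dp by simp
  qed
  then show ?case using d(2) unfolding d_def by simp
qed

end

section \<open>The maximal unramified subextension\<close>

context galois_valued
begin

lemma E_closed:
  "\<zero> \<in> E" "\<one> \<in> E" "x \<in> E \<Longrightarrow> \<ominus> x \<in> E" "x \<in> E \<Longrightarrow> y \<in> E \<Longrightarrow> x \<otimes> y \<in> E"
  "x \<in> E \<Longrightarrow> y \<in> E \<Longrightarrow> x \<oplus> y \<in> E" "x \<in> E \<Longrightarrow> y \<in> E \<Longrightarrow> x \<ominus> y \<in> E" "x \<in> E \<Longrightarrow> x \<in> L" "x \<in> E \<Longrightarrow> x \<in> carrier R"
  using subringE[OF subfieldE(1)[OF E_subfield]] E_L by (auto simp: a_minus_def)

lemma OE_closed: "x \<in> vring w E \<Longrightarrow> x \<in> O\<^sub>L"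
  using E_L by (auto simp: vring_def)

lemma endo_polyf:
  assumes M: "subfield M R" and s: "s \<in> endo M" and c: "\<And>j. c j \<in> M" "\<And>j. s (c j) = c j" and y: "y \<in> M"
  shows "s (polyf c n y) = polyf c n (s y) \<and> polyf c n y \<in> M"
proof (induction n)
  case 0
  then show ?case using endo_zero[OF M s] subringE(2)[OF subfieldE(1)[OF M]] by simp
next
  case (Suc n)
  note Ms = subringE[OF subfieldE(1)[OF M]]
  have yn: "y [^] n \<in> M" using subring_pow[OF subfieldE(1)[OF M] y] .
  have "s (c n \<otimes> y [^] n) = c n \<otimes> s y [^] n"
    using endoD(2)[OF s c(1)[of n] yn] c(2)[of n] endo_pow[OF M s y] by simp
  moreover have "c n \<otimes> y [^] n \<in> M" using Ms(6) c(1) yn by simp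
  ultimately show ?case using Suc endoD(3)[OF s, of "polyf c n y" "c n \<otimes> y [^] n"] Ms(7) by simp
qed

text \<open>If s acts nontrivially on O_M, choose z there with w (s z - z) minimal. For f over O_K
  with f(z) in the maximal ideal and f'(z) a unit, w (s f(z) - f(z)) is the same minimum. But f(z) =
  k v with k in K of positive valuation and v in O_M, so this valuation exceeds the minimum. No
  exact root is needed.\<close>

lemma unramified_subset_E:
  assumes M: "subfield M R" "M \<subseteq> L"
    and val: "\<And>x. x \<in> M \<Longrightarrow> x \<noteq> \<zero> \<Longrightarrow> \<exists>k\<in>K. w k = w x"
    and sep: "\<And>x. x \<in> vring w M \<Longrightarrow> \<exists>c n. (\<forall>j. c j \<in> vring w K) \<and> 0 < w (polyf c n x) \<and> w (dpolyf c n x) = 0"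
    and KM: "K \<subseteq> M"
  shows "M \<subseteq> E"
proof
  note Ms = subringE[OF subfieldE(1)[OF M(1)]]
  fix x assume x: "x \<in> M"
  have fix_int: "s y = y" if s: "s \<in> inertia" and y: "y \<in> vring w M" for s y
  proof -
    have sG: "s \<in> G" using inertiaD(1)[OF s] .
    have se: "s \<in> endo L" using G_endo[OF sG] .
    have MO: "vring w M \<subseteq> O\<^sub>L" using M(2) by (auto simp: vring_def)
    define A where "A = (\<lambda>y. s y \<ominus> y) ` vring w M"
    have "A \<subseteq> O\<^sub>L"
    proof
      fix a assume "a \<in> A"
      then obtain z where z: "z \<in> vring w M" "a = s z \<ominus> z" by (auto simp: A_def)
      then have "z \<in> O\<^sub>L" "s z \<in> O\<^sub>L" using MO O_closed[OF sG] by auto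
      then show "a \<in> O\<^sub>L" using z subringE(5,7)[OF vring_subring[OF KL(2)]] by (simp add: a_minus_def)
    qed
    moreover have "A \<noteq> {}" using y by (auto simp: A_def)
    ultimately obtain z where z: "z \<in> vring w M" "\<And>v. v \<in> vring w M \<Longrightarrow> w (s z \<ominus> z) \<le> w (s v \<ominus> v)"
      using min_value[of A] by (auto simp: A_def)
    have zO: "z \<in> O\<^sub>L" "s z \<in> O\<^sub>L" using z MO O_closed[OF sG] by auto
    have zL: "z \<in> L" "s z \<in> L" "z \<in> carrier R" "s z \<in> carrier R" "z \<in> M" using zO z L_carrier by (auto simp: vring_def)
    have "s z \<ominus> z = \<zero>"
    proof (rule ccontr)
      assume nz: "s z \<ominus> z \<noteq> \<zero>"
      obtain r where r: "w (s z \<ominus> z) = ereal r" using w_real[of "s z \<ominus> z"] nz zL by auto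
      obtain c n where c: "\<And>j. c j \<in> vring w K" "0 < w (polyf c n z)" "w (dpolyf c n z) = 0" using sep[OF z(1)] by blast
      have cR: "c j \<in> vring w (carrier R)" for j using c(1)[of j] K_carrier by (auto simp: vring_def)
      have cK: "c j \<in> L" "s (c j) = c j" for j
        using c(1)[of j] KL(3) sG gal_iff[OF KL(2,3), of s] by (auto simp: vring_def)
      define f where "f = polyf c n z"
      have fM: "f \<in> M" unfolding f_def using polyf_in_subring(1)[OF subfieldE(1)[OF M(1)], of n c z] c(1) KM zL by (auto simp: vring_def)
      have fL: "f \<in> L" "f \<in> carrier R" using fM M(2) L_carrier by auto
      have sf: "s f = polyf c n (s z)" unfolding f_def using endo_polyf[OF KL(2) se cK zL(1)] by simp
      have "w (polyf c n (s z) \<ominus> f) = ereal r"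
        using w_polyf_diff(3)[of n c z "s z"] cR zO zL c(3) inertiaD(2)[OF s zO(1)] r
        unfolding f_def by (auto simp: vring_def)
      then have wf: "w (s f \<ominus> f) = ereal r" unfolding sf .
      have "f \<noteq> \<zero>"
      proof
        assume "f = \<zero>"
        then have "s f \<ominus> f = \<zero>" using endo_zero[OF KL(2) se] by (simp add: a_minus_def)
        then show False using wf by simp
      qed
      then obtain k where k: "k \<in> K" "w k = w f" using val fM by blast
      have k0: "k \<noteq> \<zero>" using k w_inf[of f] fL \<open>f \<noteq> \<zero>\<close> by auto
      have kR: "k \<in> carrier R" "k \<in> L" "k \<in> M" using k KL(3) K_carrier KM by auto
      have ik: "inv k \<in> M" "inv k \<in> carrier R" "k \<otimes> inv k = \<one>" using subfield_inv[OF M(1) kR(3) k0] field_Units kR k0 by auto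
      define v where "v = inv k \<otimes> f"
      have vM: "v \<in> M" "v \<in> carrier R" "v \<in> L" unfolding v_def using ik fM fL Ms(6) M(2) by auto
      have "0 \<le> w v" unfolding v_def using w_divide_ge[OF fL(2) kR(1) k0] k(2) by simp
      then have v: "v \<in> vring w M" using vM by (simp add: vring_def)
      have kv: "k \<otimes> v = f" unfolding v_def using m_assoc[of k "inv k" f] ik kR fL by simp
      have sk: "s k = k" using k(1) sG gal_iff[OF KL(2,3), of s] by auto
      have sv: "s v \<in> carrier R" using G_closed[OF sG vM(3)] L_carrier by auto
      have "s f = k \<otimes> s v" using endoD(2)[OF se kR(2) vM(3)] kv sk by simp
      then have "s f \<ominus> f = k \<otimes> (s v \<ominus> v)" unfolding kv[symmetric] using kR(1) sv vM(2) by algebra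
      moreover have "ereal r < w (k \<otimes> (s v \<ominus> v))"
        using w_mult_gt'[of k "s v \<ominus> v" r] kR(1) sv vM(2) k(2) c(2) z(2)[OF v] r by (simp add: f_def)
      ultimately show False using wf by simp
    qed
    then have "w (s z \<ominus> z) = \<infinity>" by simp
    then have "w (s y \<ominus> y) = \<infinity>" using z(2)[OF y] by simp
    moreover have "y \<in> carrier R" "s y \<in> carrier R" using y MO O_closed[OF sG, of y] L_carrier by (auto simp: vring_def)
    ultimately show ?thesis using w_inf[of "s y \<ominus> y"] by simp
  qed
  have "s x = x" if s: "s \<in> inertia" for s
  proof (cases "0 \<le> w x")
    case True
    then show ?thesis using fix_int[OF s] x by (simp add: vring_def)
  next
    case False
    then have x0: "x \<noteq> \<zero>" by auto
    have xL: "x \<in> L" "x \<in> carrier R" using x M(2) L_carrier by auto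
    have se: "s \<in> endo L" using G_endo[OF inertiaD(1)[OF s]] .
    have "w (inv x) = - w x" using w_inv[OF xL(2) x0] .
    then have "inv x \<in> vring w M" using False subfield_inv[OF M(1) x x0] by (auto simp: vring_def)
    then have "s (inv x) = inv x" using fix_int[OF s] by simp
    then have "inv (s x) = inv x" using endo_inv[OF KL(2) se xL(1) x0] by simp
    moreover have "s x \<in> Units R" "x \<in> Units R" using endo_nonzero[OF KL(2) se xL(1) x0] endoD(1)[OF se xL(1)] L_carrier x0 xL field_Units by auto
    ultimately show ?thesis by (metis Units_inv_inv)
  qed
  then show "x \<in> E" using x M(2) by (auto simp: E_def fixed_def)
qed

text \<open>For an unramified field U, the intersection M of L and U satisfies the hypotheses of
  \<open>unramified_subset_E\<close>; the polynomials are lifted from the residue field of U, into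
  which O_M maps.\<close>

lemma L_K_ur_subset: "L \<inter> K_ur R w K \<subseteq> E"
proof
  fix x assume x: "x \<in> L \<inter> K_ur R w K"
  then obtain U where U: "unramified_fin R w K U" "x \<in> U" by (auto simp: K_ur_def)
  have UF: "subfield U R" "K \<subseteq> U" "w ` (U - {\<zero>}) = w ` (K - {\<zero>})" "separable_ext (rf U) (res_img R w K U)"
    using U(1) by (auto simp: unramified_fin_def)
  define M where "M = L \<inter> U"
  have M: "subfield M R"
  proof (rule subfieldI')
    show "subring M R" unfolding M_def using subring_inter[OF subfieldE(1)[OF KL(2)] subfieldE(1)[OF UF(1)]] .
    show "inv k \<in> M" if "k \<in> M - {\<zero>}" for k
      using that subfield_inv[OF KL(2)] subfield_inv[OF UF(1)] by (auto simp: M_def)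
  qed
  have "M \<subseteq> E"
  proof (rule unramified_subset_E[OF M])
    show "M \<subseteq> L" "K \<subseteq> M" using KL(3) UF(2) by (auto simp: M_def)
    fix y assume "y \<in> M" "y \<noteq> \<zero>"
    then have "w y \<in> w ` (U - {\<zero>})" by (auto simp: M_def)
    then show "\<exists>k\<in>K. w k = w y" unfolding UF(3) by force
  next
    fix y assume "y \<in> vring w M"
    then have "y \<in> vring w U" by (auto simp: M_def vring_def)
    then show "\<exists>c n. (\<forall>j. c j \<in> vring w K) \<and> 0 < w (polyf c n y) \<and> w (dpolyf c n y) = 0"
      using separable_lift[OF UF(1) KL(1) UF(2,4)] by simp
  qed
  then show "x \<in> E" using x U(2) by (auto simp: M_def)
qed

text \<open>Conjugating t by s stays in inertia, by \<open>inertia_conj\<close>, so t fixes s x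
  whenever inertia fixes x.\<close>

lemma E_stable:
  assumes s: "s \<in> G" and x: "x \<in> E" shows "s x \<in> E"
proof -
  obtain u where u: "u \<in> G" "\<forall>x\<in>L. s (u x) = x \<and> u (s x) = x"
    using automorphisms_inverse[OF KL(2) G_automorphisms s] by blast
  have xL: "x \<in> L" using x E_L by auto
  have sx: "s x \<in> L" using G_closed[OF s xL] .
  have "t (s x) = s x" if t: "t \<in> inertia" for t
  proof -
    have tG: "t \<in> G" using inertiaD(1)[OF t] .
    define v where "v = compose L u (compose L t s)"
    have vG: "v \<in> G" unfolding v_def using automorphismsD(5)[OF G_automorphisms] u(1) tG s by auto
    have vx: "v y = u (t (s y))" if "y \<in> L" for y using that by (simp add: v_def compose_def)
    have "0 < w (v y \<ominus> y)" if y: "y \<in> O\<^sub>L" for y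
      using inertia_conj[OF u(1) t s _ y] u(2) vx[of y] y by (auto simp: vring_def)
    then have "v \<in> inertia" using vG by (simp add: inertia_def)
    then have "v x = x" using E_fixed x by simp
    then have "s (u (t (s x))) = s x" using vx[OF xL] by simp
    then show ?thesis using u(2) G_closed[OF tG sx] by simp
  qed
  then show ?thesis using sx by (auto simp: E_def fixed_def)
qed

section \<open>The action of the Galois group on E and on its residue field\<close>

definition GE :: "('a \<Rightarrow> 'a) set" where "GE = (\<lambda>s. restrict s E) ` G"

lemma GE_automorphisms: "automorphisms E GE" and GE_fixed: "fixed E GE = K"
proof -
  note r = automorphisms_restrict[OF KL(2) G_automorphisms E_subfield E_L]
  show "automorphisms E GE" unfolding GE_def by (rule r(1)) (rule E_stable)
  have "fixed E GE = fixed L G \<inter> E" unfolding GE_def by (rule r(2)) (rule E_stable)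
  then show "fixed E GE = K" using G_fixed K_E by auto
qed

lemma GE_closed: "s \<in> GE \<Longrightarrow> x \<in> E \<Longrightarrow> s x \<in> E" "s \<in> GE \<Longrightarrow> x \<in> E \<Longrightarrow> w (s x) = w x"
  using E_stable G_inv E_L by (auto simp: GE_def)

text \<open>If a and b agreed on k_E, the inverse of a composed with b would act trivially on k_E,
  hence on k_L; it would lie in inertia and fix E, so a and b would agree on E.\<close>

lemma GE_distinct:
  assumes "s \<in> GE" "t \<in> GE" "s \<noteq> t"
  shows "\<exists>x\<in>vring w E. \<not> 0 < w (s x \<ominus> t x)"
proof (rule ccontr)
  assume "\<not> ?thesis"
  then have close: "0 < w (s x \<ominus> t x)" if "x \<in> vring w E" for x using that by blast
  obtain a b where a: "a \<in> G" "s = restrict a E" and b: "b \<in> G" "t = restrict b E" using assms by (auto simp: GE_def)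
  obtain u where u: "u \<in> G" "\<forall>x\<in>L. a (u x) = x \<and> u (a x) = x"
    using automorphisms_inverse[OF KL(2) G_automorphisms a(1)] by blast
  define v where "v = compose L u b"
  have vG: "v \<in> G" unfolding v_def using automorphismsD(5)[OF G_automorphisms] u(1) b by auto
  have vx: "v y = u (b y)" if "y \<in> L" for y using that by (simp add: v_def compose_def)
  have vE: "0 < w (v x \<ominus> x)" if x: "x \<in> vring w E" for x
  proof -
    have xL: "x \<in> L" "x \<in> E" using x E_L by (auto simp: vring_def)
    have ab: "a x \<in> L" "b x \<in> L" using G_closed a b xL by auto
    have "0 < w (a x \<ominus> b x)" using close[OF x] a b xL by simp
    then have "0 < w (b x \<ominus> a x)" using w_minus_commute[OF L_closed(8)[OF ab(1)] L_closed(8)[OF ab(2)]] by simp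
    also have "w (b x \<ominus> a x) = w (u (b x \<ominus> a x))" using G_inv[OF u(1) L_closed(6)[OF ab(2,1)]] by simp
    also have "u (b x \<ominus> a x) = v x \<ominus> x" using endo_minus[OF KL(2) G_endo[OF u(1)] ab(2,1)] u(2) vx xL by simp
    finally show ?thesis .
  qed
  \<comment> \<open>\<open>k\<^sub>L/k\<^sub>E\<close> is purely inseparable, so acting trivially on \<open>k\<^sub>E\<close> forces acting trivially on \<open>k\<^sub>L\<close>\<close>
  have "0 < w (v y \<ominus> y)" if y: "y \<in> O\<^sub>L" for y
  proof -
    obtain m e where e: "e \<in> vring w E" "0 < w (y [^] (p ^ m) \<ominus> e)" using residue_purely_inseparable[OF y] by blast
    have yL: "y \<in> L" "y \<in> carrier R" "0 \<le> w y" using y L_carrier by (auto simp: vring_def)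
    have eL: "e \<in> L" "e \<in> carrier R" using OE_closed[OF e(1)] L_carrier by (auto simp: vring_def)
    have ypL: "y [^] (p ^ m) \<in> L" "y [^] (p ^ m) \<in> carrier R" using L_closed(7)[OF yL(1)] L_carrier by auto
    have vy: "v y \<in> L" "v y \<in> carrier R" "0 \<le> w (v y)" using G_closed[OF vG yL(1)] G_inv[OF vG yL(1)] yL L_carrier by auto
    have ve: "v e \<in> carrier R" using G_closed[OF vG eL(1)] L_carrier by auto
    have "v (y [^] (p ^ m) \<ominus> e) = v y [^] (p ^ m) \<ominus> v e"
      using endo_minus[OF KL(2) G_endo[OF vG] ypL(1) eL(1)] endo_pow[OF KL(2) G_endo[OF vG] yL(1)] by simp
    then have "0 < w (v y [^] (p ^ m) \<ominus> v e)" using G_inv[OF vG L_closed(6)[OF ypL(1) eL(1)]] e(2) by simp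
    then have "0 < w (v y [^] (p ^ m) \<ominus> e)" using cong_trans[of "v y [^] (p ^ m)" "v e" e 0] vE[OF e(1)] vy ve eL by simp
    then have "0 < w (v y [^] (p ^ m) \<ominus> y [^] (p ^ m))"
      using cong_trans[of "v y [^] (p ^ m)" e "y [^] (p ^ m)" 0] vy eL ypL e(2) w_minus_commute[of e "y [^] (p ^ m)"] by simp
    then show ?thesis using frobenius_inj[OF vy(2,3) yL(2,3)] by simp
  qed
  then have "v \<in> inertia" using vG by (simp add: inertia_def)
  then have "v x = x" if "x \<in> E" for x using E_fixed that by simp
  then have "b x = a x" if "x \<in> E" for x
  proof -
    have xL: "x \<in> L" using that E_L by auto
    have "u (b x) = x" using vx[OF xL] \<open>\<And>x. x \<in> E \<Longrightarrow> v x = x\<close>[OF that] by simp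
    then have "a (u (b x)) = a x" by simp
    then show ?thesis using u(2) G_closed[OF b(1) xL] by simp
  qed
  then have "s = t" unfolding a b by (intro restrict_ext) auto
  then show False using assms by simp
qed

text \<open>Independence of the distinct characters that GE induces on k_E, with the maximal ideal
  of O_E as P: if no sum were a unit, all coefficients would lie in that ideal.\<close>

lemma GE_independence:
  assumes c: "\<And>s. s \<in> GE \<Longrightarrow> c s \<in> vring w E" and u: "u \<in> GE" "w (c u) = 0"
  shows "\<exists>z\<in>vring w E. w (\<Oplus>s\<in>GE. c s \<otimes> s z) = 0"
proof (rule ccontr)
  assume neg: "\<not> ?thesis"
  note V = vring_subring[OF E_subfield]
  note Vs = subringE[OF V]
  have sV: "s x \<in> vring w E" if "s \<in> GE" "x \<in> vring w E" for s x
    using GE_closed[OF that(1), of x] that(2) by (simp add: vring_def)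
  have in_P: "x \<in> vmax w E \<longleftrightarrow> x \<in> E \<and> 0 < w x" for x by (simp add: vmax_def)
  have "\<forall>s\<in>GE. c s \<in> vmax w E"
  proof (rule independence_mod_prime[OF V, of _ "vring w E"])
    show "vmax w E \<subseteq> vring w E" by (auto simp: vmax_def vring_def)
    show "\<zero> \<in> vmax w E" "\<one> \<notin> vmax w E" using E_closed by (auto simp: vmax_def)
    show "a \<ominus> b \<in> vmax w E" if "a \<in> vmax w E" "b \<in> vmax w E" for a b
      using that E_closed(6,8) w_minus_gt[of a b 0] by (auto simp: vmax_def)
    show "a \<otimes> b \<in> vmax w E" if "a \<in> vring w E" "b \<in> vmax w E" for a b
      using that E_closed(4,8) vmax_mult[of a b] by (auto simp: vmax_def vring_def)
    show "a \<in> vmax w E \<or> b \<in> vmax w E" if "a \<in> vring w E" "b \<in> vring w E" "a \<otimes> b \<in> vmax w E" for a b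
    proof (rule ccontr)
      assume "\<not> ?thesis"
      then have "w a = 0" "w b = 0" using that by (auto simp: vmax_def vring_def)
      then show False using that w_mult[of a b] E_closed(8) by (auto simp: vmax_def vring_def)
    qed
    show "\<one> \<in> vring w E" by (rule Vs(3))
    show "x \<otimes> y \<in> vring w E" if "x \<in> vring w E" "y \<in> vring w E" for x y by (rule Vs(6)[OF that])
    show "finite GE" by (rule automorphismsD(1)[OF GE_automorphisms])
    show "s x \<in> vring w E" if "s \<in> GE" "x \<in> vring w E" for s x by (rule sV[OF that])
    show "s \<one> = \<one>" if "s \<in> GE" for s by (rule endoD(4)[OF automorphismsD(2)[OF GE_automorphisms that]])
    show "s (x \<otimes> y) = s x \<otimes> s y" if "s \<in> GE" "x \<in> vring w E" "y \<in> vring w E" for s x y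
      using endoD(2)[OF automorphismsD(2)[OF GE_automorphisms that(1)]] that(2,3) by (simp add: vring_def)
    show "\<exists>x\<in>vring w E. s x \<ominus> t x \<notin> vmax w E" if "s \<in> GE" "t \<in> GE" "s \<noteq> t" for s t
      using GE_distinct[OF that] by (auto simp: vmax_def)
    show "c s \<in> vring w E" if "s \<in> GE" for s by (rule c[OF that])
    fix z assume z: "z \<in> vring w E"
    have "(\<Oplus>s\<in>GE. c s \<otimes> s z) \<in> vring w E"
      by (rule finsum_in_subring[OF V]) (rule Vs(6)[OF c sV[OF _ z]])
    then show "(\<Oplus>s\<in>GE. c s \<otimes> s z) \<in> vmax w E" using neg z by (auto simp: vring_def vmax_def)
  qed
  then show False using u by (auto simp: vmax_def)
qed

text \<open>The quotients s y / y are units, so some z makes the sum of the (s y / y) s z a unit;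
  then the trace of y z is y times a unit, and it lies in K.\<close>

lemma E_value_group: 
  assumes y: "y \<in> E" "y \<noteq> \<zero>" shows "\<exists>k\<in>K. k \<noteq> \<zero> \<and> w k = w y"
proof -
  note S = GE_automorphisms
  have yR: "y \<in> carrier R" using y E_closed by auto
  have iy: "inv y \<in> E" "inv y \<in> carrier R" "y \<otimes> inv y = \<one>" "w (inv y) = - w y"
    using subfield_inv[OF E_subfield y] field_Units w_inv[OF yR y(2)] yR y(2) by auto
  obtain r where r: "w y = ereal r" using w_real yR y(2) by metis
  define c where "c s = inv y \<otimes> s y" for s
  have sy: "s y \<in> E" "s y \<in> carrier R" "w (s y) = w y" if "s \<in> GE" for s using GE_closed[OF that y(1)] E_closed by auto
  have wc: "w (c s) = 0" if "s \<in> GE" for s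
    unfolding c_def using w_mult[OF iy(2) sy(2)[OF that]] sy(3)[OF that] iy(4) r by (simp add: zero_ereal_def)
  have cV: "c s \<in> vring w E" if "s \<in> GE" for s using wc[OF that] sy(1)[OF that] iy(1) E_closed(4) by (simp add: c_def vring_def)
  obtain z where z: "z \<in> vring w E" "w (\<Oplus>s\<in>GE. c s \<otimes> s z) = 0"
    using GE_independence[of c, OF cV automorphismsD(4)[OF S] wc[OF automorphismsD(4)[OF S]]] by blast
  have zE: "z \<in> E" "y \<otimes> z \<in> E" using z y E_closed(4) by (auto simp: vring_def)
  have sz: "s z \<in> carrier R" "c s \<in> carrier R" if "s \<in> GE" for s
    using E_closed(8)[OF GE_closed(1)[OF that zE(1)]] E_closed(8)[OF vringD(1)[OF cV[OF that]]] by simp_all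
  define t where "t = (\<Oplus>s\<in>GE. s (y \<otimes> z))"
  have tK: "t \<in> K" unfolding t_def using trace_fixed[OF E_subfield S zE(2)] GE_fixed by simp
  have "t = (\<Oplus>s\<in>GE. y \<otimes> (c s \<otimes> s z))" unfolding t_def
  proof (intro finsum_cong')
    show "(\<lambda>s. y \<otimes> (c s \<otimes> s z)) \<in> GE \<rightarrow> carrier R" using sz yR by auto
    fix s assume s: "s \<in> GE"
    have "s (y \<otimes> z) = s y \<otimes> s z" using endoD(2)[OF automorphismsD(2)[OF S s] y(1) zE(1)] .
    moreover have "y \<otimes> (c s \<otimes> s z) = (y \<otimes> inv y) \<otimes> (s y \<otimes> s z)"
      unfolding c_def using yR iy(2) sy(2)[OF s] sz(1)[OF s] by algebra
    ultimately show "s (y \<otimes> z) = y \<otimes> (c s \<otimes> s z)" using iy(3) sy(2)[OF s] sz(1)[OF s] by simp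
  qed simp
  also have "\<dots> = y \<otimes> (\<Oplus>s\<in>GE. c s \<otimes> s z)"
    using sz yR automorphismsD(1)[OF S] by (intro finsum_rdistr[symmetric]) auto
  finally have "w t = w y" using w_mult[OF yR, of "\<Oplus>s\<in>GE. c s \<otimes> s z"] z(2) sz by (simp add: Pi_iff)
  moreover have "t \<noteq> \<zero>" using calculation r by auto
  ultimately show ?thesis using tK by blast
qed

text \<open>With z of unit trace t, the weighted average Tr(z x)/t lies in K and is congruent to x,
  because every s x is.\<close>

lemma E_residue_fixed:
  assumes x: "x \<in> vring w E" and fx: "\<And>s. s \<in> GE \<Longrightarrow> 0 < w (s x \<ominus> x)"
  shows "\<exists>b\<in>vring w K. 0 < w (x \<ominus> b)"
proof -
  note S = GE_automorphisms
  have xE: "x \<in> E" "x \<in> carrier R" "0 \<le> w x" using x E_closed by (auto simp: vring_def)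
  obtain z where z: "z \<in> vring w E" "w (\<Oplus>s\<in>GE. \<one> \<otimes> s z) = 0"
    using GE_independence[of "\<lambda>_. \<one>", OF subringE(3)[OF vring_subring[OF E_subfield]] automorphismsD(4)[OF S] w_one] by blast
  have zE: "z \<in> E" "z \<otimes> x \<in> E" "0 \<le> w z" using z xE E_closed(4) by (auto simp: vring_def)
  have sz: "s z \<in> carrier R" "s x \<in> carrier R" "w (s z) = w z" if "s \<in> GE" for s
    using E_closed(8)[OF GE_closed(1)[OF that zE(1)]] E_closed(8)[OF GE_closed(1)[OF that xE(1)]] GE_closed(2)[OF that zE(1)] by simp_all
  define t where "t = (\<Oplus>s\<in>GE. s z)"
  have tz: "(\<Oplus>s\<in>GE. \<one> \<otimes> s z) = t" unfolding t_def using sz by (intro finsum_cong') auto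
  have wt: "w t = 0" using z(2) tz by simp
  then have t0: "t \<noteq> \<zero>" by auto
  have tK: "t \<in> K" "t \<in> carrier R" unfolding t_def using trace_fixed[OF E_subfield S zE(1)] GE_fixed K_carrier by auto
  have it: "inv t \<in> K" "inv t \<in> carrier R" "inv t \<otimes> t = \<one>" "w (inv t) = 0"
    using subfield_inv[OF KL(1) tK(1) t0] field_Units tK t0 w_inv[OF tK(2) t0] wt by auto
  define v where "v = (\<Oplus>s\<in>GE. s (z \<otimes> x))"
  have vK: "v \<in> K" "v \<in> carrier R" unfolding v_def using trace_fixed[OF E_subfield S zE(2)] GE_fixed K_carrier by auto
  have "v = (\<Oplus>s\<in>GE. s z \<otimes> (s x \<ominus> x) \<oplus> s z \<otimes> x)"
    unfolding v_def
  proof (intro finsum_cong')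
    show "(\<lambda>s. s z \<otimes> (s x \<ominus> x) \<oplus> s z \<otimes> x) \<in> GE \<rightarrow> carrier R" using sz xE by auto
    fix s assume s: "s \<in> GE"
    show "s (z \<otimes> x) = s z \<otimes> (s x \<ominus> x) \<oplus> s z \<otimes> x"
      using endoD(2)[OF automorphismsD(2)[OF S s] zE(1) xE(1)] sz[OF s] xE(2) by simp algebra
  qed simp
  also have "\<dots> = (\<Oplus>s\<in>GE. s z \<otimes> (s x \<ominus> x)) \<oplus> (\<Oplus>s\<in>GE. s z \<otimes> x)"
    using sz xE by (intro finsum_addf) auto
  also have "(\<Oplus>s\<in>GE. s z \<otimes> x) = t \<otimes> x"
    unfolding t_def using sz xE automorphismsD(1)[OF S] by (intro finsum_ldistr[symmetric]) auto
  finally have v: "v = (\<Oplus>s\<in>GE. s z \<otimes> (s x \<ominus> x)) \<oplus> t \<otimes> x" .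
  define q where "q = (\<Oplus>s\<in>GE. s z \<otimes> (s x \<ominus> x))"
  have qR: "q \<in> carrier R" unfolding q_def using sz xE by (intro finsum_closed) auto
  have "ereal 0 < w q" unfolding q_def
  proof (rule w_finsum_gt)
    fix s assume s: "s \<in> GE"
    show "s z \<otimes> (s x \<ominus> x) \<in> carrier R" using sz[OF s] xE by simp
    show "ereal 0 < w (s z \<otimes> (s x \<ominus> x))"
      using vmax_mult[of "s z" "s x \<ominus> x"] sz[OF s] zE(3) fx[OF s] xE by (simp add: zero_ereal_def)
  qed
  then have wq: "0 < w q" by (simp add: zero_ereal_def)
  define b where "b = inv t \<otimes> v"
  have bK: "b \<in> K" "b \<in> carrier R" unfolding b_def using it vK subringE(6)[OF subfieldE(1)[OF KL(1)]] K_carrier by auto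
  have "b = inv t \<otimes> q \<oplus> inv t \<otimes> t \<otimes> x" unfolding b_def v q_def[symmetric] using it(2) qR tK(2) xE(2) by algebra
  then have "b \<ominus> x = inv t \<otimes> q" using it qR xE(2) by (simp add: a_minus_def a_assoc r_neg)
  then have bx: "0 < w (b \<ominus> x)" using w_mult_unit[OF it(2) qR it(4)] wq by simp
  then have xb: "0 < w (x \<ominus> b)" using w_minus_commute[OF xE(2) bK(2)] by simp
  then show ?thesis using bK cong_nonneg[OF xE(2) bK(2) xE(3)] by (intro bexI[of _ b]) (auto simp: vring_def)
qed

text \<open>\<open>separable_extI\<close> for the induced action on cosets: orbits are images of the
  finite GE, and by \<open>E_residue_fixed\<close> an invariant class is represented in K.\<close>

lemma E_residue_separable: "separable_ext (rf E) (res_img R w K E)"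
proof -
  note S = GE_automorphisms and V = vring_subring[OF E_subfield]
  note Vs = subringE[OF V]
  interpret Q: field "rf E" using rf_field[OF E_subfield] .
  note cls = cl_simps[OF E_subfield] and rfc = rf_carrier[OF E_subfield]
  have sV: "s x \<in> vring w E" if "s \<in> GE" "x \<in> vring w E" for s x
    using GE_closed[OF that(1), of x] that(2) by (simp add: vring_def)
  \<comment> \<open>The induced map on residue classes is literally the image of the coset, because
    s and its inverse preserve the maximal ideal.\<close>
  have img: "s ` cl E x = cl E (s x)" if s: "s \<in> GE" and x: "x \<in> vring w E" for s x
  proof -
    have se: "s \<in> endo E" using automorphismsD(2)[OF S s] .
    have xE: "x \<in> E" using x by (simp add: vring_def)
    obtain u where u: "u \<in> GE" "\<forall>x\<in>E. s (u x) = x \<and> u (s x) = x" using automorphisms_inverse[OF E_subfield S s] by blast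
    have mem: "z \<in> cl E v \<longleftrightarrow> (\<exists>h\<in>vmax w E. z = h \<oplus> v)" for z v unfolding a_r_coset_def' by auto
    have m: "t h \<in> vmax w E" if "t \<in> GE" "h \<in> vmax w E" for t h
      using GE_closed[OF that(1), of h] that(2) by (simp add: vmax_def)
    show ?thesis
    proof
      show "s ` cl E x \<subseteq> cl E (s x)"
      proof
        fix z assume "z \<in> s ` cl E x"
        then obtain y where "y \<in> cl E x" "z = s y" by blast
        then obtain h where h: "h \<in> vmax w E" "z = s (h \<oplus> x)" using mem[of y x] by blast
        have "h \<in> E" using h by (simp add: vmax_def)
        then have "z = s h \<oplus> s x" using endoD(3)[OF se _ xE] h by simp
        then show "z \<in> cl E (s x)" using mem[of z "s x"] m[OF s h(1)] by blast
      qed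
      show "cl E (s x) \<subseteq> s ` cl E x"
      proof
        fix z assume "z \<in> cl E (s x)"
        then obtain h where h: "h \<in> vmax w E" "z = h \<oplus> s x" using mem[of z "s x"] by blast
        have uh: "u h \<in> vmax w E" "u h \<in> E" using m[OF u(1) h(1)] by (auto simp: vmax_def)
        have "s (u h \<oplus> x) = z" using endoD(3)[OF se uh(2) xE] u(2) h by (simp add: vmax_def)
        moreover have "u h \<oplus> x \<in> cl E x" using mem[of "u h \<oplus> x" x] uh(1) by blast
        ultimately show "z \<in> s ` cl E x" by blast
      qed
    qed
  qed
  show ?thesis
  proof (rule Q.separable_extI[where G = "(\<lambda>s. (`) s) ` GE"])
    show "subfield (res_img R w K E) (rf E)" using res_img_subfield[OF E_subfield KL(1) K_E] .
    fix g assume "g \<in> (\<lambda>s. (`) s) ` GE"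
    then obtain s where s: "s \<in> GE" "g = (`) s" by auto
    have se: "s \<in> endo E" using automorphismsD(2)[OF S s(1)] .
    show "g \<in> ring_hom (rf E) (rf E)"
    proof (rule ring_hom_memI)
      fix C assume "C \<in> carrier (rf E)"
      then obtain x where x: "x \<in> vring w E" "C = cl E x" using rfc by auto
      show "g C \<in> carrier (rf E)" unfolding s(2) x(2) img[OF s(1) x(1)] using cls(1)[OF sV[OF s(1) x(1)]] .
      fix D assume "D \<in> carrier (rf E)"
      then obtain y where y: "y \<in> vring w E" "D = cl E y" using rfc by auto
      have xy: "x \<in> E" "y \<in> E" using x y by (auto simp: vring_def)
      show "g (C \<otimes>\<^bsub>rf E\<^esub> D) = g C \<otimes>\<^bsub>rf E\<^esub> g D"
        unfolding s(2) x(2) y(2) cls(3)[OF x(1) y(1), symmetric] img[OF s(1) x(1)] img[OF s(1) y(1)] img[OF s(1) Vs(6)[OF x(1) y(1)]]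
          endoD(2)[OF se xy] using cls(3)[OF sV[OF s(1) x(1)] sV[OF s(1) y(1)]] .
      show "g (C \<oplus>\<^bsub>rf E\<^esub> D) = g C \<oplus>\<^bsub>rf E\<^esub> g D"
        unfolding s(2) x(2) y(2) cls(2)[OF x(1) y(1), symmetric] img[OF s(1) x(1)] img[OF s(1) y(1)] img[OF s(1) Vs(7)[OF x(1) y(1)]]
          endoD(3)[OF se xy] using cls(2)[OF sV[OF s(1) x(1)] sV[OF s(1) y(1)]] .
    next
      show "g \<one>\<^bsub>rf E\<^esub> = \<one>\<^bsub>rf E\<^esub>" unfolding s(2) cls(4)[symmetric] img[OF s(1) Vs(3)] endoD(4)[OF se] ..
    qed
  next
    fix C assume "C \<in> carrier (rf E)"
    then obtain x where x: "x \<in> vring w E" "C = cl E x" using rfc by auto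
    have xE: "x \<in> E" using x by (simp add: vring_def)
    define A where "A = (\<lambda>s. cl E (s x)) ` GE"
    show "\<exists>A. finite A \<and> C \<in> A \<and> A \<subseteq> carrier (rf E) \<and> (\<forall>s\<in>(\<lambda>s. (`) s) ` GE. s ` A = A)"
    proof (intro exI[of _ A] conjI ballI)
      show "finite A" unfolding A_def using automorphismsD(1)[OF S] by simp
      show "C \<in> A" unfolding A_def x(2) using automorphismsD(4)[OF S] xE by (intro image_eqI[of _ _ "\<lambda>x\<in>E. x"]) auto
      show "A \<subseteq> carrier (rf E)" unfolding A_def using cls(1)[OF sV[OF _ x(1)]] by auto
      fix g assume "g \<in> (\<lambda>s. (`) s) ` GE"
      then obtain t where t: "t \<in> GE" "g = (`) t" by auto
      have "g ` A = (\<lambda>s. t ` cl E (s x)) ` GE" unfolding A_def t(2) by auto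
      also have "\<dots> = (\<lambda>s. cl E (compose E t s x)) ` GE"
        using img[OF t(1) sV[OF _ x(1)]] xE by (intro image_cong) (auto simp: compose_def)
      also have "\<dots> = (\<lambda>s. cl E (s x)) ` (compose E t ` GE)" by auto
      finally show "g ` A = A" unfolding automorphisms_compose_bij(1)[OF E_subfield S t(1)] A_def .
    qed
  next
    fix C assume C: "C \<in> carrier (rf E)" "\<And>g. g \<in> (\<lambda>s. (`) s) ` GE \<Longrightarrow> g C = C"
    then obtain x where x: "x \<in> vring w E" "C = cl E x" using rfc by auto
    have "0 < w (s x \<ominus> x)" if s: "s \<in> GE" for s
    proof -
      have "s ` C = C" using C(2) s by blast
      then have "cl E (s x) = cl E x" unfolding x(2) img[OF s x(1)] .
      then show ?thesis using cl_eq_iff[OF E_subfield sV[OF s x(1)] x(1)] by simp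
    qed
    then obtain b where b: "b \<in> vring w K" "0 < w (x \<ominus> b)" using E_residue_fixed[OF x(1)] by blast
    have "b \<in> vring w E" using b(1) K_E by (auto simp: vring_def)
    then have "C = cl E b" unfolding x(2) using cl_eq_iff[OF E_subfield x(1)] b(2) by simp
    then show "C \<in> res_img R w K E" using b(1) unfolding res_img_def by blast
  qed
qed

theorem E_eq: "L \<inter> K_ur R w K = E"
proof
  show "L \<inter> K_ur R w K \<subseteq> E" by (rule L_K_ur_subset)
  have "unramified_fin R w K E"
    unfolding unramified_fin_def
  proof (intro conjI E_subfield K_E E_residue_separable)
    show "finite_dimension K E" using finite_dimension_intermediate[OF E_subfield K_E E_L] .
    show "w ` (E - {\<zero>}) = w ` (K - {\<zero>})"
    proof
      show "w ` (E - {\<zero>}) \<subseteq> w ` (K - {\<zero>})" 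
      proof
        fix a assume "a \<in> w ` (E - {\<zero>})"
        then obtain y where "y \<in> E" "y \<noteq> \<zero>" "a = w y" by blast
        then obtain k where "k \<in> K" "k \<noteq> \<zero>" "w k = a" using E_value_group[of y] by blast
        then show "a \<in> w ` (K - {\<zero>})" by blast
      qed
      show "w ` (K - {\<zero>}) \<subseteq> w ` (E - {\<zero>})" using K_E by auto
    qed
  qed
  then show "E \<subseteq> L \<inter> K_ur R w K" using E_L unfolding K_ur_def by blast
qed

end

section \<open>Residual independence of powers\<close>

context cring
begin

lemma polyf_zero: "x \<in> carrier R \<Longrightarrow> polyf (\<lambda>_. \<zero>) n x = \<zero>"
  by (induction n) auto

lemma polyf_append:
  assumes "\<And>j. c j \<in> carrier R" "x \<in> carrier R"
  shows "polyf c (m + n) x = polyf c m x \<oplus> x [^] m \<otimes> polyf (\<lambda>j. c (m + j)) n x"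
proof (induction n)
  case 0
  then show ?case using assms polyf_closed(1)[of m c x] by simp
next
  case (Suc n)
  have C: "polyf c m x \<in> carrier R" "polyf (\<lambda>j. c (m + j)) n x \<in> carrier R"
    using polyf_closed(1) assms by auto
  have "x [^] (m + n) = x [^] m \<otimes> x [^] n" using assms by (simp add: nat_pow_mult)
  then show ?case using Suc C assms by (simp add: r_distr a_assoc m_lcomm)
qed

lemma polyf_Suc_left:
  assumes "\<And>j. c j \<in> carrier R" "x \<in> carrier R"
  shows "polyf c (Suc n) x = c 0 \<oplus> x \<otimes> polyf (\<lambda>j. c (Suc j)) n x"
  using polyf_append[of c x 1 n] assms by simp

lemma polyf_truncate:
  assumes "\<And>j. c j \<in> carrier R" "x \<in> carrier R" "m \<le> n"
  shows "polyf (\<lambda>j. if j < m then c j else \<zero>) n x = polyf c m x"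
proof -
  let ?d = "\<lambda>j. if j < m then c j else \<zero>"
  have d: "\<And>j. ?d j \<in> carrier R" using assms by auto
  have "polyf ?d (m + (n - m)) x = polyf ?d m x \<oplus> x [^] m \<otimes> polyf (\<lambda>j. ?d (m + j)) (n - m) x"
    by (rule polyf_append[OF d assms(2)])
  moreover have "polyf (\<lambda>j. ?d (m + j)) (n - m) x = \<zero>" using polyf_zero[OF assms(2)] by simp
  moreover have "polyf ?d m x = polyf c m x" by (rule polyf_cong) auto
  ultimately show ?thesis using assms polyf_closed(1)[of m c x] by simp
qed

end

context field
begin

lemma exp_base_Suc: "exp_base x (Suc n) = x [^] n # exp_base x n"
  by (simp add: exp_base_def)

lemma Span_exp_base_polyf:
  assumes F: "subfield F R" and x: "x \<in> carrier R"
  shows "Span F (exp_base x n) = {polyf c n x | c. \<forall>j. c j \<in> F}"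
proof (induction n)
  case 0
  have "\<zero> \<in> F" using subringE(2)[OF subfieldE(1)[OF F]] .
  then show ?case by (auto simp: exp_base_def intro: exI[of _ "\<lambda>_. \<zero>"])
next
  case (Suc n)
  note FR = subfieldE(3)[OF F]
  have S: "Span F (exp_base x (Suc n)) = line_extension F (x [^] n) (Span F (exp_base x n))"
    by (simp add: exp_base_Suc)
  show ?case unfolding S Suc
  proof (intro equalityI subsetI)
    fix v assume "v \<in> line_extension F (x [^] n) {polyf c n x | c. \<forall>j. c j \<in> F}"
    then obtain k c where k: "k \<in> F" "\<forall>j. c j \<in> F" "v = k \<otimes> x [^] n \<oplus> polyf c n x"
      unfolding line_extension_mem_iff by blast
    have "polyf (c(n := k)) n x = polyf c n x" by (rule polyf_cong) auto
    moreover have "polyf c n x \<in> carrier R" using polyf_closed(1) k(2) FR x by blast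
    ultimately have "v = polyf (c(n := k)) (Suc n) x" using k FR x by (auto simp: a_comm subset_iff)
    moreover have "\<forall>j. (c(n := k)) j \<in> F" using k by simp
    ultimately show "v \<in> {polyf c (Suc n) x | c. \<forall>j. c j \<in> F}" by blast
  next
    fix v assume "v \<in> {polyf c (Suc n) x | c. \<forall>j. c j \<in> F}"
    then obtain c where c: "\<forall>j. c j \<in> F" "v = polyf c (Suc n) x" by blast
    have "polyf c n x \<in> carrier R" "c n \<in> carrier R" using polyf_closed(1) c(1) FR x by blast+
    then have "v = c n \<otimes> x [^] n \<oplus> polyf c n x" using c(2) x by (simp add: a_comm)
    then show "v \<in> line_extension F (x [^] n) {polyf c n x | c. \<forall>j. c j \<in> F}"
      unfolding line_extension_mem_iff using c(1) by blast
  qed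
qed

lemma independent_exp_base_polyf:
  assumes F: "subfield F R" and x: "x \<in> carrier R"
    and ind: "\<And>c j. (\<And>j. c j \<in> F) \<Longrightarrow> polyf c n x = \<zero> \<Longrightarrow> j < n \<Longrightarrow> c j = \<zero>"
  shows "independent F (exp_base x n)"
proof -
  note FR = subfieldE(3)[OF F] and Fs = subringE[OF subfieldE(1)[OF F]]
  have "m \<le> n \<Longrightarrow> independent F (exp_base x m)" for m
  proof (induction m)
    case 0
    then show ?case by (simp add: exp_base_def)
  next
    case (Suc m)
    show ?case unfolding exp_base_Suc
    proof (rule li_Cons)
      show "x [^] m \<in> carrier R" using x by simp
      show "independent F (exp_base x m)" using Suc by simp
      show "x [^] m \<notin> Span F (exp_base x m)"
      proof
        assume "x [^] m \<in> Span F (exp_base x m)"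
        then obtain c where c: "\<forall>j. c j \<in> F" "x [^] m = polyf c m x" unfolding Span_exp_base_polyf[OF F x] by blast
        \<comment> \<open>The relation expressing x^m by lower powers, written as a vanishing
          polynomial: -1 at position m, then zeros up to the n terms required by the
          hypothesis.\<close>
        define d where "d = (\<lambda>j. if j < Suc m then (c(m := \<ominus> \<one>)) j else \<zero>)"
        have dF: "d j \<in> F" for j using c(1) Fs by (auto simp: d_def)
        have "polyf d n x = polyf (c(m := \<ominus> \<one>)) (Suc m) x"
          unfolding d_def using c(1) FR Fs x Suc.prems by (intro polyf_truncate) (auto simp: subset_iff)
        also have "polyf (c(m := \<ominus> \<one>)) m x = polyf c m x" by (rule polyf_cong) auto
        then have "polyf (c(m := \<ominus> \<one>)) (Suc m) x = \<zero>" using c(2) x nat_pow_closed[OF x, of m] by (simp add: l_minus r_neg)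
        finally have "d m = \<zero>" using ind[of d m] dF Suc.prems by simp
        then have "\<ominus> \<one> = \<zero>" by (simp add: d_def)
        then show False by simp
      qed
    qed
  qed
  then show ?thesis by simp
qed

end

context valued_field
begin

text \<open>Linear independence over k_F of the residues of 1, x, ..., x^(n-1), expressed through
  representatives. It can thus be compared for different F inside one field and tested by valuations
  alone.\<close>

definition res_indep :: "'a set \<Rightarrow> 'a \<Rightarrow> nat \<Rightarrow> bool" where
  "res_indep F x n \<longleftrightarrow> (\<forall>c. (\<forall>j. c j \<in> vring w F) \<longrightarrow> 0 < w (polyf c n x) \<longrightarrow> (\<forall>j<n. 0 < w (c j)))"

lemma res_indepD:
  "res_indep F x n \<Longrightarrow> (\<And>j. c j \<in> vring w F) \<Longrightarrow> 0 < w (polyf c n x) \<Longrightarrow> j < n \<Longrightarrow> 0 < w (c j)"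
  unfolding res_indep_def by blast

lemma w_polyf_pos:
  assumes "x \<in> carrier R" "0 \<le> w x" "\<And>j. j < n \<Longrightarrow> c j \<in> carrier R" "\<And>j. j < n \<Longrightarrow> 0 < w (c j)"
  shows "0 < w (polyf c n x)"
  using assms(3,4)
proof (induction n)
  case (Suc n)
  have "x [^] n \<in> vring w (carrier R)"
    using subring_pow[OF vring_subring[OF carrier_is_subfield]] assms by (simp add: vring_def)
  then have "0 < w (c n \<otimes> x [^] n)"
    using vmax_mult[of "x [^] n" "c n"] Suc.prems assms(1) by (simp add: vring_def m_comm)
  then show ?case using Suc w_add_gt[of "polyf c n x" "c n \<otimes> x [^] n" 0] polyf_closed(1)[of n c x] assms(1) by simp
qed simp

lemma polyf_cong_coeff:
  assumes "x \<in> carrier R" "0 \<le> w x" "\<And>j. j < n \<Longrightarrow> c j \<in> carrier R" "\<And>j. j < n \<Longrightarrow> d j \<in> carrier R"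
    "\<And>j. j < n \<Longrightarrow> 0 < w (c j \<ominus> d j)"
  shows "0 < w (polyf c n x \<ominus> polyf d n x)"
proof -
  have "polyf c n x = polyf (\<lambda>j. (c j \<ominus> d j) \<oplus> d j) n x"
  proof (rule polyf_cong)
    fix j assume "j < n"
    then have "c j \<in> carrier R" "d j \<in> carrier R" using assms by auto
    then show "c j = (c j \<ominus> d j) \<oplus> d j" by algebra
  qed
  also have "\<dots> = polyf (\<lambda>j. c j \<ominus> d j) n x \<oplus> polyf d n x"
    using assms by (intro polyf_add) auto
  finally have e: "polyf c n x = polyf (\<lambda>j. c j \<ominus> d j) n x \<oplus> polyf d n x" .
  define u v where "u = polyf (\<lambda>j. c j \<ominus> d j) n x" and "v = polyf d n x"
  have "u \<in> carrier R" "v \<in> carrier R" unfolding u_def v_def using assms by (auto intro!: polyf_closed(1))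
  then have "polyf c n x \<ominus> polyf d n x = u" unfolding e u_def[symmetric] v_def[symmetric] by algebra
  then show ?thesis unfolding u_def using w_polyf_pos[of x n "\<lambda>j. c j \<ominus> d j"] assms by auto
qed

text \<open>Dividing by the coefficient of least valuation leaves an integral polynomial with one
  coefficient 1, whose value is a unit by independence. So the valuation of a polynomial in x is the
  least valuation of its coefficients.\<close>

lemma res_indep_value:
  assumes F: "subfield F R" and ind: "res_indep F x n" and x: "x \<in> carrier R" and wx: "0 \<le> w x"
    and c: "\<And>j. c j \<in> F" and nz: "i < n" "c i \<noteq> \<zero>"
  shows "\<exists>j<n. c j \<noteq> \<zero> \<and> w (polyf c n x) = w (c j)"
proof -
  note FR = subfieldE(3)[OF F] and Fs = subringE[OF subfieldE(1)[OF F]]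
  define A where "A = w ` c ` {..<n}"
  have "Min A \<in> A" unfolding A_def using nz(1) by (intro Min_in) auto
  then obtain j where j: "j < n" "w (c j) = Min A" by (auto simp: A_def)
  have min: "w (c j) \<le> w (c k)" if "k < n" for k unfolding j(2) A_def using that by (intro Min_le) auto
  have cR: "c k \<in> carrier R" for k using c FR by auto
  have c0: "c j \<noteq> \<zero>" using min[OF nz(1)] nz(2) w_inf[OF cR[of i]] by auto
  have ic: "inv (c j) \<in> F" "inv (c j) \<in> carrier R" "c j \<otimes> inv (c j) = \<one>" "inv (c j) \<otimes> c j = \<one>"
    using subfield_inv[OF F c c0] FR field_Units cR c0 by auto
  define d where "d k = (if k < n then inv (c j) \<otimes> c k else \<zero>)" for k
  have d: "d k \<in> vring w F" for k
    using w_divide_ge[OF cR[of k] cR[of j] c0 min, of] ic(1) c Fs by (auto simp: d_def vring_def)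
  have dR: "d k \<in> carrier R" for k using d[of k] FR by (auto simp: vring_def)
  have e: "polyf c n x = c j \<otimes> polyf d n x"
  proof -
    have "polyf c n x = polyf (\<lambda>k. c j \<otimes> d k) n x"
    proof (rule polyf_cong)
      fix k assume "k < n"
      then show "c k = c j \<otimes> d k" unfolding d_def using m_assoc[of "c j" "inv (c j)" "c k"] cR ic by simp
    qed
    also have "\<dots> = c j \<otimes> polyf d n x" using dR cR x by (intro polyf_smult)
    finally show ?thesis .
  qed
  have dj: "d j = \<one>" unfolding d_def using ic(4) j(1) by simp
  have P: "polyf d n x \<in> carrier R" using polyf_closed(1) dR x by auto
  have ncong: "\<not> 0 < w (polyf d n x)"
  proof
    assume "0 < w (polyf d n x)"
    then have "0 < w (d j)" using res_indepD[where c = d, OF ind d] j(1) by simp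
    then show False using dj by simp
  qed
  then have "w (polyf d n x) \<le> 0" by simp
  moreover have "polyf d n x \<in> vring w (carrier R)"
    using polyf_in_subring(1)[OF vring_subring[OF carrier_is_subfield], of n d x] d FR x wx by (auto simp: vring_def)
  ultimately have "w (polyf d n x) = 0" by (auto simp: vring_def)
  then have "w (polyf c n x) = w (c j)" unfolding e using w_mult[OF cR P] by simp
  then show ?thesis using j(1) c0 by blast
qed

end

context galois_valued
begin

lemma OL_closed:
  "x \<in> O\<^sub>L \<Longrightarrow> y \<in> O\<^sub>L \<Longrightarrow> x \<otimes> y \<in> O\<^sub>L" "x \<in> O\<^sub>L \<Longrightarrow> y \<in> O\<^sub>L \<Longrightarrow> x \<oplus> y \<in> O\<^sub>L"
  "x \<in> O\<^sub>L \<Longrightarrow> y \<in> O\<^sub>L \<Longrightarrow> x \<ominus> y \<in> O\<^sub>L" "x \<in> O\<^sub>L \<Longrightarrow> x [^] (n::nat) \<in> O\<^sub>L" "\<zero> \<in> O\<^sub>L" "\<one> \<in> O\<^sub>L"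
  "x \<in> O\<^sub>L \<Longrightarrow> \<ominus> x \<in> O\<^sub>L" "x \<in> O\<^sub>L \<Longrightarrow> x \<in> L" "x \<in> O\<^sub>L \<Longrightarrow> x \<in> carrier R" "x \<in> O\<^sub>L \<Longrightarrow> 0 \<le> w x"
  "x \<in> O\<^sub>L \<Longrightarrow> x \<in> vring w (carrier R)"
  using subringE[OF vring_subring[OF KL(2)]] subring_pow[OF vring_subring[OF KL(2)]] L_carrier
  by (auto simp: a_minus_def vring_def)

lemma OL_polyf: "(\<And>j. c j \<in> O\<^sub>L) \<Longrightarrow> x \<in> O\<^sub>L \<Longrightarrow> polyf c n x \<in> O\<^sub>L" "(\<And>j. c j \<in> O\<^sub>L) \<Longrightarrow> x \<in> O\<^sub>L \<Longrightarrow> dpolyf c n x \<in> O\<^sub>L"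
  using polyf_in_subring[OF vring_subring[OF KL(2)]] by blast+

lemma w_multiple_not_dvd:
  assumes "x \<in> carrier R" "\<not> p dvd j" shows "w ([(j::nat)] \<cdot> x) = w x"
proof -
  have j: "0 < j mod p" "j mod p < p" using assms(2) p_prime by (auto simp: dvd_eq_mod_eq_0 prime_gt_0_nat)
  define a b where "a = [(j mod p)] \<cdot> \<one>" and "b = [(p * (j div p))] \<cdot> \<one>"
  have ab: "a \<in> carrier R" "b \<in> carrier R" by (auto simp: a_def b_def)
  have "[j] \<cdot> \<one> = [(j mod p + p * (j div p))] \<cdot> \<one>" by simp
  also have "\<dots> = a \<oplus> b" unfolding a_def b_def by (rule add.nat_pow_mult[symmetric]) simp
  finally have e: "[j] \<cdot> \<one> = a \<oplus> b" .
  have "w a = 0" unfolding a_def using w_coprime_multiple[of \<one> "j mod p"] j by simp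
  moreover have "0 < w b" unfolding b_def using w_multiple_of_p[of \<one> "p * (j div p)"] by simp
  ultimately have "w ([j] \<cdot> \<one>) = 0" unfolding e using w_add_eq[of a b] ab by simp
  moreover have "[j] \<cdot> x = [j] \<cdot> \<one> \<otimes> x" using assms(1) by (simp add: add_pow_ldistr)
  ultimately show ?thesis using w_mult_unit[of "[j] \<cdot> \<one>" x] assms(1) by simp
qed

text \<open>If the coefficients away from multiples of p vanish in the residue field, only powers of
  x^p survive. The induction consumes p consecutive terms at a time.\<close>

lemma polyf_frobenius_split:
  assumes x: "x \<in> carrier R" "0 \<le> w x" and c: "\<And>j. c j \<in> carrier R" "\<And>j. 0 \<le> w (c j)"
    and nd: "\<And>j. j < p * m \<Longrightarrow> \<not> p dvd j \<Longrightarrow> 0 < w (c j)"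
  shows "0 < w (polyf c (p * m) x \<ominus> polyf (\<lambda>l. c (p * l)) m (x [^] p))"
  using nd
proof (induction m)
  case 0
  then show ?case by (simp add: a_minus_def)
next
  case (Suc m)
  obtain p' where p': "p = Suc p'" using prime_gt_0_nat[OF p_prime] gr0_conv_Suc by auto
  have IH: "0 < w (polyf c (p * m) x \<ominus> polyf (\<lambda>l. c (p * l)) m (x [^] p))"
    by (rule Suc.IH) (rule Suc.prems, auto)
  define a where "a = polyf c (p * m) x"
  define b where "b = polyf (\<lambda>l. c (p * l)) m (x [^] p)"
  define t where "t = polyf (\<lambda>j. c (p * m + Suc j)) p' x"
  define y where "y = x [^] (p * m)"
  have C: "a \<in> carrier R" "b \<in> carrier R" "t \<in> carrier R" "y \<in> carrier R" "c (p * m) \<in> carrier R"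
    unfolding a_def b_def t_def y_def using c x by (auto intro!: polyf_closed(1))
  have "polyf c (p * m + p) x = a \<oplus> y \<otimes> polyf (\<lambda>j. c (p * m + j)) (Suc p') x"
    unfolding a_def y_def p'[symmetric] by (rule polyf_append[OF c(1) x(1)])
  also have "polyf (\<lambda>j. c (p * m + j)) (Suc p') x = c (p * m) \<oplus> x \<otimes> t"
    unfolding t_def using polyf_Suc_left[of "\<lambda>j. c (p * m + j)" x p'] c x by simp
  finally have e1: "polyf c (p * Suc m) x = a \<oplus> y \<otimes> (c (p * m) \<oplus> x \<otimes> t)" by (simp add: add.commute)
  have e2: "polyf (\<lambda>l. c (p * l)) (Suc m) (x [^] p) = b \<oplus> c (p * m) \<otimes> y"
    unfolding b_def y_def using x by (simp add: nat_pow_pow)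
  have "polyf c (p * Suc m) x \<ominus> polyf (\<lambda>l. c (p * l)) (Suc m) (x [^] p) = (a \<ominus> b) \<oplus> (y \<otimes> x) \<otimes> t"
    unfolding e1 e2 using C x by algebra
  moreover have "0 < w t" unfolding t_def
  proof (rule w_polyf_pos[OF x])
    fix j assume j: "j < p'"
    have "\<not> p dvd Suc j" using j p' by (auto dest: dvd_imp_le)
    then have "\<not> p dvd (p * m + Suc j)" by (metis dvd_add_right_iff dvd_triv_left)
    moreover have "p * m + Suc j < p * Suc m" using j p' by simp
    ultimately show "0 < w (c (p * m + Suc j))" using Suc.prems by blast
  qed (rule c)
  moreover have "y \<otimes> x \<in> vring w (carrier R)" unfolding y_def
    using x subring_pow[OF vring_subring[OF carrier_is_subfield], of x] subringE(6)[OF vring_subring[OF carrier_is_subfield]]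
    by (simp add: vring_def)
  ultimately show ?case using w_add_gt[of "a \<ominus> b" "(y \<otimes> x) \<otimes> t" 0] vmax_mult[of "y \<otimes> x" t] IH C x
    unfolding a_def[symmetric] b_def[symmetric] by (simp add: vring_def)
qed

text \<open>The derivative is a polynomial in x with coefficients [j] c j; independence puts them in
  the maximal ideal, and [j] is a unit when p does not divide j.\<close>

lemma w_nondivisible_coeffs:
  assumes ind: "res_indep E x n" and x: "x \<in> O\<^sub>L" and c: "\<And>j. c j \<in> vring w E"
    and d: "0 < w (dpolyf c n x)" and j: "j < n" "\<not> p dvd j"
  shows "0 < w (c j)"
proof -
  obtain m where m: "n = Suc m" using j by (cases n) auto
  have xR: "x \<in> carrier R" using OL_closed x by auto
  have cR: "c j \<in> carrier R" for j using c[of j] E_closed by (auto simp: vring_def)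
  \<comment> \<open>The derivative has m = n - 1 terms; padding by one zero matches the n terms of
    the independence hypothesis.\<close>
  define e where "e = (\<lambda>j. if j < m then [Suc j] \<cdot> c (Suc j) else \<zero>)"
  have eV: "e j \<in> vring w E" for j
    using add_pow_in_subring[OF vring_subring[OF E_subfield] c] subringE(2)[OF vring_subring[OF E_subfield]]
    unfolding e_def by (simp del: add.nat_pow_Suc)
  have "dpolyf c n x = polyf (\<lambda>j. [Suc j] \<cdot> c (Suc j)) m x" unfolding m using dpolyf_eq_polyf[of m c x] cR xR by simp
  also have "\<dots> = polyf e n x" unfolding e_def m using cR xR by (intro polyf_truncate[symmetric]) auto
  finally have "0 < w (polyf e n x)" using d by simp
  obtain i where i: "j = Suc i" using j(2) by (cases j) auto
  have "0 < w (e i)" using res_indepD[where c = e, OF ind eV \<open>0 < w (polyf e n x)\<close>, of i] j(1) i by simp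
  moreover have "i < m" using i j m by simp
  ultimately show ?thesis using w_multiple_not_dvd[OF cR j(2)] unfolding e_def i by (simp del: add.nat_pow_Suc)
qed

text \<open>Induction on the number of terms. A polynomial that vanishes at the residue of x has
  vanishing derivative there, since a simple root would lie in k_E. The derivative has fewer terms,
  so the coefficients away from multiples of p vanish, and what is left is a polynomial in x^p with
  at most m terms.\<close>

lemma res_indep_mult_p:
  assumes x: "x \<in> O\<^sub>L" and nE: "\<And>b. b \<in> vring w E \<Longrightarrow> \<not> 0 < w (x \<ominus> b)" and ind: "res_indep E (x [^] p) m"
  shows "res_indep E x (p * m)"
proof -
  have xR: "x \<in> carrier R" "0 \<le> w x" using OL_closed x by auto
  have xpR: "x [^] p \<in> carrier R" using xR by simp
  have step: "n \<le> p * m \<Longrightarrow> res_indep E x n" for n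
  proof (induction n)
    case 0
    then show ?case by (simp add: res_indep_def)
  next
    case (Suc n)
    have IH: "res_indep E x n" using Suc by simp
    show ?case unfolding res_indep_def
    proof (intro allI impI)
      fix c j assume c: "\<forall>j. c j \<in> vring w E" and pos: "0 < w (polyf c (Suc n) x)" and j: "j < Suc n"
      have cV: "c j \<in> vring w E" for j using c by simp
      have cR: "c j \<in> carrier R" "0 \<le> w (c j)" "c j \<in> O\<^sub>L" for j using cV[of j] OE_closed[OF cV[of j]] E_closed by (auto simp: vring_def)
      have "w (dpolyf c (Suc n) x) \<noteq> 0" using simple_root_residue[OF cV x pos] nE by blast
      moreover have dO: "dpolyf c (Suc n) x \<in> O\<^sub>L" using OL_polyf(2)[OF cR(3) x] .
      ultimately have dpos: "0 < w (dpolyf c (Suc n) x)" using OL_closed(10)[OF dO] by simp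
      define e where "e = (\<lambda>j. if j < n then [Suc j] \<cdot> c (Suc j) else \<zero>)"
      have eV: "e j \<in> vring w E" for j
        using add_pow_in_subring[OF vring_subring[OF E_subfield] cV] subringE(2)[OF vring_subring[OF E_subfield]]
        unfolding e_def by (simp del: add.nat_pow_Suc)
      have "dpolyf c (Suc n) x = polyf e n x"
        unfolding e_def using dpolyf_eq_polyf[of n c x] cR xR polyf_truncate[of "\<lambda>j. [Suc j] \<cdot> c (Suc j)" x n n] by simp
      then have "0 < w (polyf e n x)" using dpos by simp
      then have epos: "0 < w (e i)" if "i < n" for i using res_indepD[where c = e, OF IH eV _ that] by simp
      have nd: "0 < w (c i)" if i: "i < Suc n" and ni: "\<not> p dvd i" for i
      proof -
        obtain l where l: "i = Suc l" using ni by (cases i) auto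
        then have "0 < w ([Suc l] \<cdot> c (Suc l))" using epos[of l] i by (simp add: e_def del: add.nat_pow_Suc)
        then show ?thesis using w_multiple_not_dvd[OF cR(1) ni, of i] l by (simp del: add.nat_pow_Suc)
      qed
      define d where "d = (\<lambda>j. if j < Suc n then c j else \<zero>)"
      have dV: "d j \<in> vring w E" for j using cV subringE(2)[OF vring_subring[OF E_subfield]] by (simp add: d_def)
      have dR: "d j \<in> carrier R" "0 \<le> w (d j)" for j using cR by (auto simp: d_def)
      have "polyf d (p * m) x = polyf c (Suc n) x"
        unfolding d_def using cR(1) xR(1) Suc.prems by (rule polyf_truncate)
      then have 1: "0 < w (polyf d (p * m) x)" using pos by simp
      have 2: "0 < w (polyf d (p * m) x \<ominus> polyf (\<lambda>l. d (p * l)) m (x [^] p))"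
        using nd by (intro polyf_frobenius_split xR dR) (auto simp: d_def)
      define u v where "u = polyf d (p * m) x" and "v = polyf (\<lambda>l. d (p * l)) m (x [^] p)"
      have uv: "u \<in> carrier R" "v \<in> carrier R" unfolding u_def v_def using dR xR xpR by (auto intro!: polyf_closed(1))
      have "v = u \<ominus> (u \<ominus> v)" using uv by algebra
      then have "0 < w v" using w_minus_gt[of u "u \<ominus> v" 0] 1 2 uv unfolding u_def[symmetric] v_def[symmetric] by simp
      then have dp: "0 < w (d (p * l))" if "l < m" for l
        using res_indepD[OF ind, of "\<lambda>l. d (p * l)"] dV that unfolding v_def by simp
      show "0 < w (c j)"
      proof (cases "p dvd j")
        case True
        then obtain l where l: "j = p * l" by auto
        have "p * l < p * m" using j Suc.prems l by linarith
        then have "l < m" by simp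
        then show ?thesis using dp[of l] l j by (simp add: d_def)
      qed (use nd j in blast)
    qed
  qed
  then show ?thesis by simp
qed

text \<open>\<open>res_indep_mult_p\<close> iterated along x, x^p, x^(p^2), ...: if an earlier power
  were congruent to an element of E, so would be x^(p^(k - 1)). The guard k > 0 empties the
  hypothesis at k = 0, where k - 1 is truncated.\<close>

lemma res_indep_prime_power:
  assumes "x \<in> O\<^sub>L" "\<And>b. b \<in> vring w E \<Longrightarrow> k > 0 \<Longrightarrow> \<not> 0 < w (x [^] (p ^ (k - 1)) \<ominus> b)"
  shows "res_indep E x (p ^ k)"
  using assms
proof (induction k arbitrary: x)
  case 0
  have "0 < w (c j)" if "\<And>j. c j \<in> vring w E" "0 < w (polyf c 1 x)" "j < 1" for c and j :: nat
    using that E_closed(8)[OF vringD(1)[OF that(1)[of 0]]] by simp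
  then show ?case by (simp add: res_indep_def)
next
  case (Suc k)
  have xR: "x \<in> carrier R" "0 \<le> w x" using OL_closed Suc.prems(1) by auto
  have "res_indep E x (p * p ^ k)"
  proof (rule res_indep_mult_p[OF Suc.prems(1)])
    fix b assume b: "b \<in> vring w E"
    show "\<not> 0 < w (x \<ominus> b)"
    proof
      assume "0 < w (x \<ominus> b)"
      moreover have "b \<in> carrier R" using b E_closed by (auto simp: vring_def)
      ultimately have "0 < w (x [^] (p ^ k) \<ominus> b [^] (p ^ k))" using cong_pow[OF xR(1) _ xR(2)] by simp
      moreover have "b [^] (p ^ k) \<in> vring w E" using subring_pow[OF vring_subring[OF E_subfield] b] .
      ultimately show False using Suc.prems(2)[of "b [^] (p ^ k)"] by simp
    qed
  next
    show "res_indep E (x [^] p) (p ^ k)"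
    proof (rule Suc.IH)
      show "x [^] p \<in> O\<^sub>L" using OL_closed(4)[OF Suc.prems(1)] .
      fix b assume b: "b \<in> vring w E" "0 < k"
      have "(x [^] p) [^] (p ^ (k - 1)) = x [^] (p ^ k)"
        using b(2) xR(1) by (simp add: nat_pow_pow power_eq_if)
      then show "\<not> 0 < w ((x [^] p) [^] (p ^ (k - 1)) \<ominus> b)" using Suc.prems(2)[OF b(1)] by simp
    qed
  qed
  then show ?case by simp
qed

text \<open>The derivative n x^(n - 1) lies in the maximal ideal because p divides n, so already the
  linear term of the Taylor expansion gains valuation.\<close>

lemma pow_diff_gt:
  assumes x: "x \<in> carrier R" "0 \<le> w x" and y: "y \<in> carrier R" "0 \<le> w y" and n: "p dvd n"
    and d: "0 < w (y \<ominus> x)" "ereal r \<le> w (y \<ominus> x)"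
  shows "ereal r < w (y [^] n \<ominus> x [^] n)"
proof -
  note V = vring_subring[OF carrier_is_subfield]
  have xV: "x \<in> vring w (carrier R)" "y \<ominus> x \<in> vring w (carrier R)" using x y d by (auto simp: vring_def)
  obtain s where s: "s \<in> vring w (carrier R)"
    "(x \<oplus> (y \<ominus> x)) [^] n = x [^] n \<oplus> (y \<ominus> x) \<otimes> ([n] \<cdot> (x [^] (n - 1))) \<oplus> (y \<ominus> x) \<otimes> (y \<ominus> x) \<otimes> s"
    using pow_taylor[OF V xV, of n] by blast
  define e where "e = [n] \<cdot> (x [^] (n - 1))"
  have xn: "x [^] (n - 1) \<in> carrier R" "0 \<le> w (x [^] (n - 1))"
    using subring_pow[OF V xV(1)] by (auto simp: vring_def)
  have e: "e \<in> carrier R" "0 < w e" unfolding e_def using w_multiple_of_p[OF xn n] x by auto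
  have sR: "s \<in> carrier R" "0 \<le> w s" using s by (auto simp: vring_def)
  have yx: "x \<oplus> (y \<ominus> x) = y" using x y by algebra
  define xn where "xn = x [^] n"
  have xnR: "xn \<in> carrier R" using x by (simp add: xn_def)
  have "y [^] n = xn \<oplus> (y \<ominus> x) \<otimes> e \<oplus> (y \<ominus> x) \<otimes> (y \<ominus> x) \<otimes> s"
    using s(2)[folded e_def, unfolded yx] by (simp add: xn_def)
  then have "y [^] n \<ominus> x [^] n = (e \<oplus> s \<otimes> (y \<ominus> x)) \<otimes> (y \<ominus> x)"
    unfolding xn_def[symmetric] using x(1) y(1) e(1) sR(1) xnR by algebra
  moreover have "0 < w (e \<oplus> s \<otimes> (y \<ominus> x))"
    using w_add_gt[of e "s \<otimes> (y \<ominus> x)" 0] vmax_mult[of s "y \<ominus> x"] e sR x y d by simp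
  ultimately show ?thesis using w_mult_gt'[of "e \<oplus> s \<otimes> (y \<ominus> x)" "y \<ominus> x" r] e sR x y d by simp
qed

end

section \<open>Monogenic extensions\<close>

text \<open>For q = 0 the truncated q - 1 is again 0, and without its guard \<open>q_min\<close>
  would contradict the choice of \<open>a\<close>.\<close>

locale monogenic = galois_valued +
  fixes \<alpha> a :: 'a and q :: nat
  assumes gen: "O\<^sub>L = generate_ring R (insert \<alpha> (vring w K))" and alpha_L: "\<alpha> \<in> L"
    and a: "a \<in> vring w E" "0 < w (\<alpha> [^] (p ^ q) \<ominus> a)"
    and q_min: "\<And>b. b \<in> vring w E \<Longrightarrow> q > 0 \<Longrightarrow> \<not> 0 < w (\<alpha> [^] (p ^ (q - 1)) \<ominus> b)"
begin

text \<open>The value at \<alpha> of X^(p^q) - a, a lift of the minimal polynomial over k_E of the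
  residue of \<alpha>. It lies in the maximal ideal and may generate it.\<close>

definition \<gamma> :: 'a where "\<gamma> = \<alpha> [^] (p ^ q) \<ominus> a"

lemma alpha: "\<alpha> \<in> O\<^sub>L" "\<alpha> \<in> carrier R" "0 \<le> w \<alpha>"
proof -
  show "\<alpha> \<in> O\<^sub>L" unfolding gen by (intro generate_ring.incl) simp
  then show "\<alpha> \<in> carrier R" "0 \<le> w \<alpha>" using OL_closed by auto
qed

lemma gamma: "\<gamma> \<in> O\<^sub>L" "\<gamma> \<in> carrier R" "0 < w \<gamma>"
  using a alpha OE_closed[OF a(1)] OL_closed by (auto simp: \<gamma>_def)

lemma alpha_indep: "res_indep E \<alpha> (p ^ q)"
  using res_indep_prime_power[OF alpha(1)] q_min by blast

lemma OL_induct [consumes 1, case_names alpha base one neg add mult]: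
  assumes "x \<in> O\<^sub>L" "P \<alpha>" "\<And>x. x \<in> vring w K \<Longrightarrow> P x" "P \<one>" "\<And>x. x \<in> O\<^sub>L \<Longrightarrow> P x \<Longrightarrow> P (\<ominus> x)"
    "\<And>x y. x \<in> O\<^sub>L \<Longrightarrow> y \<in> O\<^sub>L \<Longrightarrow> P x \<Longrightarrow> P y \<Longrightarrow> P (x \<oplus> y)"
    "\<And>x y. x \<in> O\<^sub>L \<Longrightarrow> y \<in> O\<^sub>L \<Longrightarrow> P x \<Longrightarrow> P y \<Longrightarrow> P (x \<otimes> y)"
  shows "P x"
  using assms(1) unfolding gen
proof (induction rule: generate_ring.induct)
  case (incl h)
  then show ?case using assms(2,3) by blast
qed (use assms gen in auto)

text \<open>Results of division with remainder by X^(p^q) - a, evaluated at \<alpha>; the quotient Q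
  is remembered only as an element of O_L.\<close>

definition expansions :: "'a set" where
  "expansions = {Q \<otimes> \<gamma> \<oplus> polyf c (p ^ q) \<alpha> | Q c. Q \<in> O\<^sub>L \<and> (\<forall>j. c j \<in> vring w E)}"

lemma expansionsI: "Q \<in> O\<^sub>L \<Longrightarrow> (\<And>j. c j \<in> vring w E) \<Longrightarrow> Q \<otimes> \<gamma> \<oplus> polyf c (p ^ q) \<alpha> \<in> expansions"
  unfolding expansions_def by blast

lemma expansions_closed:
  assumes y: "y \<in> expansions"
  shows "y \<in> carrier R" "z \<in> expansions \<Longrightarrow> y \<oplus> z \<in> expansions" "e \<in> vring w E \<Longrightarrow> e \<otimes> y \<in> expansions"
    "\<alpha> \<otimes> y \<in> expansions"
proof -
  note VE = subringE[OF vring_subring[OF E_subfield]]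
  obtain Q c where y: "y = Q \<otimes> \<gamma> \<oplus> polyf c (p ^ q) \<alpha>" and Q: "Q \<in> O\<^sub>L" and c: "\<And>j. c j \<in> vring w E"
    using y unfolding expansions_def by blast
  have cR: "c j \<in> carrier R" for j using c VE(1) by auto
  define P where "P = polyf c (p ^ q) \<alpha>"
  have C: "Q \<in> carrier R" "P \<in> carrier R" unfolding P_def using OL_closed Q polyf_closed(1)[of "p ^ q" c \<alpha>] cR alpha by auto
  show "y \<in> carrier R" using y C gamma P_def by simp
  show "y \<oplus> z \<in> expansions" if "z \<in> expansions"
  proof -
    obtain Q' c' where z: "z = Q' \<otimes> \<gamma> \<oplus> polyf c' (p ^ q) \<alpha>" "Q' \<in> O\<^sub>L" "\<And>j. c' j \<in> vring w E"
      using \<open>z \<in> expansions\<close> unfolding expansions_def by blast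
    have c'R: "c' j \<in> carrier R" for j using z(3) VE(1) by auto
    define P' where "P' = polyf c' (p ^ q) \<alpha>"
    have C': "Q' \<in> carrier R" "P' \<in> carrier R" unfolding P'_def using OL_closed z(2) polyf_closed(1)[of "p ^ q" c' \<alpha>] c'R alpha by auto
    have "polyf (\<lambda>j. c j \<oplus> c' j) (p ^ q) \<alpha> = P \<oplus> P'" unfolding P_def P'_def using cR c'R alpha by (intro polyf_add)
    moreover have "y \<oplus> z = (Q \<oplus> Q') \<otimes> \<gamma> \<oplus> (P \<oplus> P')" unfolding y z P_def[symmetric] P'_def[symmetric] using C C' gamma(2) by algebra
    ultimately show ?thesis using expansionsI[of "Q \<oplus> Q'" "\<lambda>j. c j \<oplus> c' j"] OL_closed(2)[OF Q z(2)] VE(7)[OF c z(3)] by simp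
  qed
  show "e \<otimes> y \<in> expansions" if e: "e \<in> vring w E"
  proof -
    have eR: "e \<in> carrier R" using e VE(1) by auto
    have "polyf (\<lambda>j. e \<otimes> c j) (p ^ q) \<alpha> = e \<otimes> P" unfolding P_def using cR eR alpha by (intro polyf_smult)
    moreover have "e \<otimes> y = (e \<otimes> Q) \<otimes> \<gamma> \<oplus> e \<otimes> P" unfolding y P_def[symmetric] using C eR gamma(2) by algebra
    ultimately show ?thesis using expansionsI[of "e \<otimes> Q" "\<lambda>j. e \<otimes> c j"] OL_closed(1)[OF OE_closed[OF e] Q] VE(6)[OF e c] by simp
  qed
  show "\<alpha> \<otimes> y \<in> expansions"
  proof -
    obtain m where m: "p ^ q = Suc m" using p_prime prime_gt_0_nat by (metis gr0_conv_Suc zero_less_power)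
    \<comment> \<open>Multiplication by \<alpha> shifts the coefficients; the top term is rewritten
      by \<alpha>^(p^q) = \<gamma> + a, so that c m a becomes the constant coefficient and c m is
      added to the quotient.\<close>
    define d where "d j = (case j of 0 \<Rightarrow> c m \<otimes> a | Suc i \<Rightarrow> c i)" for j
    have d: "d j \<in> vring w E" for j unfolding d_def using c VE(6)[OF c a(1)] by (cases j) auto
    have dR: "d j \<in> carrier R" for j using d VE(1) by auto
    define T where "T = polyf c m \<alpha>"
    have aR: "a \<in> carrier R" "T \<in> carrier R" unfolding T_def using a VE(1) polyf_closed(1)[of m c \<alpha>] cR alpha by auto
    have "polyf d (Suc m) \<alpha> = c m \<otimes> a \<oplus> \<alpha> \<otimes> T"
      using polyf_Suc_left[of d \<alpha> m] dR alpha by (simp add: d_def T_def)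
    moreover have "P = T \<oplus> c m \<otimes> \<alpha> [^] m" unfolding P_def m T_def by simp
    moreover have "\<alpha> [^] m \<otimes> \<alpha> = \<gamma> \<oplus> a"
    proof -
      have "\<alpha> [^] (p ^ q) \<in> carrier R" using alpha by simp
      then have "\<alpha> [^] (p ^ q) = \<gamma> \<oplus> a" unfolding \<gamma>_def using aR by algebra
      then show ?thesis by (simp add: m)
    qed
    moreover have "\<alpha> \<otimes> (T \<oplus> c m \<otimes> \<alpha> [^] m) = \<alpha> \<otimes> T \<oplus> c m \<otimes> (\<alpha> [^] m \<otimes> \<alpha>)"
    proof -
      have "\<alpha> [^] m \<in> carrier R" using alpha by simp
      then show ?thesis using alpha(2) aR cR[of m] by algebra
    qed
    ultimately have aP: "\<alpha> \<otimes> P = c m \<otimes> \<gamma> \<oplus> polyf d (p ^ q) \<alpha>"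
      unfolding m using alpha(2) aR cR[of m] gamma(2) by simp algebra
    define D where "D = polyf d (p ^ q) \<alpha>"
    have DR: "D \<in> carrier R" unfolding D_def using polyf_closed(1)[of "p ^ q" d \<alpha>] dR alpha by auto
    have "\<alpha> \<otimes> y = (\<alpha> \<otimes> Q) \<otimes> \<gamma> \<oplus> \<alpha> \<otimes> P" unfolding y P_def[symmetric] using C alpha(2) gamma(2) by algebra
    also have "\<dots> = (\<alpha> \<otimes> Q \<oplus> c m) \<otimes> \<gamma> \<oplus> D"
      unfolding aP D_def[symmetric] using C alpha(2) gamma(2) cR[of m] DR by algebra
    finally show ?thesis unfolding D_def
      using expansionsI[of "\<alpha> \<otimes> Q \<oplus> c m" d] OL_closed(2)[OF OL_closed(1)[OF alpha(1) Q] OE_closed[OF c[of m]]] d by simp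
  qed
qed

text \<open>\<open>expansions\<close> contains 1 and is stable under multiplication by \<alpha> and
  by O_E; inducting over the generation of O_L on the multiplier x avoids multiplying two
  expansions.\<close>

lemma expansion:
  assumes "x \<in> O\<^sub>L"
  shows "\<exists>Q\<in>O\<^sub>L. \<exists>c. (\<forall>j. c j \<in> vring w E) \<and> x = Q \<otimes> \<gamma> \<oplus> polyf c (p ^ q) \<alpha>"
proof -
  note VE = subringE[OF vring_subring[OF E_subfield]]
  have neg: "\<ominus> y \<in> expansions" if "y \<in> expansions" for y
    using expansions_closed(3)[OF that VE(5)[OF VE(3)]] expansions_closed(1)[OF that] by (simp add: l_minus)
  have "\<forall>y\<in>expansions. x \<otimes> y \<in> expansions"
    using assms
  proof (induction rule: OL_induct)
    case (base x)
    then have "x \<in> vring w E" using K_E by (auto simp: vring_def)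
    then show ?case using expansions_closed(3) by blast
  next
    case (neg x)
    then show ?case using \<open>\<And>y. y \<in> expansions \<Longrightarrow> \<ominus> y \<in> expansions\<close> expansions_closed(1) OL_closed(9) by (simp add: l_minus)
  next
    case (add x y)
    then show ?case using expansions_closed(1,2) OL_closed(9) by (simp add: l_distr)
  next
    case (mult x y)
    then show ?case using expansions_closed(1) OL_closed(9) by (simp add: m_assoc)
  qed (use expansions_closed in auto)
  moreover have "\<one> \<in> expansions"
  proof -
    obtain m where m: "p ^ q = Suc m" using p_prime prime_gt_0_nat by (metis gr0_conv_Suc zero_less_power)
    define c where "c j = (if j = 0 then \<one> else \<zero>)" for j :: nat
    have "polyf c (p ^ q) \<alpha> = \<one>"
      unfolding m using polyf_Suc_left[of c \<alpha> m] alpha polyf_zero[of \<alpha> m] by (simp add: c_def)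
    moreover have "\<And>j. c j \<in> vring w E" using VE by (simp add: c_def)
    ultimately show ?thesis using expansionsI[of \<zero> c] OL_closed(5) gamma by simp
  qed
  ultimately have "x \<otimes> \<one> \<in> expansions" by blast
  then show ?thesis using OL_closed(9)[OF assms] unfolding expansions_def by auto
qed

lemma residue_expansion:
  assumes "x \<in> O\<^sub>L"
  shows "\<exists>c. (\<forall>j. c j \<in> vring w E) \<and> 0 < w (x \<ominus> polyf c (p ^ q) \<alpha>)"
proof -
  obtain Q c where Q: "Q \<in> O\<^sub>L" and c: "\<And>j. c j \<in> vring w E" "x = Q \<otimes> \<gamma> \<oplus> polyf c (p ^ q) \<alpha>" using expansion[OF assms] by blast
  define P where "P = polyf c (p ^ q) \<alpha>"
  have "P \<in> carrier R" unfolding P_def using polyf_closed(1)[of "p ^ q" c \<alpha>] c(1) E_closed(8) alpha by (auto simp: vring_def)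
  then have "x \<ominus> P = Q \<otimes> \<gamma>" unfolding c(2) P_def[symmetric] using OL_closed(9)[OF Q] gamma(2) by algebra
  then show ?thesis using c(1) vmax_mult[of Q \<gamma>] OL_closed(9,10)[OF Q] gamma unfolding P_def by (intro exI[of _ c]) auto
qed

definition unif :: "'a \<Rightarrow> bool" where
  "unif u \<longleftrightarrow> u \<in> L \<and> u \<noteq> \<zero> \<and> 0 < w u \<and> (\<forall>x\<in>L. 0 < w x \<longrightarrow> w u \<le> w x)"

text \<open>If \<gamma> is not a uniformizer, expand a uniformizer as u = Q \<gamma> + P. Then w (Q
  \<gamma>) > w u, so w P = w u, and by \<open>res_indep_value\<close> w P is the valuation of a
  coefficient in E.\<close>

lemma uniformizer_cases: "unif \<gamma> \<or> (\<exists>u\<in>E. unif u)"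
proof -
  obtain u where u: "unif u" using uniformizer_exists unfolding unif_def by blast
  then have uL: "u \<in> L" "u \<in> carrier R" "u \<noteq> \<zero>" "0 < w u" "\<And>x. x \<in> L \<Longrightarrow> 0 < w x \<Longrightarrow> w u \<le> w x" using L_carrier by (auto simp: unif_def)
  obtain r where r: "w u = ereal r" using w_real uL by metis
  show ?thesis
  proof (cases "w \<gamma> = w u")
    case True
    then have "\<gamma> \<noteq> \<zero>" using r by auto
    then have "unif \<gamma>" using True u gamma OL_closed(8) unfolding unif_def by auto
    then show ?thesis by simp
  next
    case False
    then have g: "w u < w \<gamma>" using uL(5)[of \<gamma>] gamma OL_closed(8) by auto
    obtain Q c where Q: "Q \<in> O\<^sub>L" and c: "\<And>j. c j \<in> vring w E" "u = Q \<otimes> \<gamma> \<oplus> polyf c (p ^ q) \<alpha>"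
    proof -
      have "u \<in> O\<^sub>L" using uL by (simp add: vring_def)
      then show ?thesis using expansion that by blast
    qed
    define P where "P = polyf c (p ^ q) \<alpha>"
    have cR: "c j \<in> carrier R" "c j \<in> E" for j using c(1)[of j] E_closed(8) by (auto simp: vring_def)
    have P: "P \<in> carrier R" unfolding P_def using polyf_closed(1)[of "p ^ q" c \<alpha>] cR alpha by auto
    have "u \<ominus> P = Q \<otimes> \<gamma>" unfolding c(2) P_def[symmetric] using OL_closed(9)[OF Q] gamma(2) P by algebra
    then have "w u < w (u \<ominus> P)" using w_mult_gt[of Q \<gamma> "w u"] OL_closed(9,10)[OF Q] gamma g by simp
    then have wP: "w P = w u" using w_eq_of_close[OF uL(2) P] by simp
    have "\<exists>i<p ^ q. c i \<noteq> \<zero>"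
    proof (rule ccontr)
      assume "\<not> ?thesis"
      then have "P = polyf (\<lambda>_. \<zero>) (p ^ q) \<alpha>" unfolding P_def by (intro polyf_cong) auto
      then show False using wP r polyf_zero[of \<alpha> "p ^ q"] alpha by simp
    qed
    then obtain i where "i < p ^ q" "c i \<noteq> \<zero>" by blast
    then obtain j where "c j \<noteq> \<zero>" "w P = w (c j)"
      using res_indep_value[where c = c, OF E_subfield alpha_indep alpha(2,3) cR(2)] unfolding P_def by blast
    then have "unif (c j)" using wP u cR(2)[of j] E_closed(7) unfolding unif_def by auto
    then show ?thesis using cR(2) by blast
  qed
qed

text \<open>Both maps fix K, and closeness beyond r passes through sums and products of integral
  elements, so it suffices to test it on the generator \<alpha>. Taking the identity of L for h
  gives a bound on w (f x - x).\<close>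

lemma close_on_OL:
  assumes f: "f \<in> G" and h: "h \<in> G" and r: "ereal r < w (f \<alpha> \<ominus> h \<alpha>)" and x: "x \<in> O\<^sub>L"
  shows "ereal r < w (f x \<ominus> h x)"
  using x
proof (induction rule: OL_induct)
  case alpha
  then show ?case using r .
next
  case (base x)
  then have "f x = x" "h x = x" "x \<in> carrier R" using f h gal_iff[OF KL(2,3)] K_carrier by (auto simp: vring_def)
  then show ?case by (simp add: minus_self)
next
  case one
  then show ?case using endoD(4)[OF G_endo[OF f]] endoD(4)[OF G_endo[OF h]] by (simp add: minus_self)
next
  case (neg x)
  have R: "f x \<in> carrier R" "h x \<in> carrier R" "x \<in> L" using O_closed[OF f neg(1)] O_closed[OF h neg(1)] OL_closed neg(1) by auto
  have "f (\<ominus> x) \<ominus> h (\<ominus> x) = \<ominus> (f x \<ominus> h x)"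
    using endo_a_inv[OF KL(2) G_endo[OF f] R(3)] endo_a_inv[OF KL(2) G_endo[OF h] R(3)] R(1,2) by simp algebra
  then show ?case using neg R by simp
next
  case (add x y)
  have R: "f x \<in> carrier R" "h x \<in> carrier R" "x \<in> L" "f y \<in> carrier R" "h y \<in> carrier R" "y \<in> L"
    using O_closed[OF f add(1)] O_closed[OF h add(1)] O_closed[OF f add(2)] O_closed[OF h add(2)] OL_closed add(1,2) by auto
  have "f (x \<oplus> y) \<ominus> h (x \<oplus> y) = (f x \<ominus> h x) \<oplus> (f y \<ominus> h y)"
    using endoD(3)[OF G_endo[OF f] R(3,6)] endoD(3)[OF G_endo[OF h] R(3,6)] R by simp algebra
  then show ?case using w_add_gt[of "f x \<ominus> h x" "f y \<ominus> h y" "ereal r"] add R by simp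
next
  case (mult x y)
  have O: "f x \<in> O\<^sub>L" "h x \<in> O\<^sub>L" "f y \<in> O\<^sub>L" "h y \<in> O\<^sub>L"
    using O_closed[OF f mult(1)] O_closed[OF h mult(1)] O_closed[OF f mult(2)] O_closed[OF h mult(2)] by auto
  then have R: "f x \<in> carrier R" "h x \<in> carrier R" "x \<in> L" "f y \<in> carrier R" "h y \<in> carrier R" "y \<in> L"
    using OL_closed mult(1,2) by auto
  have "f (x \<otimes> y) \<ominus> h (x \<otimes> y) = f x \<otimes> (f y \<ominus> h y) \<oplus> h y \<otimes> (f x \<ominus> h x)"
    using endoD(2)[OF G_endo[OF f] R(3,6)] endoD(2)[OF G_endo[OF h] R(3,6)] R by simp algebra
  then show ?case
    using w_add_gt[of "f x \<otimes> (f y \<ominus> h y)" "h y \<otimes> (f x \<ominus> h x)" "ereal r"] w_mult_gt[of "f x" "f y \<ominus> h y" "ereal r"]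
      w_mult_gt[of "h y" "f x \<ominus> h x" "ereal r"] mult R OL_closed(10)[OF O(1)] OL_closed(10)[OF O(4)] by simp
qed

lemma id_in_inertia: "(\<lambda>x\<in>L. x) \<in> inertia" using automorphismsD(4)[OF inertia_automorphisms] .

lemma compose_right_image:
  assumes t: "t \<in> inertia" shows "(\<lambda>s. compose L s t) ` inertia = inertia" "inj_on (\<lambda>s. compose L s t) inertia"
proof -
  note S = inertia_automorphisms
  obtain u where u: "u \<in> inertia" "\<forall>x\<in>L. t (u x) = x \<and> u (t x) = x" using automorphisms_inverse[OF KL(2) S t] by blast
  show inj: "inj_on (\<lambda>s. compose L s t) inertia"
  proof (rule inj_onI)
    fix f h assume f: "f \<in> inertia" and h: "h \<in> inertia" and e: "compose L f t = compose L h t"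
    show "f = h"
    proof (rule extensionalityI[OF automorphismsD(3)[OF S f] automorphismsD(3)[OF S h]])
      fix x assume x: "x \<in> L"
      have ux: "u x \<in> L" using G_closed[OF inertiaD(1)[OF u(1)] x] .
      have "f (t (u x)) = h (t (u x))" using fun_cong[OF e, of "u x"] ux by (simp add: compose_def)
      then show "f x = h x" using u(2) x by simp
    qed
  qed
  have "(\<lambda>s. compose L s t) ` inertia \<subseteq> inertia" using automorphismsD(5)[OF S _ t] by auto
  then show "(\<lambda>s. compose L s t) ` inertia = inertia" using inj automorphismsD(1)[OF S] by (metis card_image card_subset_eq)
qed

text \<open>\<open>c = t z / z\<close> has norm one over \<open>E\<close>, and its norm is congruent to a \<open>p\<close>-power of \<open>c\<close>.\<close>

lemma inertia_tame:
  assumes t: "t \<in> inertia" and z: "z \<in> L" "z \<noteq> \<zero>"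
  shows "w z < w (t z \<ominus> z)"
proof -
  note S = inertia_automorphisms
  have tG: "t \<in> G" using inertiaD(1)[OF t] .
  have zR: "z \<in> carrier R" using z L_carrier by auto
  obtain r where r: "w z = ereal r" using w_real zR z(2) by metis
  have tz: "t z \<in> L" "t z \<in> carrier R" "w (t z) = ereal r" using G_closed[OF tG z(1)] G_inv[OF tG z(1)] L_carrier r by auto
  have iz: "inv z \<in> L" "inv z \<in> carrier R" "inv z \<otimes> z = \<one>" "z \<otimes> inv z = \<one>" "w (inv z) = ereal (- r)"
    using subfield_inv[OF KL(2) z] L_carrier field_Units zR z(2) w_inv[OF zR z(2)] r by auto
  define c where "c = inv z \<otimes> t z"
  have cL: "c \<in> L" "c \<in> carrier R" unfolding c_def using L_closed(4)[OF iz(1) tz(1)] L_carrier by auto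
  have wc: "w c = 0" unfolding c_def using w_mult[OF iz(2) tz(2)] iz(5) tz(3) by (simp add: zero_ereal_def)
  have cO: "c \<in> O\<^sub>L" using cL wc by (simp add: vring_def)
  have zc: "z \<otimes> c = t z" unfolding c_def using m_assoc[OF zR iz(2) tz(2)] iz(4) tz(2) by simp
  define N where "N x = (\<Otimes>s\<in>inertia. s x)" for x
  have sR: "s x \<in> carrier R" if "s \<in> inertia" "x \<in> L" for s x using G_closed[OF inertiaD(1)[OF that(1)] that(2)] L_carrier by auto
  have "N (t z) = (\<Otimes>s\<in>inertia. compose L s t z)" unfolding N_def using z by (simp add: compose_def)
  also have "\<dots> = (\<Otimes>s\<in>(\<lambda>s. compose L s t) ` inertia. s z)"
    using compose_right_image[OF t] sR[OF _ z(1)] by (intro finprod_reindex[symmetric]) auto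
  also have "\<dots> = N z" unfolding compose_right_image(1)[OF t] N_def ..
  finally have Ntz: "N (t z) = N z" .
  have "N (t z) = (\<Otimes>s\<in>inertia. s z \<otimes> s c)" unfolding N_def
  proof (intro finprod_cong')
    show "(\<lambda>s. s z \<otimes> s c) \<in> inertia \<rightarrow> carrier R" using sR[OF _ z(1)] sR[OF _ cL(1)] by auto
    fix s assume s: "s \<in> inertia"
    show "s (t z) = s z \<otimes> s c" unfolding zc[symmetric] using endoD(2)[OF G_endo[OF inertiaD(1)[OF s]] z(1) cL(1)] .
  qed simp
  also have "\<dots> = N z \<otimes> N c" unfolding N_def using sR[OF _ z(1)] sR[OF _ cL(1)] by (intro finprod_multf) auto
  finally have e: "N z = N z \<otimes> N c" using Ntz by simp
  have NR: "N z \<in> carrier R" "N c \<in> carrier R" unfolding N_def using sR[OF _ z(1)] sR[OF _ cL(1)] by (auto intro!: finprod_closed)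
  have "w (N z) = ereal (real (card inertia) * r)" unfolding N_def
    using automorphismsD(1)[OF S] sR[OF _ z(1)] G_inv[OF inertiaD(1) z(1)] r by (intro w_finprod_const) auto
  then have Nz0: "N z \<noteq> \<zero>" by auto
  then have Nc: "N c = \<one>" using e NR m_lcancel[of "N z" "N c" \<one>] by simp
  obtain m where m: "card inertia = p ^ m" using card_inertia by blast
  have cp: "0 < w (N c \<ominus> c [^] (p ^ m))"
    unfolding N_def m[symmetric] using automorphismsD(1)[OF S] sR[OF _ cL(1)] cL wc inertiaD(2)[OF _ cO]
    by (intro cong_finprod) auto
  \<comment> \<open>The elements 1 and c have congruent p^m-th powers, so injectivity of Frobenius
    makes c congruent to 1.\<close>
  have "0 < w (\<one> [^] (p ^ m) \<ominus> c [^] (p ^ m))" using cp Nc by simp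
  then have "0 < w (\<one> \<ominus> c)" using frobenius_inj[of \<one> c m] cL wc by simp
  then have "0 < w (c \<ominus> \<one>)" using w_minus_commute[of \<one> c] cL by simp
  then have "0 < w (c \<ominus> \<one>)" .
  moreover have "t z \<ominus> z = (c \<ominus> \<one>) \<otimes> z" unfolding zc[symmetric] using zR cL(2) by algebra
  ultimately show ?thesis using w_mult_gt'[of "c \<ominus> \<one>" z r] r zR cL by simp
qed

end

section \<open>The tower of ferociously ramified steps\<close>

context valued_field
begin

lemma cong_pos:
  assumes "x \<in> carrier R" "y \<in> carrier R" "0 < w (x \<ominus> y)" "0 < w y" shows "0 < w x"
proof -
  have "x = (x \<ominus> y) \<oplus> y" using assms(1,2) by algebra
  then show ?thesis using w_add_gt[of "x \<ominus> y" y 0] assms by simp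
qed

lemma endo_trivial:
  assumes M: "subfield M R" and s: "s \<in> endo M" and triv: "\<And>x. x \<in> vring w M \<Longrightarrow> s x = x" and x: "x \<in> M"
  shows "s x = x"
proof (cases "0 \<le> w x")
  case True
  then show ?thesis using triv x by (auto simp: vring_def)
next
  case False
  then have x0: "x \<noteq> \<zero>" by auto
  have xR: "x \<in> carrier R" "s x \<in> carrier R" using x endoD(1)[OF s x] subfieldE(3)[OF M] by auto
  have "inv x \<in> vring w M" using False subfield_inv[OF M x x0] w_inv[OF xR(1) x0] by (auto simp: vring_def)
  then have "inv (s x) = inv x" using triv endo_inv[OF M s x x0] by simp
  moreover have "s x \<in> Units R" "x \<in> Units R" using endo_nonzero[OF M s x x0] xR x0 field_Units by auto
  ultimately show ?thesis by (metis Units_inv_inv)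
qed

end

context monogenic
begin

text \<open>\<open>M\<close> is the \<open>i\<close>-th step of the tower, counted downwards from \<open>L\<close>: its residue field is
  generated over that of \<open>E\<close> by the residue of \<open>y\<close>, which is the \<open>p^i\<close>-th power of that of \<open>\<alpha>\<close>.\<close>

definition chain :: "nat \<Rightarrow> 'a set \<Rightarrow> 'a \<Rightarrow> bool" where
  "chain i M y \<longleftrightarrow> subfield M R \<and> E \<subseteq> M \<and> M \<subseteq> L \<and> (\<forall>s\<in>inertia. \<forall>x\<in>M. s x \<in> M) \<and>
     (\<exists>d\<le>p ^ i. dimension d M L) \<and> y \<in> vring w M \<and> 0 < w (y \<ominus> \<alpha> [^] (p ^ i)) \<and>
     (\<forall>z\<in>vring w M. \<exists>c. (\<forall>j. c j \<in> vring w E) \<and> 0 < w (z \<ominus> polyf c (p ^ (q - i)) y))"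

lemma chainD:
  assumes "chain i M y"
  shows "subfield M R" "E \<subseteq> M" "M \<subseteq> L" "\<And>s x. s \<in> inertia \<Longrightarrow> x \<in> M \<Longrightarrow> s x \<in> M"
    "\<exists>d\<le>p ^ i. dimension d M L" "y \<in> vring w M" "0 < w (y \<ominus> \<alpha> [^] (p ^ i))"
    "\<And>z. z \<in> vring w M \<Longrightarrow> \<exists>c. (\<forall>j. c j \<in> vring w E) \<and> 0 < w (z \<ominus> polyf c (p ^ (q - i)) y)"
  using assms unfolding chain_def by blast+

lemma chain_y:
  assumes "chain i M y" shows "y \<in> O\<^sub>L" "y \<in> M" "y \<in> L" "y \<in> carrier R" "0 \<le> w y"
proof -
  show "y \<in> O\<^sub>L" "y \<in> M" using chainD(3,6)[OF assms] by (auto simp: vring_def)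
  then show "y \<in> L" "y \<in> carrier R" "0 \<le> w y" using OL_closed by auto
qed

lemma alpha_pow: "\<alpha> [^] (n::nat) \<in> O\<^sub>L" "\<alpha> [^] n \<in> carrier R" "0 \<le> w (\<alpha> [^] n)"
proof -
  show "\<alpha> [^] n \<in> O\<^sub>L" using OL_closed(4)[OF alpha(1)] .
  then show "\<alpha> [^] n \<in> carrier R" "0 \<le> w (\<alpha> [^] n)" using OL_closed(9,10) by auto
qed

lemma chain_0: "chain 0 L \<alpha>"
  unfolding chain_def
proof (intro conjI ballI)
  show "\<exists>d\<le>p ^ 0. dimension d L L" using dimension_one[OF KL(2)] by (intro exI[of _ 1]) simp
  show "s x \<in> L" if "s \<in> inertia" "x \<in> L" for s x using G_closed[OF inertiaD(1)[OF that(1)] that(2)] .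
  show "0 < w (\<alpha> \<ominus> \<alpha> [^] (p ^ 0))" using alpha(2) by (simp add: minus_self)
  show "\<exists>c. (\<forall>j. c j \<in> vring w E) \<and> 0 < w (z \<ominus> polyf c (p ^ (q - 0)) \<alpha>)" if "z \<in> O\<^sub>L" for z
    using residue_expansion[OF that] by simp
qed (use KL E_L alpha in auto)

lemma chain_pow:
  assumes "chain i M y" "i + k \<le> q"
  shows "0 < w (y [^] (p ^ k) \<ominus> \<alpha> [^] (p ^ (i + k)))"
proof -
  have "0 < w (y [^] (p ^ k) \<ominus> (\<alpha> [^] (p ^ i)) [^] (p ^ k))"
    using cong_pow[OF chain_y(4)[OF assms(1)] alpha_pow(2) chain_y(5)[OF assms(1)] chainD(7)[OF assms(1)]] .
  then show ?thesis using alpha(2) by (simp add: nat_pow_pow power_add)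
qed

text \<open>As y is congruent to \<alpha>^(p^i), the minimality of q passes to y with exponent q -
  i.\<close>

lemma chain_indep:
  assumes ch: "chain i M y" and i: "i \<le> q"
  shows "res_indep E y (p ^ (q - i))"
proof (rule res_indep_prime_power[OF chain_y(1)[OF ch]])
  fix b assume b: "b \<in> vring w E" "q - i > 0"
  have e: "i + (q - i - 1) = q - 1" "i + (q - i - 1) \<le> q" using b(2) by auto
  have bR: "b \<in> carrier R" using b E_closed(8) by (auto simp: vring_def)
  have yR: "y [^] (p ^ (q - i - 1)) \<in> carrier R" using chain_y(4)[OF ch] by simp
  have "0 < w (y [^] (p ^ (q - i - 1)) \<ominus> \<alpha> [^] (p ^ (q - 1)))" using chain_pow[OF ch e(2)] e(1) by simp
  then have c: "0 < w (\<alpha> [^] (p ^ (q - 1)) \<ominus> y [^] (p ^ (q - i - 1)))"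
    using w_minus_commute[OF yR alpha_pow(2)] by simp
  show "\<not> 0 < w (y [^] (p ^ (q - i - 1)) \<ominus> b)"
  proof
    assume "0 < w (y [^] (p ^ (q - i - 1)) \<ominus> b)"
    then have "0 < w (\<alpha> [^] (p ^ (q - 1)) \<ominus> b)" using cong_trans[OF alpha_pow(2) yR bR c] by simp
    then show False using q_min[OF b(1)] b(2) by simp
  qed
qed

text \<open>A uniformizer in \<open>M\<close> is found either in \<open>E\<close> or as \<open>y\<close> to a power divisible by \<open>p\<close> minus an
  element of \<open>E\<close>.\<close>

lemma chain_uniformizer:
  assumes ch: "chain i M y" and i: "i < q"
  shows "\<exists>u\<in>M. unif u \<and> (\<forall>t\<in>inertia. \<forall>r. ereal r \<le> w (t y \<ominus> y) \<longrightarrow> ereal r < w (t u \<ominus> u))"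
proof -
  note y = chain_y[OF ch]
  consider (g) "unif \<gamma>" | (e) u where "u \<in> E" "unif u" using uniformizer_cases by blast
  then show ?thesis
  proof cases
    case e
    have "u \<in> carrier R" using e(1) E_closed(8) by simp
    then have "ereal r < w (t u \<ominus> u)" if "t \<in> inertia" for t r
      using E_fixed[OF that e(1)] by (simp add: minus_self)
    then show ?thesis using e chainD(2)[OF ch] by blast
  next
    case g
    \<comment> \<open>As i < q, the exponent n = p^(q - i) is divisible by p, while y^n is still
      congruent to \<alpha>^(p^q).\<close>
    obtain k where k: "q = i + Suc k" using i by (metis add_Suc_right less_iff_Suc_add)
    define n where "n = p ^ Suc k"
    have pn: "p dvd n" by (simp add: n_def)
    have aR: "a \<in> carrier R" "a \<in> M" "a \<in> L" using a(1) E_closed chainD(2)[OF ch] by (auto simp: vring_def)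
    define u where "u = y [^] n \<ominus> a"
    have yn: "y [^] n \<in> carrier R" "y [^] n \<in> M" "y [^] n \<in> L"
      using y subring_pow[OF subfieldE(1)[OF chainD(1)[OF ch]] y(2)] L_closed(7) by auto
    have uM: "u \<in> M" unfolding u_def a_minus_def using yn(2) aR(2) subringE(5,7)[OF subfieldE(1)[OF chainD(1)[OF ch]]] by simp
    have uR: "u \<in> carrier R" "u \<in> L" using uM chainD(3)[OF ch] L_carrier by auto
    obtain m where m: "w \<gamma> = ereal m" using w_real gamma(2) g unfolding unif_def by metis
    have dmin: "w \<gamma> \<le> w x" if "x \<in> L" "0 < w x" for x using g that unfolding unif_def by blast
    have ai: "\<alpha> [^] (p ^ i) \<in> carrier R" "0 \<le> w (\<alpha> [^] (p ^ i))" "\<alpha> [^] (p ^ i) \<in> L" using alpha_pow OL_closed(8) by auto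
    have "(\<alpha> [^] (p ^ i)) [^] n = \<alpha> [^] (p ^ q)" unfolding n_def k using alpha(2) by (simp add: nat_pow_pow power_add mult_ac)
    \<comment> \<open>Since \<gamma> is a uniformizer, the error of y has valuation at least w
      \<gamma>; raising to the n-th power makes it strictly larger, which gives u = y^n - a the
      valuation of \<gamma>.\<close>
    moreover have "w \<gamma> \<le> w (y \<ominus> \<alpha> [^] (p ^ i))" using dmin[OF L_closed(6)[OF y(3) ai(3)] chainD(7)[OF ch]] .
    ultimately have "w \<gamma> < w (y [^] n \<ominus> \<alpha> [^] (p ^ q))"
      using pow_diff_gt[OF ai(1,2) y(4,5) pn chainD(7)[OF ch], of m] m by simp
    moreover have "u \<ominus> \<gamma> = y [^] n \<ominus> \<alpha> [^] (p ^ q)"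
      unfolding u_def \<gamma>_def using yn(1) aR(1) alpha_pow(2)[of "p ^ q"] by algebra
    ultimately have "w \<gamma> < w (\<gamma> \<ominus> u)" using w_minus_commute[OF gamma(2) uR(1)] by simp
    then have wu: "w u = w \<gamma>" using w_eq_of_close[OF gamma(2) uR(1)] by simp
    then have "unif u" using g uR unfolding unif_def by (metis w_inf gamma(2))
    moreover have "ereal r < w (t u \<ominus> u)" if t: "t \<in> inertia" and r: "ereal r \<le> w (t y \<ominus> y)" for t r
    proof -
      have te: "t \<in> endo L" using G_endo[OF inertiaD(1)[OF t]] .
      have ty: "t y \<in> O\<^sub>L" "t y \<in> carrier R" "0 \<le> w (t y)" using O_closed[OF inertiaD(1)[OF t] y(1)] OL_closed(9,10) by auto
      have "t u = t y [^] n \<ominus> a"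
        unfolding u_def using endo_minus[OF KL(2) te yn(3) aR(3)] endo_pow[OF KL(2) te y(3)] E_fixed[OF t] a(1) by (simp add: vring_def)
      moreover have "t y [^] n \<in> carrier R" using ty by simp
      ultimately have "t u \<ominus> u = t y [^] n \<ominus> y [^] n" unfolding u_def using yn(1) aR(1) by simp algebra
      then show ?thesis using pow_diff_gt[OF y(4,5) ty(2,3) pn inertiaD(2)[OF t y(1)] r] by simp
    qed
    ultimately show ?thesis using uM by blast
  qed
qed

text \<open>Write z = u v with the uniformizer u of \<open>chain_uniformizer\<close>. In t z - z = t
  v (t u - u) + u (t v - v) the first summand exceeds r by the choice of u, the second because w u >
  0.\<close>

lemma chain_maximal_ideal_moved:
  assumes ch: "chain i M y" and i: "i < q" and t: "t \<in> inertia"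
    and r: "\<And>z. z \<in> vring w M \<Longrightarrow> ereal r \<le> w (t z \<ominus> z)" and z: "z \<in> M" "0 < w z"
  shows "ereal r < w (t z \<ominus> z)"
proof -
  note M = chainD(1)[OF ch] and M_L = chainD(3)[OF ch]
  obtain u where u: "u \<in> M" "unif u" "ereal r \<le> w (t y \<ominus> y) \<longrightarrow> ereal r < w (t u \<ominus> u)"
    using chain_uniformizer[OF ch i] t by blast
  have uu: "ereal r < w (t u \<ominus> u)" using u(3) r[OF chainD(6)[OF ch]] by simp
  have u0: "u \<noteq> \<zero>" "0 < w u" "w u \<le> w z" using u(2) z M_L unfolding unif_def by auto
  have R: "u \<in> L" "u \<in> carrier R" "z \<in> L" "z \<in> carrier R" using u z M_L L_carrier by auto
  have te: "t \<in> endo L" using G_endo[OF inertiaD(1)[OF t]] .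
  have iu: "inv u \<in> M" "inv u \<in> carrier R" "u \<otimes> inv u = \<one>" using subfield_inv[OF M u(1) u0(1)] field_Units R u0(1) by auto
  define v where "v = inv u \<otimes> z"
  have vM: "v \<in> M" unfolding v_def using subringE(6)[OF subfieldE(1)[OF M] iu(1) z(1)] .
  have vL: "v \<in> L" "v \<in> carrier R" using vM M_L L_carrier by auto
  have "0 \<le> w v" unfolding v_def using w_divide_ge[OF R(4,2) u0(1,3)] .
  then have vV: "v \<in> vring w M" using vM by (simp add: vring_def)
  have uv: "u \<otimes> v = z" unfolding v_def using m_assoc[OF R(2) iu(2) R(4)] iu(3) R(4) by simp
  have tR: "t u \<in> carrier R" "t v \<in> carrier R" "0 \<le> w (t v)"
    using endoD(1)[OF te R(1)] endoD(1)[OF te vL(1)] L_carrier G_inv[OF inertiaD(1)[OF t] vL(1)] \<open>0 \<le> w v\<close> by auto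
  have "t z = t u \<otimes> t v" unfolding uv[symmetric] using endoD(2)[OF te R(1) vL(1)] .
  then have "t z \<ominus> z = t v \<otimes> (t u \<ominus> u) \<oplus> u \<otimes> (t v \<ominus> v)"
    unfolding uv[symmetric] using R(2) vL(2) tR by simp algebra
  moreover have "ereal r < w (t v \<otimes> (t u \<ominus> u))" using w_mult_gt[of "t v" "t u \<ominus> u" "ereal r"] tR uu R by simp
  moreover have "ereal r < w (u \<otimes> (t v \<ominus> v))" using w_mult_gt'[of u "t v \<ominus> v" r] u0(2) r[OF vV] tR vL R by simp
  ultimately show ?thesis using w_add_gt[of "t v \<otimes> (t u \<ominus> u)" "u \<otimes> (t v \<ominus> v)" "ereal r"] tR vL R by simp
qed

text \<open>Iterates, such as the zeroth, need not be extensional on L, hence the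
  restriction.\<close>

lemma inertia_funpow:
  assumes t: "t \<in> inertia"
  shows "restrict (t ^^ j) L \<in> inertia" "x \<in> L \<Longrightarrow> (t ^^ j) x \<in> L"
proof -
  have L: "(t ^^ j) x \<in> L" if "x \<in> L" for j x
    using that G_closed[OF inertiaD(1)[OF t]] by (induction j) auto
  show "restrict (t ^^ j) L \<in> inertia"
  proof (induction j)
    case 0
    have "restrict (t ^^ 0) L = (\<lambda>x\<in>L. x)" by (auto simp: restrict_def)
    then show ?case using id_in_inertia by metis
  next
    case (Suc j)
    have "restrict (t ^^ Suc j) L = compose L t (restrict (t ^^ j) L)" by (auto simp: compose_def)
    then show ?case using automorphismsD(5)[OF inertia_automorphisms t Suc] by metis
  qed
  show "x \<in> L \<Longrightarrow> (t ^^ j) x \<in> L" by (rule L)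
qed

text \<open>The element of inertia that moves \<open>\<alpha>\<close> least among those acting nontrivially on \<open>M\<close> will do:
  its \<open>p\<close>-th power and its commutators move \<open>\<alpha>\<close> less, hence act trivially on \<open>M\<close>.\<close>

lemma central_element:
  assumes ch: "chain i M y" and i: "i < q"
  shows "\<exists>t\<in>inertia. (\<exists>x\<in>M. t x \<noteq> x) \<and> (\<forall>s\<in>inertia. \<forall>x\<in>M. t (s x) = s (t x)) \<and> (\<forall>x\<in>M. (t ^^ p) x = x)"
proof -
  note S = inertia_automorphisms and M_L = chainD(3)[OF ch]
  define N where "N = {s \<in> inertia. \<exists>x\<in>M. s x \<noteq> x}"
  \<comment> \<open>If inertia acted trivially on M, then y would lie in E, and a p-power of it
    would contradict the minimality of q.\<close>
  have "N \<noteq> {}"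
  proof
    assume "N = {}"
    then have "M \<subseteq> E" using M_L by (auto simp: N_def E_def fixed_def)
    then have yE: "y \<in> vring w E" using chainD(6)[OF ch] by (auto simp: vring_def)
    have e: "i + (q - 1 - i) = q - 1" "i + (q - 1 - i) \<le> q" using i by auto
    define b where "b = y [^] (p ^ (q - 1 - i))"
    have b: "b \<in> vring w E" unfolding b_def using subring_pow[OF vring_subring[OF E_subfield] yE] .
    have "0 < w (b \<ominus> \<alpha> [^] (p ^ (q - 1)))" using chain_pow[OF ch e(2)] e(1) by (simp add: b_def)
    then have "0 < w (\<alpha> [^] (p ^ (q - 1)) \<ominus> b)"
      using w_minus_commute[OF alpha_pow(2), of b] b E_closed(8) by (auto simp: vring_def)
    then show False using q_min[OF b] i by simp
  qed
  moreover have "finite N" unfolding N_def using automorphismsD(1)[OF S] by simp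
  \<comment> \<open>Moving \<alpha> least means the largest valuation of s \<alpha> - \<alpha>,
    hence the maximum.\<close>
  ultimately have "Max ((\<lambda>s. w (s \<alpha> \<ominus> \<alpha>)) ` N) \<in> (\<lambda>s. w (s \<alpha> \<ominus> \<alpha>)) ` N" by (intro Max_in) auto
  then obtain t where t: "t \<in> N" "w (t \<alpha> \<ominus> \<alpha>) = Max ((\<lambda>s. w (s \<alpha> \<ominus> \<alpha>)) ` N)" by auto
  have tmax: "w (s \<alpha> \<ominus> \<alpha>) \<le> w (t \<alpha> \<ominus> \<alpha>)" if "s \<in> N" for s
    unfolding t(2) using that \<open>finite N\<close> by (intro Max_ge) auto
  have tI: "t \<in> inertia" using t(1) by (simp add: N_def)
  have triv: "s x = x" if "s \<in> inertia" "w (t \<alpha> \<ominus> \<alpha>) < w (s \<alpha> \<ominus> \<alpha>)" "x \<in> M" for s x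
  proof (rule ccontr)
    assume "s x \<noteq> x"
    then have "s \<in> N" using that by (auto simp: N_def)
    then show False using tmax that(2) by (meson not_le)
  qed
  have tG: "t \<in> G" and te: "t \<in> endo L" using inertiaD(1)[OF tI] G_endo by auto
  have aL: "\<alpha> \<in> L" using alpha_L .
  define d where "d = t \<alpha> \<ominus> \<alpha>"
  have ta: "t \<alpha> \<in> L" "t \<alpha> \<in> carrier R" using G_closed[OF tG aL] L_carrier by auto
  have dL: "d \<in> L" "d \<in> carrier R" unfolding d_def using L_closed(6)[OF ta(1) aL] L_carrier by auto
  have d0: "d \<noteq> \<zero>"
  proof
    assume "d = \<zero>"
    then have inf: "w (t \<alpha> \<ominus> (\<lambda>x\<in>L. x) \<alpha>) = \<infinity>" using aL by (simp add: d_def)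
    have fixO: "t x = x" if x: "x \<in> O\<^sub>L" for x
    proof -
      have xL: "x \<in> L" "x \<in> carrier R" "t x \<in> carrier R" using OL_closed x G_closed[OF tG] L_carrier by auto
      have "ereal r < w (t x \<ominus> x)" for r
        using close_on_OL[OF tG inertiaD(1)[OF id_in_inertia], of r x] inf x xL by simp
      then have "w (t x \<ominus> x) = \<infinity>" by (intro ereal_top) (use less_imp_le in blast)
      then show ?thesis using w_inf[of "t x \<ominus> x"] xL by simp
    qed
    have "t x = x" if "x \<in> M" for x
      using endo_trivial[OF KL(2) te fixO] that M_L by blast
    then show False using t(1) by (auto simp: N_def)
  qed
  obtain r where r: "w d = ereal r" using w_real dL d0 by metis
  have dpos: "0 < w d" unfolding d_def using inertiaD(2)[OF tI alpha(1)] .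
  \<comment> \<open>\<open>close_on_OL\<close> speaks of strict bounds only, so the weak bound is
    obtained by contradiction, with v the valuation of t z - z itself.\<close>
  have tr: "ereal r \<le> w (t z \<ominus> z)" if z: "z \<in> O\<^sub>L" for z
  proof (rule ccontr)
    assume n: "\<not> ?thesis"
    have zR: "z \<in> L" "z \<in> carrier R" using OL_closed z by auto
    moreover have "t z \<in> carrier R" using G_closed[OF tG zR(1)] L_carrier by auto
    ultimately have tz: "t z \<ominus> z \<in> carrier R" by simp
    have "t z \<ominus> z \<noteq> \<zero>" using n by auto
    then obtain v where v: "w (t z \<ominus> z) = ereal v" using w_real tz by metis
    then have "ereal v < w (t \<alpha> \<ominus> (\<lambda>x\<in>L. x) \<alpha>)" using n r aL by (simp add: d_def)
    then show False using close_on_OL[OF tG inertiaD(1)[OF id_in_inertia] _ z] v zR(1) by fastforce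
  qed
  have "t (s x) = s (t x)" if s: "s \<in> inertia" and x: "x \<in> M" for s x
  proof -
    have sG: "s \<in> G" and se: "s \<in> endo L" using inertiaD(1)[OF s] G_endo by auto
    define e where "e = s \<alpha> \<ominus> \<alpha>"
    have sa: "s \<alpha> \<in> L" "s \<alpha> \<in> carrier R" using G_closed[OF sG aL] L_carrier by auto
    have eL: "e \<in> L" "e \<in> carrier R" unfolding e_def using L_closed(6)[OF sa(1) aL] L_carrier by auto
    have sd: "s d \<in> L" "s d \<in> carrier R" "t e \<in> L" "t e \<in> carrier R"
      using G_closed[OF sG dL(1)] G_closed[OF tG eL(1)] L_carrier by auto
    have st: "s (t \<alpha>) = s d \<oplus> s \<alpha>"
    proof -
      have "t \<alpha> = d \<oplus> \<alpha>" unfolding d_def using ta alpha(2) by algebra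
      then show ?thesis using endoD(3)[OF se dL(1) aL] by simp
    qed
    have ts: "t (s \<alpha>) = t e \<oplus> t \<alpha>"
    proof -
      have "s \<alpha> = e \<oplus> \<alpha>" unfolding e_def using sa alpha(2) by algebra
      then show ?thesis using endoD(3)[OF te eL(1) aL] by simp
    qed
    have sta: "s (t \<alpha>) \<in> L" "t (s \<alpha>) \<in> L" using G_closed[OF sG ta(1)] G_closed[OF tG sa(1)] by auto
    \<comment> \<open>Both brackets have valuation above r: the first by \<open>inertia_tame\<close>
      for d, the second because e lies in the maximal ideal of L, by
      \<open>chain_maximal_ideal_moved\<close> for the initial chain
      \<open>chain 0 L \<alpha>\<close>.\<close>
    have "s (t \<alpha>) \<ominus> t (s \<alpha>) = (s d \<ominus> d) \<ominus> (t e \<ominus> e)"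
      unfolding st ts using d_def e_def ta sa sd dL eL alpha(2) by algebra
    moreover have "ereal r < w (s d \<ominus> d)" using inertia_tame[OF s dL(1) d0] r by simp
    moreover have "ereal r < w (t e \<ominus> e)"
      using chain_maximal_ideal_moved[OF chain_0 _ tI tr eL(1)] inertiaD(2)[OF s alpha(1)] i e_def by simp
    ultimately have lt: "ereal r < w (s (t \<alpha>) \<ominus> t (s \<alpha>))" using w_minus_gt[of "s d \<ominus> d" "t e \<ominus> e"] sd dL eL by simp
    define h where "h = compose L t s"
    have hI: "h \<in> inertia" unfolding h_def using automorphismsD(5)[OF S tI s] .
    obtain u where u: "u \<in> inertia" "\<forall>x\<in>L. h (u x) = x \<and> u (h x) = x" using automorphisms_inverse[OF KL(2) S hI] by blast
    have uG: "u \<in> G" using inertiaD(1)[OF u(1)] .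
    \<comment> \<open>The inverse of t s composed with s t. The valuation of \<rho> \<alpha> -
      \<alpha> is above r, so \<rho> is trivial on M, which is commutation there.\<close>
    define \<rho> where "\<rho> = compose L u (compose L s t)"
    have rI: "\<rho> \<in> inertia" unfolding \<rho>_def using automorphismsD(5)[OF S u(1) automorphismsD(5)[OF S s tI]] .
    have "h \<alpha> = t (s \<alpha>)" using aL by (simp add: h_def compose_def)
    then have "u (t (s \<alpha>)) = \<alpha>" using u(2) aL by metis
    moreover have "\<rho> \<alpha> = u (s (t \<alpha>))" using aL by (simp add: \<rho>_def compose_def)
    ultimately have "\<rho> \<alpha> \<ominus> \<alpha> = u (s (t \<alpha>) \<ominus> t (s \<alpha>))" using endo_minus[OF KL(2) G_endo[OF uG] sta] by simp
    then have "w (t \<alpha> \<ominus> \<alpha>) < w (\<rho> \<alpha> \<ominus> \<alpha>)" using G_inv[OF uG L_closed(6)[OF sta]] lt r by (simp add: d_def)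
    then have rx: "\<rho> x = x" using triv rI x by blast
    have xL: "x \<in> L" using x M_L by auto
    then have ux: "u (s (t x)) = x" using rx by (simp add: \<rho>_def compose_def)
    have "s (t x) \<in> L" using G_closed[OF sG G_closed[OF tG xL]] .
    then have "s (t x) = h x" using u(2) ux by metis
    then show ?thesis using xL by (simp add: h_def compose_def)
  qed
  moreover have "(t ^^ p) x = x" if x: "x \<in> M" for x
  proof -
    have nd: "[j] \<cdot> d \<in> carrier R" for j :: nat using dL by simp
    have tj: "(t ^^ j) \<alpha> \<in> carrier R" for j using inertia_funpow(2)[OF tI aL] L_carrier by auto
    \<comment> \<open>Modulo elements of valuation above r the iterates add up: t^j \<alpha> is
      \<alpha> + j d. For j = p the multiple p d itself has valuation above r.\<close>
    have step: "ereal r < w ((t ^^ j) \<alpha> \<ominus> \<alpha> \<ominus> [j] \<cdot> d)" for j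
    proof (induction j)
      case 0
      show ?case using alpha(2) by (simp add: minus_self)
    next
      case (Suc j)
      define s where "s = restrict (t ^^ j) L"
      have s: "s \<in> inertia" unfolding s_def using inertia_funpow(1)[OF tI] .
      have se: "s \<in> endo L" using G_endo[OF inertiaD(1)[OF s]] .
      have sd: "s d \<in> carrier R" using endoD(1)[OF se dL(1)] L_carrier by auto
      have e: "t \<alpha> = d \<oplus> \<alpha>" unfolding d_def using ta alpha(2) by algebra
      have "(t ^^ Suc j) \<alpha> = s (t \<alpha>)" using ta(1) by (simp add: s_def funpow_swap1)
      also have "\<dots> = s d \<oplus> (t ^^ j) \<alpha>" unfolding e using endoD(3)[OF se dL(1) aL] aL by (simp add: s_def)
      finally have f: "(t ^^ Suc j) \<alpha> = s d \<oplus> (t ^^ j) \<alpha>" .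
      have n: "[Suc j] \<cdot> d = [j] \<cdot> d \<oplus> d" using dL by simp
      have "(t ^^ Suc j) \<alpha> \<ominus> \<alpha> \<ominus> [Suc j] \<cdot> d = (s d \<ominus> d) \<oplus> ((t ^^ j) \<alpha> \<ominus> \<alpha> \<ominus> [j] \<cdot> d)"
        unfolding f n using sd dL(2) tj[of j] nd[of j] alpha(2) by algebra
      moreover have "ereal r < w (s d \<ominus> d)" using inertia_tame[OF s dL(1) d0] r by simp
      ultimately show ?case using w_add_gt[OF _ _ _ Suc, of "s d \<ominus> d"] sd dL(2) tj[of j] nd[of j] alpha(2) by simp
    qed
    have "[p] \<cdot> d = ([p] \<cdot> \<one>) \<otimes> d" using dL(2) add_pow_ldistr[of \<one> d p] by simp
    then have "ereal r < w ([p] \<cdot> d)" using w_mult_gt'[OF _ dL(2) w_p, of r] r by simp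
    moreover have "(t ^^ p) \<alpha> \<ominus> \<alpha> = ((t ^^ p) \<alpha> \<ominus> \<alpha> \<ominus> [p] \<cdot> d) \<oplus> [p] \<cdot> d"
      using tj[of p] nd[of p] alpha(2) by algebra
    ultimately have "ereal r < w ((t ^^ p) \<alpha> \<ominus> \<alpha>)"
      using w_add_gt[OF _ nd[of p] step[of p]] tj[of p] nd[of p] alpha(2) by simp
    then have "w (t \<alpha> \<ominus> \<alpha>) < w (restrict (t ^^ p) L \<alpha> \<ominus> \<alpha>)" using r aL by (simp add: d_def)
    then have "restrict (t ^^ p) L x = x" using triv inertia_funpow(1)[OF tI] x by blast
    then show ?thesis using x M_L by auto
  qed
  ultimately show ?thesis using tI t(1) unfolding N_def by blast
qed

text \<open>The iterates t^j with j < p form a group on M, and Artin gives degree at most p over its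
  fixed field. No lower bound is kept: equality comes out in \<open>top_dimension\<close>.\<close>

lemma chain_fixed_field:
  assumes ch: "chain i M y" and t: "t \<in> inertia" and order: "\<And>x. x \<in> M \<Longrightarrow> (t ^^ p) x = x"
  shows "subfield {x \<in> M. t x = x} R" "\<exists>d\<le>p ^ Suc i. dimension d {x \<in> M. t x = x} L"
proof -
  note M = chainD(1)[OF ch] and M_L = chainD(3)[OF ch]
  have p1: "1 < p" using p_prime prime_gt_1_nat by blast
  define S where "S = (\<lambda>j. restrict (t ^^ j) M) ` {..<p}"
  have tM: "(t ^^ j) x \<in> M" if "x \<in> M" for j x
    using that chainD(4)[OF ch t] by (induction j) auto
  have te: "restrict (t ^^ j) M \<in> endo M" for j
  proof -
    have e: "restrict (t ^^ j) L \<in> endo L" using G_endo[OF inertiaD(1)[OF inertia_funpow(1)[OF t]]] .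
    note Ms = subringE[OF subfieldE(1)[OF M]]
    show ?thesis
    proof (rule endoI)
      fix x y assume xy: "x \<in> M" "y \<in> M"
      then have "x \<in> L" "y \<in> L" "x \<otimes> y \<in> M" "x \<oplus> y \<in> M" "x \<otimes> y \<in> L" "x \<oplus> y \<in> L" using M_L Ms(6,7) by auto
      then show "restrict (t ^^ j) M (x \<otimes> y) = restrict (t ^^ j) M x \<otimes> restrict (t ^^ j) M y"
        "restrict (t ^^ j) M (x \<oplus> y) = restrict (t ^^ j) M x \<oplus> restrict (t ^^ j) M y"
        using endoD(2,3)[OF e, of x y] xy by auto
    qed (use tM Ms(3) M_L endoD(4)[OF e] in auto)
  qed
  have S: "automorphisms M S" unfolding automorphisms_def
  proof (intro conjI ballI)
    have "restrict (t ^^ 0) M = (\<lambda>x\<in>M. x)" by (auto simp: restrict_def)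
    moreover have "restrict (t ^^ 0) M \<in> S" unfolding S_def using p1 by (intro imageI) simp
    ultimately show "(\<lambda>x\<in>M. x) \<in> S" by metis
  next
    fix f h assume "f \<in> S" "h \<in> S"
    then obtain j k where jk: "f = restrict (t ^^ j) M" "h = restrict (t ^^ k) M" unfolding S_def by blast
    have "compose M f h = restrict (t ^^ ((j + k) mod p)) M"
    proof
      fix x show "compose M f h x = restrict (t ^^ ((j + k) mod p)) M x"
        using funpow_mod_eq[OF order, of x "j + k"] tM[of x k] by (simp add: jk compose_def funpow_add)
    qed
    then show "compose M f h \<in> S" unfolding S_def using p1 by auto
  qed (use te in \<open>auto simp: S_def\<close>)
  have fix_pow: "(t ^^ j) x = x" if "t x = x" for j x using that by (induction j) auto
  have "fixed M S = {x \<in> M. t x = x}"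
  proof (intro equalityI subsetI)
    fix x assume x: "x \<in> fixed M S"
    have "restrict (t ^^ 1) M \<in> S" unfolding S_def using p1 by blast
    then show "x \<in> {x \<in> M. t x = x}" using fixedD[OF x] by fastforce
  qed (auto simp: fixed_def S_def fix_pow)
  moreover have "card S \<le> p" unfolding S_def using card_image_le[of "{..<p}"] by simp
  ultimately obtain m where m: "m \<le> p" "dimension m {x \<in> M. t x = x} M" using artin[OF M S] by (metis order_trans)
  show sub: "subfield {x \<in> M. t x = x} R"
    using fixed_subfield[OF M automorphismsD(6)[OF S]] \<open>fixed M S = _\<close> by simp
  obtain d where d: "d \<le> p ^ i" "dimension d M L" using chainD(5)[OF ch] by blast
  have "dimension (m * d) {x \<in> M. t x = x} L" using telescopic_base[OF sub M m(2) d(2)] .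
  moreover have "m * d \<le> p ^ Suc i" using mult_le_mono[OF m(1) d(1)] by simp
  ultimately show "\<exists>d\<le>p ^ Suc i. dimension d {x \<in> M. t x = x} L" by blast
qed

text \<open>The element sought is the norm of y under the iterates of t: its p factors are all
  congruent to y. Invariance follows by cancelling y in y y' = y (t y').\<close>

lemma chain_norm:
  assumes ch: "chain i M y" and i: "i < q" and t: "t \<in> inertia" and order: "\<And>x. x \<in> M \<Longrightarrow> (t ^^ p) x = x"
  shows "\<exists>y'\<in>vring w {x \<in> M. t x = x}. 0 < w (y' \<ominus> y [^] p)"
proof -
  note M = chainD(1)[OF ch] and M_L = chainD(3)[OF ch]
  obtain m where m: "p = Suc m" using p_prime prime_gt_0_nat gr0_conv_Suc by blast
  have te: "t \<in> endo L" using G_endo[OF inertiaD(1)[OF t]] .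
  define f where "f j = (t ^^ j) y" for j
  have tM: "f j \<in> M" for j unfolding f_def
    using chain_y(2)[OF ch] chainD(4)[OF ch t] by (induction j) auto
  have fI: "0 < w (f j \<ominus> y)" for j
    using inertiaD(2)[OF inertia_funpow(1)[OF t] chain_y(1)[OF ch], of j] chain_y(3)[OF ch] by (simp add: f_def)
  have fL: "f j \<in> L" "f j \<in> carrier R" for j using tM M_L L_carrier by auto
  have fV: "f j \<in> vring w M" for j
  proof -
    have "0 < w (y \<ominus> f j)" using fI w_minus_commute[OF fL(2) chain_y(4)[OF ch]] by simp
    then show ?thesis using cong_nonneg[OF chain_y(4)[OF ch] fL(2) chain_y(5)[OF ch]] tM by (simp add: vring_def)
  qed
  define y' where "y' = (\<Otimes>j\<in>{..m}. f j)"
  have y'V: "y' \<in> vring w M" unfolding y'_def by (rule finprod_in_subring[OF vring_subring[OF M] fV])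
  have y'R: "y' \<in> carrier R" "y' \<in> M" using y'V subfieldE(3)[OF M] by (auto simp: vring_def)
  \<comment> \<open>Needed for the cancellation below; y = 0 would make \<alpha>^(p^(q - 1))
    congruent to 0, an element of E.\<close>
  have y0: "y \<noteq> \<zero>"
  proof
    assume y0: "y = \<zero>"
    have e: "i + (q - 1 - i) = q - 1" "i + (q - 1 - i) \<le> q" using i by auto
    have "p ^ (q - 1 - i) \<noteq> 0" using m by simp
    then have "y [^] (p ^ (q - 1 - i)) = \<zero>" using y0 by (simp add: nat_pow_zero)
    then have "0 < w (\<zero> \<ominus> \<alpha> [^] (p ^ (q - 1)))" using chain_pow[OF ch e(2)] e(1) by simp
    then have "0 < w (\<alpha> [^] (p ^ (q - 1)) \<ominus> \<zero>)" using w_minus_commute[OF zero_closed alpha_pow(2)] by simp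
    then show False using q_min[of \<zero>] i E_closed(1) by (simp add: vring_def)
  qed
  have ty: "t y' = (\<Otimes>j\<in>{..m}. f (Suc j))"
  proof -
    have "t y' = (\<Otimes>j\<in>{..m}. t (f j))" unfolding y'_def by (rule endo_finprod[OF KL(2) te fL(1)]) simp
    then show ?thesis by (simp add: f_def)
  qed
  have tyR: "t y' \<in> carrier R" using endoD(1)[OF te] y'R M_L L_carrier by auto
  \<comment> \<open>The product of f 0, ..., f (m + 1) is split once at its last and once at its
    first factor.\<close>
  have "f \<in> {..Suc m} \<rightarrow> carrier R" using fL(2) by auto
  then have "f (Suc m) \<otimes> y' = t y' \<otimes> f 0"
    using finprod_Suc[of f m] finprod_Suc2[of f m] unfolding ty unfolding y'_def by simp
  moreover have "f (Suc m) = y" "f 0 = y" using order[OF chain_y(2)[OF ch]] m by (auto simp: f_def)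
  ultimately have "y \<otimes> y' = y \<otimes> t y'" using m_comm tyR chain_y(4)[OF ch] by simp
  then have "t y' = y'" using m_lcancel[OF y0 chain_y(4)[OF ch] y'R(1) tyR] by simp
  moreover have "0 < w (y' \<ominus> y [^] p)"
    using cong_finprod[of "{..m}" f y] fL(2) chain_y[OF ch] fI unfolding y'_def by (simp add: m)
  ultimately show ?thesis using y'V by (auto simp: vring_def)
qed

lemma OE_coeffs:
  assumes "\<And>j. c j \<in> vring w E"
  shows "c j \<in> vring w (carrier R)" "c j \<in> carrier R" "0 \<le> w (c j)"
  using assms[of j] E_closed(8) by (auto simp: vring_def)

text \<open>If \<open>z\<close> is fixed by \<open>t\<close>, then the derivative of its expansion in \<open>y\<close> vanishes in the residue
  field: otherwise \<open>t\<close> would move \<open>z\<close> exactly as much as \<open>y\<close>, which is least possible.\<close>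

lemma chain_fixed_expansion:
  assumes ch: "chain i M y" and i: "i < q" and t: "t \<in> inertia" and nt: "x \<in> M" "t x \<noteq> x"
    and y': "y' \<in> carrier R" "0 < w (y' \<ominus> y [^] p)"
    and z: "z \<in> vring w M" "t z = z"
  shows "\<exists>c. (\<forall>j. c j \<in> vring w E) \<and> 0 < w (z \<ominus> polyf c (p ^ (q - Suc i)) y')"
proof -
  note M = chainD(1)[OF ch] and M_L = chainD(3)[OF ch] and y = chain_y[OF ch]
  define n where "n = p ^ (q - i)"
  have te: "t \<in> endo L" using G_endo[OF inertiaD(1)[OF t]] .
  have tR: "t u \<in> carrier R" "t u \<in> L" if "u \<in> L" for u using G_closed[OF inertiaD(1)[OF t] that] L_carrier by auto
  have teM: "t \<in> endo M"
  proof (rule endoI)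
    fix u v assume "u \<in> M" "v \<in> M"
    then have "u \<in> L" "v \<in> L" using M_L by auto
    then show "t (u \<otimes> v) = t u \<otimes> t v" "t (u \<oplus> v) = t u \<oplus> t v" using endoD(2,3)[OF te] by auto
  qed (use chainD(4)[OF ch t] endoD(4)[OF te] in auto)
  have V_L: "u \<in> L" "u \<in> carrier R" "u \<in> O\<^sub>L" if "u \<in> vring w M" for u
    using that M_L L_carrier by (auto simp: vring_def)
  have ty: "t y \<in> O\<^sub>L" "t y \<in> carrier R" "t y \<in> vring w (carrier R)"
    using O_closed[OF inertiaD(1)[OF t] y(1)] OL_closed(9,11) by auto
  have "(\<lambda>u. t u \<ominus> u) ` vring w M \<subseteq> O\<^sub>L"
    using O_closed[OF inertiaD(1)[OF t]] V_L OL_closed(3) by blast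
  moreover have "(\<lambda>u. t u \<ominus> u) ` vring w M \<noteq> {}" using chainD(6)[OF ch] by blast
  ultimately have "\<exists>x\<in>(\<lambda>u. t u \<ominus> u) ` vring w M. \<forall>v\<in>(\<lambda>u. t u \<ominus> u) ` vring w M. w x \<le> w v" by (rule min_value)
  then obtain z0 where z0: "z0 \<in> vring w M" and min: "\<And>u. u \<in> vring w M \<Longrightarrow> w (t z0 \<ominus> z0) \<le> w (t u \<ominus> u)"
    by blast
  have dR: "t u \<ominus> u \<in> carrier R" if "u \<in> vring w M" for u using V_L[OF that] tR by simp
  have "t z0 \<ominus> z0 \<noteq> \<zero>"
  proof
    assume "t z0 \<ominus> z0 = \<zero>"
    then have "w (t u \<ominus> u) = \<infinity>" if "u \<in> vring w M" for u using min[OF that] by simp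
    then have "t u \<ominus> u = \<zero>" if "u \<in> vring w M" for u using w_inf[OF dR[OF that]] that by simp
    then have "t u = u" if "u \<in> vring w M" for u using r_right_minus_eq tR(1) V_L that by blast
    then show False using endo_trivial[OF M teM _ nt(1)] nt(2) by blast
  qed
  then obtain r where r: "w (t z0 \<ominus> z0) = ereal r" using w_real dR[OF z0] by metis
  have hr: "ereal r \<le> w (t u \<ominus> u)" if "u \<in> vring w M" for u using min[OF that] r by simp
  \<comment> \<open>Only the polynomial part of the expansion of u counts: the remainder lies in the
    maximal ideal, and its contribution \<zeta> has valuation above r.\<close>
  have expand: "\<exists>c \<zeta>. (\<forall>j. c j \<in> vring w E) \<and> \<zeta> \<in> carrier R \<and> ereal r < w \<zeta> \<and> 0 < w (u \<ominus> polyf c n y) \<and>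
      t u \<ominus> u = (polyf c n (t y) \<ominus> polyf c n y) \<oplus> \<zeta>" if u: "u \<in> vring w M" for u
  proof -
    obtain c where c: "\<And>j. c j \<in> vring w E" "0 < w (u \<ominus> polyf c n y)" using chainD(8)[OF ch u] unfolding n_def by blast
    define P where "P = polyf c n y"
    have cE: "c j \<in> M" "t (c j) = c j" "c j \<in> carrier R" for j
      using c(1)[of j] chainD(2)[OF ch] E_fixed[OF t] E_closed(8) by (auto simp: vring_def)
    have tP: "t P = polyf c n (t y)" "P \<in> M"
      unfolding P_def using endo_polyf[where c = c, OF M teM cE(1,2) y(2)] by auto
    define e where "e = u \<ominus> P"
    have eM: "e \<in> M" unfolding e_def a_minus_def using u tP(2) subringE(5,7)[OF subfieldE(1)[OF M]] by (auto simp: vring_def)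
    have L: "e \<in> L" "e \<in> carrier R" "P \<in> L" "P \<in> carrier R" using eM tP(2) M_L L_carrier by auto
    have "u = P \<oplus> e" unfolding e_def using L(4) V_L(2)[OF u] by algebra
    then have "t u \<ominus> u = (t P \<oplus> t e) \<ominus> (P \<oplus> e)" using endoD(3)[OF te L(3,1)] by simp
    also have "\<dots> = (t P \<ominus> P) \<oplus> (t e \<ominus> e)" using L tR(1)[OF L(1)] tR(1)[OF L(3)] by algebra
    finally have "t u \<ominus> u = (polyf c n (t y) \<ominus> polyf c n y) \<oplus> (t e \<ominus> e)" unfolding tP(1) unfolding P_def .
    moreover have "ereal r < w (t e \<ominus> e)"
      using chain_maximal_ideal_moved[OF ch i t hr eM] c(2) by (simp add: e_def P_def)
    ultimately show ?thesis using c L(2) tR(1)[OF L(1)] by (intro exI[of _ c] exI[of _ "t e \<ominus> e"]) auto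
  qed
  have yV: "y \<in> vring w (carrier R)" using y by (simp add: vring_def)
  \<comment> \<open>The minimum r is attained at y: otherwise the polynomial part of every
    expansion, and with it t z0 - z0, would have valuation above r.\<close>
  have "w (t y \<ominus> y) = ereal r"
  proof (rule antisym)
    obtain c \<zeta> where c: "\<And>j. c j \<in> vring w E" "\<zeta> \<in> carrier R" "ereal r < w \<zeta>"
        "t z0 \<ominus> z0 = (polyf c n (t y) \<ominus> polyf c n y) \<oplus> \<zeta>" using expand[OF z0] by blast
    have PR: "polyf c n (t y) \<ominus> polyf c n y \<in> carrier R"
      using polyf_closed(1)[of n c "t y"] polyf_closed(1)[of n c y] OE_coeffs(2)[where c = c, OF c(1)] ty y by auto
    have "\<not> ereal r < w (polyf c n (t y) \<ominus> polyf c n y)"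
      using w_add_gt[OF PR c(2) _ c(3)] c(4) r by auto
    then show "w (t y \<ominus> y) \<le> ereal r"
      using w_polyf_diff(1)[of n c y "t y"] OE_coeffs(1)[where c = c, OF c(1)] yV ty(3) by (meson not_le order_trans)
  qed (rule hr[OF chainD(6)[OF ch]])
  note yr = this
  obtain c \<zeta> where c: "\<And>j. c j \<in> vring w E" "\<zeta> \<in> carrier R" "ereal r < w \<zeta>" "0 < w (z \<ominus> polyf c n y)"
      "t z \<ominus> z = (polyf c n (t y) \<ominus> polyf c n y) \<oplus> \<zeta>" using expand[OF z(1)] by blast
  note cV = OE_coeffs[where c = c, OF c(1)]
  have PR: "polyf c n (t y) \<in> carrier R" "polyf c n y \<in> carrier R" "dpolyf c n y \<in> carrier R" "0 \<le> w (dpolyf c n y)"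
    using polyf_closed(1)[of n c "t y"] polyf_closed[of n c y] cV(2) ty y
      OL_polyf(2)[of c y n] OE_closed[OF c(1)] OL_closed(10) by auto
  have "t z \<ominus> z = \<zero>" using z(2) V_L(2)[OF z(1)] by (simp add: minus_self)
  then have "polyf c n (t y) \<ominus> polyf c n y = \<ominus> \<zeta>"
    using c(5) PR c(2) minus_equality[of "polyf c n (t y) \<ominus> polyf c n y" \<zeta>] by (metis minus_closed minus_minus)
  then have "ereal r < w (polyf c n (t y) \<ominus> polyf c n y)" using c(2,3) by simp
  then have "w (dpolyf c n y) \<noteq> 0"
    using w_polyf_diff(3)[of n c y "t y"] cV(1) yV ty(3) inertiaD(2)[OF t y(1)] yr by auto
  then have dpos: "0 < w (dpolyf c n y)" using PR(4) by simp
  define k where "k = p ^ (q - Suc i)"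
  have n: "n = p * k" unfolding n_def k_def using i by (simp add: Suc_diff_Suc flip: power_Suc)
  have nd: "0 < w (c j)" if "j < p * k" "\<not> p dvd j" for j
    using w_nondivisible_coeffs[where c = c, OF chain_indep[OF ch less_imp_le[OF i]] y(1) c(1)] dpos that n
    unfolding n_def by metis
  have yp: "y [^] p \<in> vring w (carrier R)" "y [^] p \<in> carrier R"
    using OL_closed(9,11)[OF OL_closed(4)[OF y(1)]] by auto
  have y'V: "y' \<in> vring w (carrier R)"
    using cong_nonneg[OF yp(2) y'(1)] yp(1) y'(2) w_minus_commute[OF y'(1) yp(2)] y'(1) by (simp add: vring_def)
  let ?c = "\<lambda>l. c (p * l)"
  have PR': "polyf ?c k (y [^] p) \<in> carrier R" "polyf ?c k y' \<in> carrier R"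
    using polyf_closed(1)[of k ?c] cV(2) yp(2) y'(1) by auto
  have "0 < w (polyf c n y \<ominus> polyf ?c k (y [^] p))"
    unfolding n by (rule polyf_frobenius_split[OF y(4,5) cV(2,3) nd])
  then have "0 < w (z \<ominus> polyf ?c k (y [^] p))"
    using cong_trans[OF V_L(2)[OF z(1)] PR(2) PR'(1) c(4)] by simp
  moreover have "0 < w (polyf ?c k (y [^] p) \<ominus> polyf ?c k y')"
    using w_polyf_diff(1)[of k ?c "y [^] p" y'] cV(1) yp(1) y'V y'(2) w_minus_commute[OF PR'] by auto
  ultimately have "0 < w (z \<ominus> polyf ?c k y')"
    using cong_trans[OF V_L(2)[OF z(1)] PR'(1,2)] by simp
  then show ?thesis unfolding k_def using c(1) by (intro exI[of _ ?c]) auto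
qed

lemma chain_Suc:
  assumes ch: "chain i M y" and i: "i < q"
  shows "\<exists>M' y'. chain (Suc i) M' y'"
proof -
  obtain t x where t: "t \<in> inertia" and x: "x \<in> M" "t x \<noteq> x"
    and comm: "\<And>s x. s \<in> inertia \<Longrightarrow> x \<in> M \<Longrightarrow> t (s x) = s (t x)" and order: "\<And>x. x \<in> M \<Longrightarrow> (t ^^ p) x = x"
    using central_element[OF ch i] by blast
  let ?M = "{x \<in> M. t x = x}"
  obtain y' where y': "y' \<in> vring w ?M" "0 < w (y' \<ominus> y [^] p)" using chain_norm[OF ch i t order] by blast
  have y'R: "y' \<in> carrier R" using y'(1) subfieldE(3)[OF chainD(1)[OF ch]] by (auto simp: vring_def)
  have "chain (Suc i) ?M y'" unfolding chain_def
  proof (intro conjI ballI)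
    show "subfield ?M R" "\<exists>d\<le>p ^ Suc i. dimension d ?M L" using chain_fixed_field[OF ch t order] by auto
    show "E \<subseteq> ?M" using chainD(2)[OF ch] E_fixed[OF t] by auto
    show "?M \<subseteq> L" using chainD(3)[OF ch] by auto
    \<comment> \<open>Stability under inertia is where the commutation of t with inertia
      enters.\<close>
    show "s x \<in> ?M" if "s \<in> inertia" "x \<in> ?M" for s x using that chainD(4)[OF ch] comm by auto
    show "y' \<in> vring w ?M" using y'(1) .
    have e: "(\<alpha> [^] (p ^ i)) [^] p = \<alpha> [^] (p ^ Suc i)" using alpha(2) by (simp add: nat_pow_pow mult.commute)
    have "0 < w (y [^] p \<ominus> \<alpha> [^] (p ^ Suc i))"
      using cong_pow[OF chain_y(4)[OF ch] alpha_pow(2) chain_y(5)[OF ch] chainD(7)[OF ch], of p] unfolding e .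
    then show "0 < w (y' \<ominus> \<alpha> [^] (p ^ Suc i))"
      using cong_trans[OF y'R _ alpha_pow(2) y'(2)] chain_y(4)[OF ch] by simp
    show "\<exists>c. (\<forall>j. c j \<in> vring w E) \<and> 0 < w (z \<ominus> polyf c (p ^ (q - Suc i)) y')" if "z \<in> vring w ?M" for z
      using chain_fixed_expansion[OF ch i t x y'R y'(2)] that by (auto simp: vring_def)
  qed
  then show ?thesis by blast
qed

lemma chain_exists: "i \<le> q \<Longrightarrow> \<exists>M y. chain i M y"
proof (induction i)
  case 0
  then show ?case using chain_0 by blast
next
  case (Suc i)
  then show ?case using chain_Suc by (metis Suc_le_lessD less_imp_le)
qed

section \<open>The last field T of the descent\<close>

text \<open>For i = q the expansion in y has p^0 = 1 term, so every residue of T comes from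
  E.\<close>

lemma top_residue:
  assumes T: "chain q T y" and z: "z \<in> vring w T"
  shows "\<exists>b\<in>vring w E. 0 < w (z \<ominus> b)"
proof -
  obtain c where c: "\<And>j. c j \<in> vring w E" "0 < w (z \<ominus> polyf c (p ^ (q - q)) y)" using chainD(8)[OF T z] by blast
  have "polyf c (p ^ (q - q)) y = c 0" using OE_coeffs(2)[of c, OF c(1)] chain_y(4)[OF T] by simp
  then show ?thesis using c by auto
qed

text \<open>Coefficients in T may be replaced by congruent ones in E, where
  \<open>alpha_indep\<close> applies.\<close>

lemma top_indep:
  assumes T: "chain q T y"
  shows "res_indep T \<alpha> (p ^ q)"
  unfolding res_indep_def
proof (intro allI impI)
  fix c j assume c: "\<forall>j. c j \<in> vring w T" "0 < w (polyf c (p ^ q) \<alpha>)" and j: "j < p ^ q"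
  have cR: "c j \<in> carrier R" for j using c(1) subfieldE(3)[OF chainD(1)[OF T]] by (auto simp: vring_def)
  have "\<forall>j. \<exists>b. b \<in> vring w E \<and> 0 < w (c j \<ominus> b)" using top_residue[OF T] c(1) by blast
  then obtain d where "\<forall>j. d j \<in> vring w E \<and> 0 < w (c j \<ominus> d j)" by metis
  then have d: "d j \<in> vring w E" "0 < w (c j \<ominus> d j)" for j by auto
  have dR: "d j \<in> carrier R" for j using OE_coeffs(2)[of d, OF d(1)] .
  have R: "polyf c (p ^ q) \<alpha> \<in> carrier R" "polyf d (p ^ q) \<alpha> \<in> carrier R"
    using polyf_closed(1)[of "p ^ q" _ \<alpha>] cR dR alpha(2) by auto
  have "0 < w (polyf c (p ^ q) \<alpha> \<ominus> polyf d (p ^ q) \<alpha>)"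
    by (rule polyf_cong_coeff[OF alpha(2,3) cR dR d(2)])
  then have "0 < w (polyf d (p ^ q) \<alpha>)" using cong_pos[OF R(2,1)] w_minus_commute[OF R] c(2) by simp
  then have "0 < w (d j)" using res_indepD[of E \<alpha> "p ^ q" d, OF alpha_indep d(1)] j by simp
  then show "0 < w (c j)" using cong_pos[OF cR dR d(2)] by simp
qed

text \<open>The powers of \<alpha> below p^q are independent over T because their residues are, so
  the degree is at least p^q; the descent gave at most p^q.\<close>

lemma top_dimension:
  assumes T: "chain q T y"
  shows "dimension (p ^ q) T L"
proof -
  note M = chainD(1)[OF T]
  have "independent T (exp_base \<alpha> (p ^ q))"
  proof (rule independent_exp_base_polyf[OF M alpha(2)])
    fix c :: "nat \<Rightarrow> 'a" and j assume c: "\<And>j. c j \<in> T" "polyf c (p ^ q) \<alpha> = \<zero>" "j < p ^ q"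
    show "c j = \<zero>"
    proof (rule ccontr)
      assume "c j \<noteq> \<zero>"
      then obtain k where k: "c k \<noteq> \<zero>" "w (polyf c (p ^ q) \<alpha>) = w (c k)"
        using res_indep_value[where c = c, OF M top_indep[OF T] alpha(2,3) c(1,3)] by blast
      then show False using w_inf[of "c k"] c(1)[of k] c(2) subfieldE(3)[OF M] by auto
    qed
  qed
  moreover have "set (exp_base \<alpha> (p ^ q)) \<subseteq> L" using L_closed(7)[OF alpha_L] by (auto simp: exp_base_def)
  moreover obtain d where d: "d \<le> p ^ q" "dimension d T L" using chainD(5)[OF T] by blast
  ultimately have "length (exp_base \<alpha> (p ^ q)) \<le> d" using independent_length_le_dimension[OF M d(2)] by blast
  then have "d = p ^ q" using d(1) by (simp add: exp_base_def)
  then show ?thesis using d(2) by simp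
qed

text \<open>The stability carried through the descent lets inertia act on T by restriction, with
  fixed field E.\<close>

lemma top_galois:
  assumes T: "chain q T y"
  shows "galois R E T"
proof -
  note M = chainD(1)[OF T]
  define S where "S = (\<lambda>s. restrict s T) ` inertia"
  have "automorphisms T S" "fixed T S = fixed L inertia \<inter> T"
    unfolding S_def by (rule automorphisms_restrict[OF KL(2) inertia_automorphisms M chainD(3)[OF T]];
      use chainD(4)[OF T] in blast)+
  moreover have "fixed L inertia \<inter> T = E" using chainD(2)[OF T] by (auto simp: E_def)
  ultimately show ?thesis using galois_fixed[OF M] by metis
qed

lemma top_case_I:
  assumes T: "chain q T y"
  shows "case_I R w E T"
proof -
  note M = chainD(1)[OF T]
  interpret Q: field "rf T" by (rule rf_field[OF M])
  have "x \<in> res_img R w E T" if x: "x \<in> carrier (rf T)" for x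
  proof -
    obtain z where z: "z \<in> vring w T" "x = cl T z" using x rf_carrier[OF M] by auto
    obtain b where b: "b \<in> vring w E" "0 < w (z \<ominus> b)" using top_residue[OF T z(1)] by blast
    have "b \<in> vring w T" using b(1) chainD(2)[OF T] by (auto simp: vring_def)
    then have "x = cl T b" using cl_eq_iff[OF M z(1)] b(2) z(2) by simp
    then show ?thesis using b(1) unfolding res_img_def by blast
  qed
  \<comment> \<open>All residue classes of T come from E, so \<open>separable_extI\<close> is
    applied with the empty set of maps and singletons as orbits.\<close>
  moreover have "\<exists>A. finite A \<and> a \<in> A \<and> A \<subseteq> carrier (rf T) \<and> (\<forall>s\<in>{}. s ` A = A)" if "a \<in> carrier (rf T)" for a
    using that by (intro exI[of _ "{a}"]) simp
  ultimately show ?thesis unfolding case_I_def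
    using Q.separable_extI[OF res_img_subfield[OF M E_subfield chainD(2)[OF T]], of "{}"] by blast
qed

text \<open>The residues of the powers of \<alpha> below p^q form a basis of k_L over k_T: they span
  by \<open>residue_expansion\<close> and are independent by \<open>top_indep\<close>. Hence both
  degrees are p^q, and the p^q-th power of the residue of \<alpha> is the residue of a, an element
  of E.\<close>

lemma top_case_II:
  assumes T: "chain q T y"
  shows "case_II R w p T L"
proof -
  note M = chainD(1)[OF T] and M_L = chainD(3)[OF T]
  interpret Q: field "rf L" by (rule rf_field[OF KL(2)])
  define F where "F = res_img R w T L"
  define A where "A = cl L \<alpha>"
  have F: "subfield F (rf L)" unfolding F_def by (rule res_img_subfield[OF KL(2) M M_L])
  have A: "A \<in> carrier (rf L)" unfolding A_def by (rule cl_simps(1)[OF KL(2) alpha(1)])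
  have TO: "x \<in> O\<^sub>L" if "x \<in> vring w T" for x using that M_L by (auto simp: vring_def)
  have ET: "x \<in> vring w T" if "x \<in> vring w E" for x using that chainD(2)[OF T] by (auto simp: vring_def)
  have FI: "cl L x \<in> F" if "x \<in> vring w T" for x using that unfolding F_def res_img_def by blast
  have expand: "\<exists>c. (\<forall>j. c j \<in> F) \<and> C = Q.polyf c (p ^ q) A" if C: "C \<in> carrier (rf L)" for C
  proof -
    obtain x where x: "x \<in> O\<^sub>L" "C = cl L x" using C rf_carrier[OF KL(2)] by auto
    obtain c where c: "\<And>j. c j \<in> vring w E" "0 < w (x \<ominus> polyf c (p ^ q) \<alpha>)" using residue_expansion[OF x(1)] by blast
    have "cl L x = cl L (polyf c (p ^ q) \<alpha>)"
      using cl_eq_iff[OF KL(2) x(1)] c(2) OL_polyf(1)[of c, OF OE_closed[OF c(1)] alpha(1)] by simp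
    also have "\<dots> = Q.polyf (\<lambda>j. cl L (c j)) (p ^ q) A"
      unfolding A_def by (rule cl_polyf(1)[OF KL(2) OE_closed[OF c(1)] alpha(1)])
    finally show ?thesis using x(2) FI[OF ET[OF c(1)]] by (intro exI[of _ "\<lambda>j. cl L (c j)"]) simp
  qed
  have "Q.Span F (Q.exp_base A (p ^ q)) = carrier (rf L)"
  proof
    show "carrier (rf L) \<subseteq> Q.Span F (Q.exp_base A (p ^ q))"
      using expand unfolding Q.Span_exp_base_polyf[OF F A] by blast
    show "Q.Span F (Q.exp_base A (p ^ q)) \<subseteq> carrier (rf L)"
      unfolding Q.Span_exp_base_polyf[OF F A] using Q.polyf_closed(1)[of "p ^ q" _ A] A subfieldE(3)[OF F] by blast
  qed
  moreover have "Q.independent F (Q.exp_base A (p ^ q))"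
  proof (rule Q.independent_exp_base_polyf[OF F A])
    fix c :: "nat \<Rightarrow> 'a set" and j assume c: "\<And>j. c j \<in> F" "Q.polyf c (p ^ q) A = \<zero>\<^bsub>rf L\<^esub>" "j < p ^ q"
    have "\<forall>j. \<exists>d. d \<in> vring w T \<and> c j = cl L d" using c(1) unfolding F_def res_img_def by blast
    then obtain d where "\<forall>j. d j \<in> vring w T \<and> c j = cl L (d j)" by metis
    then have d: "d j \<in> vring w T" "c j = cl L (d j)" for j by auto
    have "c = (\<lambda>j. cl L (d j))" using d(2) by auto
    then have "cl L (polyf d (p ^ q) \<alpha>) = \<zero>\<^bsub>rf L\<^esub>"
      using cl_polyf(1)[of L d \<alpha> "p ^ q", OF KL(2) TO[OF d(1)] alpha(1)] c(2) A_def by simp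
    then have "0 < w (polyf d (p ^ q) \<alpha>)"
      using cl_zero_iff[OF KL(2)] OL_polyf(1)[of d, OF TO[OF d(1)] alpha(1)] by blast
    then have "0 < w (d j)" using res_indepD[of T \<alpha> "p ^ q" d, OF top_indep[OF T] d(1)] c(3) by simp
    then show "c j = \<zero>\<^bsub>rf L\<^esub>" using cl_zero_iff[OF KL(2) TO[OF d(1)]] d(2) by simp
  qed
  ultimately have dQ: "Q.dimension (p ^ q) F (carrier (rf L))"
    using Q.dimension_independent[of F "Q.exp_base A (p ^ q)"] by (simp add: Q.exp_base_def)
  have gen: "carrier (rf L) = generate_field (rf L) (insert A F)"
  proof
    have sub: "insert A F \<subseteq> carrier (rf L)" using A subfieldE(3)[OF F] by blast
    show "generate_field (rf L) (insert A F) \<subseteq> carrier (rf L)" using Q.generate_field_incl[OF sub] .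
    show "carrier (rf L) \<subseteq> generate_field (rf L) (insert A F)"
    proof
      fix C assume "C \<in> carrier (rf L)"
      then obtain c where c: "\<And>j. c j \<in> F" "C = Q.polyf c (p ^ q) A" using expand by blast
      show "C \<in> generate_field (rf L) (insert A F)" unfolding c(2)
        by (rule Q.polyf_in_subring(1)[OF subfieldE(1)[OF Q.generate_field_is_subfield[OF sub]]])
          (use c(1) in \<open>auto intro: generate_field.incl\<close>)
    qed
  qed
  have "A [^]\<^bsub>rf L\<^esub> (p ^ q) = cl L (\<alpha> [^] (p ^ q))" unfolding A_def using cl_pow[OF KL(2) alpha(1)] by simp
  also have "\<dots> = cl L a" using cl_eq_iff[OF KL(2) alpha_pow(1) OE_closed[OF a(1)]] a(2) by simp
  finally have "A [^]\<^bsub>rf L\<^esub> (p ^ q) \<in> F" using FI[OF ET[OF a(1)]] by simp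
  moreover have "dim T L = p ^ q" "finite_dimension T L"
    using dimI[OF M top_dimension[OF T]] finite_dimensionI[OF top_dimension[OF T]] by (auto simp: over_def)
  moreover have "Q.dim F (carrier (rf L)) = p ^ q" "Q.finite_dimension F (carrier (rf L))"
    using Q.dimI[OF F dQ] Q.finite_dimensionI[OF dQ] by (auto simp: over_def)
  ultimately show ?thesis
    unfolding case_II_def res_deg_def F_def[symmetric] using A gen by auto
qed

end

lemma (in galois_valued) exists_ferocious_tower:
  assumes "well_ramified R w K L"
  shows "\<exists>T. galois R E T \<and> T \<subseteq> L \<and> case_I R w E T \<and> case_II R w p T L"
proof -
  obtain \<alpha> where \<alpha>: "\<alpha> \<in> L" "O\<^sub>L = generate_ring R (insert \<alpha> (vring w K))"
    using assms unfolding well_ramified_def by blast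
  define P where "P k \<longleftrightarrow> (\<exists>b\<in>vring w E. 0 < w (\<alpha> [^] (p ^ k) \<ominus> b))" for k
  have "\<alpha> \<in> O\<^sub>L" unfolding \<alpha>(2) by (intro generate_ring.incl) simp
  then have ex: "\<exists>k. P k" unfolding P_def by (rule residue_purely_inseparable)
  \<comment> \<open>The least exponent exists because k_L/k_E is purely inseparable.\<close>
  define q where "q = (LEAST k. P k)"
  have "P q" unfolding q_def by (rule LeastI_ex[OF ex])
  then obtain a where a: "a \<in> vring w E" "0 < w (\<alpha> [^] (p ^ q) \<ominus> a)" unfolding P_def by blast
  have min: "\<not> 0 < w (\<alpha> [^] (p ^ (q - 1)) \<ominus> b)" if b: "b \<in> vring w E" and q: "q > 0" for b
  proof -
    have "\<not> P (q - 1)" using q unfolding q_def by (intro not_less_Least) simp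
    then show ?thesis using b unfolding P_def by blast
  qed
  interpret monogenic R w K L p \<alpha> a q
    by unfold_locales (fact \<alpha>(2) \<alpha>(1) a min)+
  obtain T y where "chain q T y" using chain_exists[of q] by blast
  then show ?thesis using top_galois top_case_I top_case_II chainD(3) by blast
qed

theorem theorem2:
  fixes \<Omega> :: "('a, 'b) ring_scheme" and w :: "'a \<Rightarrow> ereal"
    and K L :: "'a set" and p :: nat
  assumes closure: "algebraic_closure \<Omega> K"
    and val: "valuation \<Omega> w"
    and disc: "discrete_on \<Omega> w K"
    and compl: "complete_on \<Omega> w K"
    and p_prime: "Factorial_Ring.prime p"
    and char_p: "add_pow \<Omega> p \<one>\<^bsub>\<Omega>\<^esub> \<in> vmax w K"
    and p_degree: "ring.finite_dimension (residue_field \<Omega> w K)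
                     {x [^]\<^bsub>residue_field \<Omega> w K\<^esub> p | x. x \<in> carrier (residue_field \<Omega> w K)}
                     (carrier (residue_field \<Omega> w K))"
    and gal_L: "galois \<Omega> K L"
    and p_ext: "\<exists>n. ring.dim \<Omega> K L = p ^ n"
    and wr: "well_ramified \<Omega> w K L"
  shows "\<exists>T. galois \<Omega> (L \<inter> K_ur \<Omega> w K) T \<and> T \<subseteq> L \<and>
             case_I \<Omega> w (L \<inter> K_ur \<Omega> w K) T \<and> case_II \<Omega> w p T L"
proof -
  interpret algebraic_closure \<Omega> K by (rule closure)
  interpret galois_valued \<Omega> w K L p
    by unfold_locales (fact val disc compl p_prime char_p gal_L p_ext)+
  show ?thesis unfolding E_eq using exists_ferocious_tower[OF wr] .
qed

end
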